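(* Let $R\subset S$ be a subintegral extension of commutative unital rings. The following statements are equivalent: (1) $R(X)\subset S(X)$ has FIP. (2) $R\subset S$ has FIP and is arithmetic.
   Context: All rings are commutative and unital. For a ring extension $R\subseteq S$, $[R,S]$ denotes the set of all $R$-subalgebras of $S$, ordered by inclusion. The extension has FIP if $[R,S]$ is finite. It is chained if $[R,S]$ is totally ordered by inclusion. It is arithmetic if $R_M\subseteq S_M$ is chained for each $M\in\mathrm{Supp}_R(S/R)$ (equivalently, for each prime, or each maximal, ideal $M$ of $R$), where $S_M:=S_{R\setminus M}$. An integral extension $R\subseteq S$ is subintegral if the map $\mathrm{Spec}(S)\to\mathrm{Spec}(R)$ is bijective and all residual extensions $R_P/PR_P\to S_Q/QS_Q$ (for $Q\in\mathrm{Spec}(S)$, $P:=Q\cap R$) are isomorphisms. For a ring $R$ and an indeterminate $X$, the Nagata ring of $R$ is $R(X):=R[X]_{\Sigma_R}$, where $\Sigma_R$ is the multiplicatively closed set of polynomials in $R[X]$ whose coefficients generate the unit ideal $R$; an extension $R\subseteq S$ induces an extension $R(X)\subseteq S(X)$. *)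

theory Defs
  imports "HOL-Algebra.UnivPoly" "HOL-Algebra.Subrings"
begin

section \<open>Ring extensions\<close>

text \<open>
  A ring extension is a subset \<open>R\<close> of a commutative ring \<open>S\<close> with \<^prop>\<open>subring R S\<close>;
  as a ring in its own right \<open>R\<close> is \<^term>\<open>subring_of S R\<close>.
\<close>

abbreviation subring_of :: "('a, 'm) ring_scheme \<Rightarrow> 'a set \<Rightarrow> ('a, 'm) ring_scheme" where
  "subring_of S R \<equiv> S\<lparr>carrier := R\<rparr>"

text \<open>The \<open>R\<close>-subalgebras of \<open>S\<close> are exactly the subrings of \<open>S\<close> containing \<open>R\<close>.\<close>

definition intermediate_rings :: "('a, 'm) ring_scheme \<Rightarrow> 'a set \<Rightarrow> 'a set set" where
  "intermediate_rings S R = {T. subring T S \<and> R \<subseteq> T}"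

definition has_FIP :: "('a, 'm) ring_scheme \<Rightarrow> 'a set \<Rightarrow> bool" where
  "has_FIP S R \<longleftrightarrow> finite (intermediate_rings S R)"

definition chained :: "('a, 'm) ring_scheme \<Rightarrow> 'a set \<Rightarrow> bool" where
  "chained S R \<longleftrightarrow> chain\<^sub>\<subseteq> (intermediate_rings S R)"

definition integral_extension :: "('a, 'm) ring_scheme \<Rightarrow> 'a set \<Rightarrow> bool" where
  "integral_extension S R \<longleftrightarrow>
     (\<forall>x \<in> carrier S. \<exists>(n::nat) c. c \<in> {..<n} \<rightarrow> R \<and>
        x [^]\<^bsub>S\<^esub> n \<oplus>\<^bsub>S\<^esub> (\<Oplus>\<^bsub>S\<^esub>i\<in>{..<n}. c i \<otimes>\<^bsub>S\<^esub> (x [^]\<^bsub>S\<^esub> i)) = \<zero>\<^bsub>S\<^esub>)"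


section \<open>Rings of fractions\<close>

text \<open>
  For a multiplicatively closed subset \<open>W\<close> of \<open>A\<close>, the elements of the localization
  are the classes of pairs \<open>(a, s)\<close>, read as \<open>a / s\<close>, under the usual relation
  (with the extra factor \<open>u\<close>, as \<open>W\<close> may contain zero divisors).
\<close>

definition fraction_rel :: "('a, 'm) ring_scheme \<Rightarrow> 'a set \<Rightarrow> (('a \<times> 'a) \<times> ('a \<times> 'a)) set" where
  "fraction_rel A W =
     {((a, s), (b, t)). a \<in> carrier A \<and> s \<in> W \<and> b \<in> carrier A \<and> t \<in> W \<and>
        (\<exists>u\<in>W. u \<otimes>\<^bsub>A\<^esub> (a \<otimes>\<^bsub>A\<^esub> t) = u \<otimes>\<^bsub>A\<^esub> (b \<otimes>\<^bsub>A\<^esub> s))}"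

definition fraction :: "('a, 'm) ring_scheme \<Rightarrow> 'a set \<Rightarrow> 'a \<Rightarrow> 'a \<Rightarrow> ('a \<times> 'a) set" where
  "fraction A W a s = fraction_rel A W `` {(a, s)}"

definition localization :: "('a, 'm) ring_scheme \<Rightarrow> 'a set \<Rightarrow> ('a \<times> 'a) set ring" where
  "localization A W =
     \<lparr>carrier = (carrier A \<times> W) // fraction_rel A W,
      mult = (\<lambda>x y. \<Union>(a, s)\<in>x. \<Union>(b, t)\<in>y. fraction A W (a \<otimes>\<^bsub>A\<^esub> b) (s \<otimes>\<^bsub>A\<^esub> t)),
      one = fraction A W \<one>\<^bsub>A\<^esub> \<one>\<^bsub>A\<^esub>,
      zero = fraction A W \<zero>\<^bsub>A\<^esub> \<one>\<^bsub>A\<^esub>,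
      add = (\<lambda>x y. \<Union>(a, s)\<in>x. \<Union>(b, t)\<in>y.
               fraction A W (a \<otimes>\<^bsub>A\<^esub> t \<oplus>\<^bsub>A\<^esub> b \<otimes>\<^bsub>A\<^esub> s) (s \<otimes>\<^bsub>A\<^esub> t))\<rparr>"

text \<open>
  If \<open>A\<close> is contained in \<open>B\<close> and \<open>V\<close> in \<open>W\<close>, the canonical map
  \<open>localization A V \<rightarrow> localization B W\<close>, sending \<open>a / s\<close> to \<open>a / s\<close>; see
  \<open>fraction_map_fraction\<close> below.
\<close>

definition fraction_map :: "('a, 'm) ring_scheme \<Rightarrow> 'a set \<Rightarrow> ('a \<times> 'a) set \<Rightarrow> ('a \<times> 'a) set" where
  "fraction_map B W x = (\<Union>(a, s)\<in>x. fraction B W a s)"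

locale multiplicative_set = cring A + submonoid W A for A (structure) and W
begin

lemma W_carrier: "s \<in> W \<Longrightarrow> s \<in> carrier A"
  using subset by blast

lemma fraction_rel_equiv: "equiv (carrier A \<times> W) (fraction_rel A W)"
proof (rule equivI)
  show "fraction_rel A W \<subseteq> (carrier A \<times> W) \<times> (carrier A \<times> W)"
    unfolding fraction_rel_def by auto
  show "refl_on (carrier A \<times> W) (fraction_rel A W)"
    unfolding fraction_rel_def refl_on_def using one_closed by auto
  show "sym (fraction_rel A W)"
    unfolding fraction_rel_def sym_def by (auto simp: eq_commute)
  show "trans (fraction_rel A W)"
  proof (rule transI)
    fix x y z assume "(x, y) \<in> fraction_rel A W" "(y, z) \<in> fraction_rel A W"
    then obtain a s b t c r u v where
      xyz: "x = (a, s)" "y = (b, t)" "z = (c, r)" and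
      A: "a \<in> carrier A" "b \<in> carrier A" "c \<in> carrier A" and
      W: "s \<in> W" "t \<in> W" "r \<in> W" "u \<in> W" "v \<in> W" and
      e1: "u \<otimes> (a \<otimes> t) = u \<otimes> (b \<otimes> s)" and e2: "v \<otimes> (b \<otimes> r) = v \<otimes> (c \<otimes> t)"
      unfolding fraction_rel_def by auto
    note C = W[THEN W_carrier]
    have "(u \<otimes> v \<otimes> t) \<otimes> (a \<otimes> r) = (u \<otimes> (a \<otimes> t)) \<otimes> (v \<otimes> r)"
      using A C by algebra
    also have "\<dots> = (v \<otimes> (b \<otimes> r)) \<otimes> (u \<otimes> s)"
      unfolding e1 using A C by algebra
    also have "\<dots> = (u \<otimes> v \<otimes> t) \<otimes> (c \<otimes> s)"
      unfolding e2 using A C by algebra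
    finally show "(x, z) \<in> fraction_rel A W"
      unfolding fraction_rel_def xyz using A W
      by (auto intro!: bexI[of _ "u \<otimes> v \<otimes> t"])
  qed
qed

lemma fraction_closed:
  "a \<in> carrier A \<Longrightarrow> s \<in> W \<Longrightarrow> fraction A W a s \<in> carrier (localization A W)"
  by (simp add: localization_def fraction_def quotientI)

lemma fraction_cases:
  assumes "x \<in> carrier (localization A W)"
  obtains a s where "a \<in> carrier A" "s \<in> W" "x = fraction A W a s"
  using assms by (auto simp: localization_def fraction_def elim!: quotientE)

lemma fraction_eq_iff:
  assumes "a \<in> carrier A" "s \<in> W" "b \<in> carrier A" "t \<in> W"
  shows "fraction A W a s = fraction A W b t \<longleftrightarrow>
           (\<exists>u\<in>W. u \<otimes> (a \<otimes> t) = u \<otimes> (b \<otimes> s))"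
  using eq_equiv_class_iff[OF fraction_rel_equiv, of "(a, s)" "(b, t)"] assms
  by (auto simp: fraction_def fraction_rel_def)

lemma in_fraction_iff:
  assumes "a \<in> carrier A" "s \<in> W"
  shows "(b, t) \<in> fraction A W a s \<longleftrightarrow>
           b \<in> carrier A \<and> t \<in> W \<and> fraction A W b t = fraction A W a s"
  using fraction_eq_iff[OF assms, of b t] assms
  by (auto simp: fraction_def fraction_rel_def)

lemma UN_fraction:
  assumes "a \<in> carrier A" "s \<in> W"
    and "\<And>b t. b \<in> carrier A \<Longrightarrow> t \<in> W \<Longrightarrow> fraction A W b t = fraction A W a s \<Longrightarrow> f b t = f a s"
  shows "(\<Union>(b, t)\<in>fraction A W a s. f b t) = f a s"
proof -
  have "(a, s) \<in> fraction A W a s" using assms by (simp add: in_fraction_iff)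
  moreover have "f b t = f a s" if "(b, t) \<in> fraction A W a s" for b t
    using that assms(3)[of b t] by (simp add: in_fraction_iff assms(1,2))
  then have "(\<Union>(b, t)\<in>fraction A W a s. f b t) = (\<Union>_\<in>fraction A W a s. f a s)"
    by (intro SUP_cong[OF refl]) (simp only: split_paired_all prod.case)
  ultimately show ?thesis by (metis SUP_const empty_iff)
qed

lemma fraction_mult:
  assumes "a \<in> carrier A" "s \<in> W" "b \<in> carrier A" "t \<in> W"
  shows "fraction A W a s \<otimes>\<^bsub>localization A W\<^esub> fraction A W b t = fraction A W (a \<otimes> b) (s \<otimes> t)"
proof -
  have *: "fraction A W (a' \<otimes> b') (s' \<otimes> t') = fraction A W (a \<otimes> b) (s \<otimes> t)"
    if H: "a \<in> carrier A" "s \<in> W" "b \<in> carrier A" "t \<in> W"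
      "a' \<in> carrier A" "s' \<in> W" "b' \<in> carrier A" "t' \<in> W"
      "fraction A W a' s' = fraction A W a s" "fraction A W b' t' = fraction A W b t"
    for a s b t a' s' b' t'
  proof -
    from H obtain u v where uv: "u \<in> W" "v \<in> W"
      and e1: "u \<otimes> (a' \<otimes> s) = u \<otimes> (a \<otimes> s')" and e2: "v \<otimes> (b' \<otimes> t) = v \<otimes> (b \<otimes> t')"
      by (auto simp: fraction_eq_iff)
    note C = H(1,3,5,7) H(2,4,6,8)[THEN W_carrier] uv[THEN W_carrier]
    have "(u \<otimes> v) \<otimes> ((a' \<otimes> b') \<otimes> (s \<otimes> t)) = (u \<otimes> (a' \<otimes> s)) \<otimes> (v \<otimes> (b' \<otimes> t))"
      using C by algebra
    also have "\<dots> = (u \<otimes> v) \<otimes> ((a \<otimes> b) \<otimes> (s' \<otimes> t'))"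
      unfolding e1 e2 using C by algebra
    finally show ?thesis
      using H uv by (subst fraction_eq_iff) (auto intro!: bexI[of _ "u \<otimes> v"])
  qed
  have inner: "(\<Union>(b', t')\<in>fraction A W b t. fraction A W (a' \<otimes> b') (s' \<otimes> t')) = fraction A W (a' \<otimes> b) (s' \<otimes> t)"
    if "a' \<in> carrier A" "s' \<in> W" for a' s'
    by (rule UN_fraction[OF assms(3,4)], rule *) (use assms that in simp_all)
  have "fraction A W a s \<otimes>\<^bsub>localization A W\<^esub> fraction A W b t
      = (\<Union>(a', s')\<in>fraction A W a s. \<Union>(b', t')\<in>fraction A W b t. fraction A W (a' \<otimes> b') (s' \<otimes> t'))"
    by (simp add: localization_def)
  also have "\<dots> = (\<Union>(a', s')\<in>fraction A W a s. fraction A W (a' \<otimes> b) (s' \<otimes> t))"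
  proof (rule SUP_cong[OF refl], clarify)
    fix a' s' assume "(a', s') \<in> fraction A W a s"
    then have "a' \<in> carrier A" "s' \<in> W"
      using in_fraction_iff[OF assms(1,2)] by blast+
    then show "(\<Union>(b', t')\<in>fraction A W b t. fraction A W (a' \<otimes> b') (s' \<otimes> t')) = fraction A W (a' \<otimes> b) (s' \<otimes> t)"
      by (rule inner)
  qed
  also have "\<dots> = fraction A W (a \<otimes> b) (s \<otimes> t)"
    by (rule UN_fraction[OF assms(1,2)], rule *) (use assms in simp_all)
  finally show ?thesis .
qed

lemma fraction_add:
  assumes "a \<in> carrier A" "s \<in> W" "b \<in> carrier A" "t \<in> W"
  shows "fraction A W a s \<oplus>\<^bsub>localization A W\<^esub> fraction A W b t
           = fraction A W (a \<otimes> t \<oplus> b \<otimes> s) (s \<otimes> t)"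
proof -
  have *: "fraction A W (a' \<otimes> t' \<oplus> b' \<otimes> s') (s' \<otimes> t') = fraction A W (a \<otimes> t \<oplus> b \<otimes> s) (s \<otimes> t)"
    if H: "a \<in> carrier A" "s \<in> W" "b \<in> carrier A" "t \<in> W"
      "a' \<in> carrier A" "s' \<in> W" "b' \<in> carrier A" "t' \<in> W"
      "fraction A W a' s' = fraction A W a s" "fraction A W b' t' = fraction A W b t"
    for a s b t a' s' b' t'
  proof -
    from H obtain u v where uv: "u \<in> W" "v \<in> W"
      and e1: "u \<otimes> (a' \<otimes> s) = u \<otimes> (a \<otimes> s')" and e2: "v \<otimes> (b' \<otimes> t) = v \<otimes> (b \<otimes> t')"
      by (auto simp: fraction_eq_iff)
    note C = H(1,3,5,7) H(2,4,6,8)[THEN W_carrier] uv[THEN W_carrier]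
    have "(u \<otimes> v) \<otimes> ((a' \<otimes> t' \<oplus> b' \<otimes> s') \<otimes> (s \<otimes> t))
        = (u \<otimes> (a' \<otimes> s)) \<otimes> (v \<otimes> t \<otimes> t') \<oplus> (v \<otimes> (b' \<otimes> t)) \<otimes> (u \<otimes> s \<otimes> s')"
      using C by algebra
    also have "\<dots> = (u \<otimes> v) \<otimes> ((a \<otimes> t \<oplus> b \<otimes> s) \<otimes> (s' \<otimes> t'))"
      unfolding e1 e2 using C by algebra
    finally show ?thesis
      using H uv C by (subst fraction_eq_iff) (auto intro!: bexI[of _ "u \<otimes> v"])
  qed
  have inner: "(\<Union>(b', t')\<in>fraction A W b t. fraction A W (a' \<otimes> t' \<oplus> b' \<otimes> s') (s' \<otimes> t')) = fraction A W (a' \<otimes> t \<oplus> b \<otimes> s') (s' \<otimes> t)"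
    if "a' \<in> carrier A" "s' \<in> W" for a' s'
    by (rule UN_fraction[OF assms(3,4)], rule *) (use assms that in simp_all)
  have "fraction A W a s \<oplus>\<^bsub>localization A W\<^esub> fraction A W b t
      = (\<Union>(a', s')\<in>fraction A W a s. \<Union>(b', t')\<in>fraction A W b t. fraction A W (a' \<otimes> t' \<oplus> b' \<otimes> s') (s' \<otimes> t'))"
    by (simp add: localization_def)
  also have "\<dots> = (\<Union>(a', s')\<in>fraction A W a s. fraction A W (a' \<otimes> t \<oplus> b \<otimes> s') (s' \<otimes> t))"
  proof (rule SUP_cong[OF refl], clarify)
    fix a' s' assume "(a', s') \<in> fraction A W a s"
    then have "a' \<in> carrier A" "s' \<in> W"
      using in_fraction_iff[OF assms(1,2)] by blast+
    then show "(\<Union>(b', t')\<in>fraction A W b t. fraction A W (a' \<otimes> t' \<oplus> b' \<otimes> s') (s' \<otimes> t')) = fraction A W (a' \<otimes> t \<oplus> b \<otimes> s') (s' \<otimes> t)"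
      by (rule inner)
  qed
  also have "\<dots> = fraction A W (a \<otimes> t \<oplus> b \<otimes> s) (s \<otimes> t)"
    by (rule UN_fraction[OF assms(1,2)], rule *) (use assms in simp_all)
  finally show ?thesis .
qed

lemma fraction_one: "\<one>\<^bsub>localization A W\<^esub> = fraction A W \<one> \<one>"
  and fraction_zero: "\<zero>\<^bsub>localization A W\<^esub> = fraction A W \<zero> \<one>"
  by (simp_all add: localization_def)

lemma fraction_eqI:
  assumes "a \<in> carrier A" "s \<in> W" "b \<in> carrier A" "t \<in> W" "a \<otimes> t = b \<otimes> s"
  shows "fraction A W a s = fraction A W b t"
  using assms one_closed by (subst fraction_eq_iff) auto

lemma localization_cring: "cring (localization A W)"
proof (rule cringI)
  show "abelian_group (localization A W)"
  proof (rule abelian_groupI, goal_cases)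
    case (1 x y) then show ?case
      by (elim fraction_cases) (simp add: fraction_add fraction_closed W_carrier)
  next
    case 2 show ?case by (simp add: fraction_zero fraction_closed)
  next
    case (3 x y z)
    then obtain a s b t c r where xyz: "x = fraction A W a s" "y = fraction A W b t"
        "z = fraction A W c r" and H: "a \<in> carrier A" "b \<in> carrier A" "c \<in> carrier A"
        "s \<in> W" "t \<in> W" "r \<in> W"
      by (elim fraction_cases) blast
    note C = H(1-3) H(4-6)[THEN W_carrier]
    have *: "((a \<otimes> t \<oplus> b \<otimes> s) \<otimes> r \<oplus> c \<otimes> (s \<otimes> t)) \<otimes> (s \<otimes> (t \<otimes> r)) =
          (a \<otimes> (t \<otimes> r) \<oplus> (b \<otimes> r \<oplus> c \<otimes> t) \<otimes> s) \<otimes> (s \<otimes> t \<otimes> r)"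
      using C by algebra
    have "(x \<oplus>\<^bsub>localization A W\<^esub> y) \<oplus>\<^bsub>localization A W\<^esub> z =
        fraction A W ((a \<otimes> t \<oplus> b \<otimes> s) \<otimes> r \<oplus> c \<otimes> (s \<otimes> t)) (s \<otimes> t \<otimes> r)"
      unfolding xyz using H C by (simp add: fraction_add)
    also have "\<dots> = fraction A W (a \<otimes> (t \<otimes> r) \<oplus> (b \<otimes> r \<oplus> c \<otimes> t) \<otimes> s) (s \<otimes> (t \<otimes> r))"
      by (rule fraction_eqI[OF _ _ _ _ *]) (use H C in simp_all)
    also have "\<dots> = x \<oplus>\<^bsub>localization A W\<^esub> (y \<oplus>\<^bsub>localization A W\<^esub> z)"
      unfolding xyz using H C by (simp add: fraction_add)
    finally show ?case .
  next
    case (4 x y)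
    then obtain a s b t where xy: "x = fraction A W a s" "y = fraction A W b t"
      and H: "a \<in> carrier A" "b \<in> carrier A" "s \<in> W" "t \<in> W"
      by (elim fraction_cases) blast
    then show ?case by (simp add: fraction_add W_carrier a_comm m_comm)
  next
    case (5 x) then show ?case
      by (elim fraction_cases) (simp add: fraction_add fraction_zero W_carrier)
  next
    case (6 x)
    then obtain a s where x: "x = fraction A W a s" and H: "a \<in> carrier A" "s \<in> W"
      by (elim fraction_cases) blast
    note C = H(1) W_carrier[OF H(2)]
    have *: "(\<ominus> a \<otimes> s \<oplus> a \<otimes> s) \<otimes> \<one> = \<zero> \<otimes> (s \<otimes> s)" using C by algebra
    have "fraction A W (\<ominus> a) s \<oplus>\<^bsub>localization A W\<^esub> x
        = fraction A W (\<ominus> a \<otimes> s \<oplus> a \<otimes> s) (s \<otimes> s)"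
      unfolding x using H by (simp add: fraction_add)
    also have "\<dots> = \<zero>\<^bsub>localization A W\<^esub>"
      unfolding fraction_zero by (rule fraction_eqI[OF _ _ _ _ *]) (use H C in simp_all)
    finally show ?case by (rule bexI) (use H in \<open>simp add: fraction_closed\<close>)
  qed
  show "comm_monoid (localization A W)"
  proof (rule comm_monoidI, goal_cases)
    case (1 x y) then show ?case
      by (elim fraction_cases) (simp add: fraction_mult fraction_closed)
  next
    case 2 show ?case by (simp add: fraction_one fraction_closed)
  next
    case (3 x y z) then show ?case
      by (elim fraction_cases) (simp add: fraction_mult W_carrier m_assoc)
  next
    case (4 x) then show ?case
      by (elim fraction_cases) (simp add: fraction_mult fraction_one W_carrier)
  next
    case (5 x y) then show ?case
      by (elim fraction_cases) (simp add: fraction_mult W_carrier m_comm)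
  qed
  fix x y z assume "x \<in> carrier (localization A W)" "y \<in> carrier (localization A W)"
    "z \<in> carrier (localization A W)"
  then obtain a s b t c r where xyz: "x = fraction A W a s" "y = fraction A W b t"
      "z = fraction A W c r" and H: "a \<in> carrier A" "b \<in> carrier A" "c \<in> carrier A"
      "s \<in> W" "t \<in> W" "r \<in> W"
    by (elim fraction_cases) blast
  note C = H(1-3) H(4-6)[THEN W_carrier]
  have *: "((a \<otimes> t \<oplus> b \<otimes> s) \<otimes> c) \<otimes> (s \<otimes> r \<otimes> (t \<otimes> r)) =
        (a \<otimes> c \<otimes> (t \<otimes> r) \<oplus> b \<otimes> c \<otimes> (s \<otimes> r)) \<otimes> (s \<otimes> t \<otimes> r)"
    using C by algebra
  have "(x \<oplus>\<^bsub>localization A W\<^esub> y) \<otimes>\<^bsub>localization A W\<^esub> z =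
      fraction A W ((a \<otimes> t \<oplus> b \<otimes> s) \<otimes> c) (s \<otimes> t \<otimes> r)"
    unfolding xyz using H C by (simp add: fraction_add fraction_mult)
  also have "\<dots> = fraction A W (a \<otimes> c \<otimes> (t \<otimes> r) \<oplus> b \<otimes> c \<otimes> (s \<otimes> r)) (s \<otimes> r \<otimes> (t \<otimes> r))"
    by (rule fraction_eqI[OF _ _ _ _ *]) (use H C in simp_all)
  also have "\<dots> = x \<otimes>\<^bsub>localization A W\<^esub> z \<oplus>\<^bsub>localization A W\<^esub> y \<otimes>\<^bsub>localization A W\<^esub> z"
    unfolding xyz using H C by (simp add: fraction_add fraction_mult)
  finally show "(x \<oplus>\<^bsub>localization A W\<^esub> y) \<otimes>\<^bsub>localization A W\<^esub> z =
      x \<otimes>\<^bsub>localization A W\<^esub> z \<oplus>\<^bsub>localization A W\<^esub> y \<otimes>\<^bsub>localization A W\<^esub> z" .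
qed

end

lemma fraction_map_fraction:
  fixes A B :: "('a, 'm) ring_scheme"
  assumes "multiplicative_set A V" "multiplicative_set B W"
    and "carrier A \<subseteq> carrier B" "V \<subseteq> W"
    and mult: "\<And>x y. x \<in> carrier A \<Longrightarrow> y \<in> carrier A \<Longrightarrow> x \<otimes>\<^bsub>A\<^esub> y = x \<otimes>\<^bsub>B\<^esub> y"
    and a: "a \<in> carrier A" "s \<in> V"
  shows "fraction_map B W (fraction A V a s) = fraction B W a s"
proof -
  interpret A: multiplicative_set A V by fact
  interpret B: multiplicative_set B W by fact
  show ?thesis
    unfolding fraction_map_def
  proof (rule A.UN_fraction[OF a])
    fix b t assume b: "b \<in> carrier A" "t \<in> V" "fraction A V b t = fraction A V a s"
    from iffD1[OF A.fraction_eq_iff[OF b(1,2) a] b(3)]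
    obtain u where u: "u \<in> V" "u \<otimes>\<^bsub>A\<^esub> (b \<otimes>\<^bsub>A\<^esub> s) = u \<otimes>\<^bsub>A\<^esub> (a \<otimes>\<^bsub>A\<^esub> t)"
      by blast
    have C: "s \<in> carrier A" "t \<in> carrier A" "u \<in> carrier A"
      by (rule A.W_carrier, fact)+
    have "u \<otimes>\<^bsub>B\<^esub> (b \<otimes>\<^bsub>B\<^esub> s) = u \<otimes>\<^bsub>B\<^esub> (a \<otimes>\<^bsub>B\<^esub> t)"
      using u(2)
      unfolding mult[OF b(1) C(1)] mult[OF a(1) C(2)]
        mult[OF C(3) monoid.m_closed[OF A.monoid_axioms b(1) C(1)], unfolded mult[OF b(1) C(1)]]
        mult[OF C(3) monoid.m_closed[OF A.monoid_axioms a(1) C(2)], unfolded mult[OF a(1) C(2)]] .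
    moreover have "a \<in> carrier B" "b \<in> carrier B" "s \<in> W" "t \<in> W" "u \<in> W"
      using a b(1,2) u(1) assms(3,4) by auto
    ultimately show "fraction B W b t = fraction B W a s"
      by (intro iffD2[OF B.fraction_eq_iff] bexI)
  qed
qed


section \<open>Arithmetic extensions\<close>

text \<open>
  \<open>S\<^sub>M\<close> is the localization of \<open>S\<close> at \<open>R - M\<close>, and \<open>R\<^sub>M\<close> is regarded as a subring of it
  through the canonical map.
\<close>

definition chained_at :: "('a, 'm) ring_scheme \<Rightarrow> 'a set \<Rightarrow> 'a set \<Rightarrow> bool" where
  "chained_at S R M \<longleftrightarrow>
     chained (localization S (R - M))
       (fraction_map S (R - M) ` carrier (localization (subring_of S R) (R - M)))"

text \<open>
  The support of the \<open>R\<close>-module \<open>S/R\<close>: the class of \<open>x\<close> in \<open>S/R\<close> vanishes in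
  \<open>(S/R)\<^sub>M\<close> iff \<open>u x \<in> R\<close> for some \<open>u \<in> R - M\<close>.
\<close>

definition support_quotient :: "('a, 'm) ring_scheme \<Rightarrow> 'a set \<Rightarrow> 'a set set" where
  "support_quotient S R =
     {M. primeideal M (subring_of S R) \<and> (\<exists>x\<in>carrier S. \<forall>u\<in>R - M. u \<otimes>\<^bsub>S\<^esub> x \<notin> R)}"

definition arithmetic :: "('a, 'm) ring_scheme \<Rightarrow> 'a set \<Rightarrow> bool" where
  "arithmetic S R \<longleftrightarrow> (\<forall>M \<in> support_quotient S R. chained_at S R M)"


section \<open>Subintegral extensions\<close>

definition prime_spectrum :: "('a, 'm) ring_scheme \<Rightarrow> 'a set set" where
  "prime_spectrum A = {P. primeideal P A}"

definition local_ring_at :: "('a, 'm) ring_scheme \<Rightarrow> 'a set \<Rightarrow> ('a \<times> 'a) set ring" where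
  "local_ring_at A P = localization A (carrier A - P)"

definition extended_prime :: "('a, 'm) ring_scheme \<Rightarrow> 'a set \<Rightarrow> ('a \<times> 'a) set set" where
  "extended_prime A P =
     Idl\<^bsub>local_ring_at A P\<^esub> ((\<lambda>p. fraction A (carrier A - P) p \<one>\<^bsub>A\<^esub>) ` P)"

definition residue_field :: "('a, 'm) ring_scheme \<Rightarrow> 'a set \<Rightarrow> ('a \<times> 'a) set set ring" where
  "residue_field A P = local_ring_at A P Quot extended_prime A P"

text \<open>
  For \<open>P = Q \<inter> R\<close>, the map \<open>R\<^sub>P/PR\<^sub>P \<rightarrow> S\<^sub>Q/QS\<^sub>Q\<close>
  induced by the canonical map \<open>R\<^sub>P \<rightarrow> S\<^sub>Q\<close>: a coset \<open>C\<close> of \<open>PR\<^sub>P\<close> is sent to the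
  coset of \<open>QS\<^sub>Q\<close> of the image of any of its elements.
\<close>

definition residual_map ::
  "('a, 'm) ring_scheme \<Rightarrow> 'a set \<Rightarrow> ('a \<times> 'a) set set \<Rightarrow> ('a \<times> 'a) set set" where
  "residual_map S Q C =
     (\<Union>x\<in>C. extended_prime S Q +>\<^bsub>local_ring_at S Q\<^esub> fraction_map S (carrier S - Q) x)"

definition subintegral :: "('a, 'm) ring_scheme \<Rightarrow> 'a set \<Rightarrow> bool" where
  "subintegral S R \<longleftrightarrow>
     integral_extension S R \<and>
     bij_betw (\<lambda>Q. Q \<inter> R) (prime_spectrum S) (prime_spectrum (subring_of S R)) \<and>
     (\<forall>Q \<in> prime_spectrum S.
        residual_map S Q \<in> ring_iso (residue_field (subring_of S R) (Q \<inter> R)) (residue_field S Q))"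


section \<open>Nagata rings\<close>

definition unit_content :: "('a, 'm) ring_scheme \<Rightarrow> (nat \<Rightarrow> 'a) set" where
  "unit_content A = {p \<in> carrier (UP A). Idl\<^bsub>A\<^esub> (range (coeff (UP A) p)) = carrier A}"

definition Nagata :: "('a, 'm) ring_scheme \<Rightarrow> ((nat \<Rightarrow> 'a) \<times> (nat \<Rightarrow> 'a)) set ring" where
  "Nagata A = localization (UP A) (unit_content A)"

text \<open>\<open>R(X)\<close> as a subring of \<open>S(X)\<close>, through the canonical map \<open>R(X) \<rightarrow> S(X)\<close>.\<close>

definition Nagata_subring ::
  "('a, 'm) ring_scheme \<Rightarrow> 'a set \<Rightarrow> ((nat \<Rightarrow> 'a) \<times> (nat \<Rightarrow> 'a)) set set" where
  "Nagata_subring S R =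
     fraction_map (UP S) (unit_content S) ` carrier (Nagata (subring_of S R))"

end

theory Submission
  imports Defs
begin

text \<open>
  For a prime \<open>M\<close> of \<open>R\<close> with the unique prime \<open>Q\<close> of \<open>S\<close> above it, \<open>R\<^sub>M \<subseteq> S\<^sub>M\<close> is chained iff for all
  \<open>x, y \<in> S\<close> one of \<open>x \<in> R[y]\<close>, \<open>y \<in> R[x]\<close> holds up to a factor in \<open>R - M\<close>; as the residue fields agree,
  one may take \<open>x, y \<in> Q\<close>. The engine is a Nakayama argument: if \<open>y\<close> is integral, nilpotent modulo \<open>M\<close>, and
  \<open>z = y v\<close> with \<open>v \<in> R[y]\<close> invertible at \<open>M\<close>, then \<open>y \<in> R[z]\<close> locally.

  If \<open>R(X) \<subseteq> S(X)\<close> has FIP, then \<open>T \<mapsto> T(X)\<close> embeds \<open>[R, S]\<close> into \<open>[R(X), S(X)]\<close>. Moreover two of the rings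
  \<open>R(X)[x + X\<^sup>i y]\<close> coincide, so that \<open>g x\<close> is a polynomial in \<open>x + X\<^sup>i y\<close> for some \<open>g\<close> of unit content;
  comparing coefficients and applying the engine over \<open>R[x]\<close> or \<open>R[y]\<close> makes \<open>x\<close> and \<open>y\<close> comparable.

  Conversely, among the coefficients of \<open>F \<in> S[X]\<close> there is locally a largest one. Translating a multiple of
  it to \<open>x \<in> Q\<close> gives \<open>z = x v\<close> with \<open>z \<in> R[X][F]\<close> and \<open>v\<close> invertible at \<open>M[X]\<close>, and the engine over \<open>R[X]\<close>
  shows that \<open>R(X)[F]\<close> contains all coefficients of \<open>F\<close>. Hence a ring in \<open>[R(X), S(X)]\<close> is determined by its
  trace on \<open>S\<close>.
\<close>

section \<open>Values of polynomials at an element\<close>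

text \<open>In the locales below, \<open>R\<close> is the overring (the \<open>S\<close> of the
  theorem), \<open>A\<close> the base ring and \<open>I\<close> a prime of \<open>A\<close>. The
  obstacle is that the overring is integral but not assumed finite over \<open>A\<close>, so
  Nakayama is applied to \<open>A[y]\<close> for a single integral \<open>y\<close>, where finitely
  many powers are generators. The engine asks only for an integral equation and for nilpotency
  modulo the prime. Both pass to the larger base \<open>A[x]\<close> and to constant polynomials
  over \<open>A[X]\<close>, whereas a unique prime above need not be re-established there. The
  ingredients of subintegrality enter separately: integrality and bijectivity on spectra show that
  every element outside \<open>Q\<close> divides an element of \<open>A - I\<close>; the residue
  isomorphisms serve to move elements into \<open>Q\<close> by subtracting a base element. Local
  conclusions are glued by the fact that an ideal of \<open>A[X]\<close> contained in no
  \<open>M[X]\<close>, \<open>M\<close> a prime of \<open>A\<close>, contains a polynomial of unit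
  content. The same fact trades the denominators of \<open>S(X)\<close> for denominators of
  \<open>R(X)\<close>.\<close>

inductive_set poly_values :: "('a, 'm) ring_scheme \<Rightarrow> 'a set \<Rightarrow> 'a \<Rightarrow> 'a set"
  for B (structure) and I and y where
  const: "c \<in> I \<Longrightarrow> c \<in> poly_values B I y"
| step: "c \<in> I \<Longrightarrow> t \<in> poly_values B I y \<Longrightarrow> c \<oplus> y \<otimes> t \<in> poly_values B I y"

text \<open>The truncated counterpart of \<open>poly_values\<close>. An integral equation of degree
  \<open>n\<close> is used in the form \<open>y [^] n \<in> power_span B A y n\<close>; for
  \<open>n = 0\<close> it says that the ring is trivial. Here the top power is split off, in
  \<open>poly_values\<close> the constant term: Nakayama eliminates generators from the top, while
  the other arguments divide by \<open>y\<close>.\<close>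

primrec power_span :: "('a, 'm) ring_scheme \<Rightarrow> 'a set \<Rightarrow> 'a \<Rightarrow> nat \<Rightarrow> 'a set" where
  "power_span B I y 0 = {\<zero>\<^bsub>B\<^esub>}"
| "power_span B I y (Suc n) = {s \<oplus>\<^bsub>B\<^esub> c \<otimes>\<^bsub>B\<^esub> y [^]\<^bsub>B\<^esub> n | s c. s \<in> power_span B I y n \<and> c \<in> I}"

text \<open>\<open>A\<close> is merely a set of multipliers. Negatives come from
  \<open>\<ominus> \<one> \<in> A\<close> when \<open>A\<close> is a subring, and
  \<open>A = {}\<close> leaves just closure under finite sums.\<close>

definition submod :: "('a, 'm) ring_scheme \<Rightarrow> 'a set \<Rightarrow> 'a set \<Rightarrow> bool" where
  "submod B A K \<longleftrightarrow> K \<subseteq> carrier B \<and> \<zero>\<^bsub>B\<^esub> \<in> K \<and>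
     (\<forall>a\<in>K. \<forall>b\<in>K. a \<oplus>\<^bsub>B\<^esub> b \<in> K) \<and> (\<forall>a\<in>A. \<forall>b\<in>K. a \<otimes>\<^bsub>B\<^esub> b \<in> K)"

lemma submodD:
  assumes "submod B A K"
  shows "a \<in> K \<Longrightarrow> a \<in> carrier B" "\<zero>\<^bsub>B\<^esub> \<in> K"
    "a \<in> K \<Longrightarrow> b \<in> K \<Longrightarrow> a \<oplus>\<^bsub>B\<^esub> b \<in> K" "c \<in> A \<Longrightarrow> b \<in> K \<Longrightarrow> c \<otimes>\<^bsub>B\<^esub> b \<in> K"
  using assms unfolding submod_def by auto

lemma submodI:
  assumes "K \<subseteq> carrier B" "\<zero>\<^bsub>B\<^esub> \<in> K" "\<And>a b. a \<in> K \<Longrightarrow> b \<in> K \<Longrightarrow> a \<oplus>\<^bsub>B\<^esub> b \<in> K"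
    "\<And>a b. a \<in> A \<Longrightarrow> b \<in> K \<Longrightarrow> a \<otimes>\<^bsub>B\<^esub> b \<in> K"
  shows "submod B A K"
  using assms unfolding submod_def by auto

lemma subring_submod: "subring A B \<Longrightarrow> submod B A A"
  by (rule submodI) (use subringE[of A B] in auto)

lemma poly_values_mono:
  assumes "I \<subseteq> J" shows "poly_values B I y \<subseteq> poly_values B J y"
proof
  fix t assume "t \<in> poly_values B I y"
  then show "t \<in> poly_values B J y"
    by induct (use assms in \<open>auto intro: poly_values.intros\<close>)
qed

lemma power_span_mono:
  "I \<subseteq> J \<Longrightarrow> power_span B I y n \<subseteq> power_span B J y n"
  by (induct n) fastforce+

context cring
begin

lemma submod_neg:
  assumes "submod R A K" "subring A R" "b \<in> K" shows "\<ominus> b \<in> K"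
proof -
  have "\<ominus> \<one> \<otimes> b \<in> K"
    using submodD(4)[OF assms(1) _ assms(3)] subringE(3,5)[OF assms(2)] by blast
  then show ?thesis using submodD(1)[OF assms(1,3)] by (simp add: l_minus)
qed

text \<open>With \<open>I = A\<close> this is the ring structure of \<open>A[y]\<close>; with
  \<open>I\<close> an ideal of \<open>A\<close> it treats the extended ideal
  \<open>I A[y]\<close>.\<close>

lemma submod_poly_values:
  assumes A: "subring A R" and I: "submod R A I" and y: "y \<in> carrier R"
  shows "submod R (poly_values R A y) (poly_values R I y)"
proof -
  have c: "t \<in> carrier R" if "t \<in> poly_values R J y" "J \<subseteq> carrier R" for t J
    using that by induct (use y in auto)
  note IC = submodD(1)[OF I] and I0 = submodD(2)[OF I] and Ia = submodD(3)[OF I] and Im = submodD(4)[OF I]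
  note AC = subsetD[OF subringE(1)[OF A]]
  have cI: "t \<in> carrier R" if "t \<in> poly_values R I y" for t
    using c[OF that] IC by blast
  have cA: "t \<in> carrier R" if "t \<in> poly_values R A y" for t
    using c[OF that] AC by blast
  have add: "s \<oplus> t \<in> poly_values R I y" if "s \<in> poly_values R I y" "t \<in> poly_values R I y" for s t
    using that
  proof (induct s arbitrary: t)
    case (const c)
    note c = this
    from c(2) show ?case
    proof cases
      case const then show ?thesis using c Ia by (auto intro: poly_values.intros)
    next
      case (step d u)
      have "c \<oplus> t = (c \<oplus> d) \<oplus> y \<otimes> u"
        using step c IC cI y by (simp add: a_assoc)
      then show ?thesis using c step Ia by (auto intro: poly_values.intros)
    qed
  next
    case (step c s)
    note c = this
    from c(4) show ?case
    proof cases
      case const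
      have "(c \<oplus> y \<otimes> s) \<oplus> t = (c \<oplus> t) \<oplus> y \<otimes> s"
        using const c IC[OF c(1)] IC[OF const] cI[OF c(2)] y by algebra
      then show ?thesis using c const Ia by (auto intro: poly_values.intros)
    next
      case (step d u)
      have "(c \<oplus> y \<otimes> s) \<oplus> t = (c \<oplus> d) \<oplus> y \<otimes> (s \<oplus> u)"
        unfolding step(1) using IC[OF c(1)] IC[OF step(2)] cI[OF c(2)] cI[OF step(3)] y by algebra
      then show ?thesis using c step Ia by (auto intro: poly_values.intros)
    qed
  qed
  have ym: "y \<otimes> t \<in> poly_values R I y" if "t \<in> poly_values R I y" for t
    using poly_values.step[OF I0 that] cI[OF that] y by (simp)
  have am: "a \<otimes> t \<in> poly_values R I y" if "a \<in> A" "t \<in> poly_values R I y" for a t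
    using that(2)
  proof induct
    case (const c) then show ?case using Im that by (auto intro: poly_values.intros)
  next
    case (step c t)
    have "a \<otimes> (c \<oplus> y \<otimes> t) = a \<otimes> c \<oplus> y \<otimes> (a \<otimes> t)"
      using AC[OF that(1)] IC[OF step(1)] cI[OF step(2)] y by algebra
    then show ?case using step Im that by (auto intro: poly_values.intros)
  qed
  have mult: "s \<otimes> t \<in> poly_values R I y" if "s \<in> poly_values R A y" "t \<in> poly_values R I y" for s t
    using that(1)
  proof induct
    case (const c) then show ?case using am that by blast
  next
    case (step c s)
    have "(c \<oplus> y \<otimes> s) \<otimes> t = c \<otimes> t \<oplus> y \<otimes> (s \<otimes> t)"
      using AC[OF step(1)] cA[OF step(2)] cI[OF that(2)] y by algebra
    then show ?case using add am ym step that by simp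
  qed
  show ?thesis
    by (rule submodI) (use cI add mult I0 in \<open>auto intro: poly_values.intros\<close>)
qed

lemma subring_poly_values:
  assumes A: "subring A R" and y: "y \<in> carrier R"
  shows "subring (poly_values R A y) R"
proof -
  note s = submodD[OF submod_poly_values[OF A subring_submod[OF A] y]]
  have 1: "a \<in> A \<Longrightarrow> a \<in> poly_values R A y" for a by (rule poly_values.const)
  have "\<ominus> \<one> \<in> poly_values R A y"
    using subringE(3,5)[OF A] 1 by blast
  then have "\<ominus> h \<in> poly_values R A y" if "h \<in> poly_values R A y" for h
    using s(4)[of "\<ominus> \<one>" h] s(1)[OF that] that by (simp add: l_minus)
  then show ?thesis
    by (intro subringI) (use s 1 subringE(3)[OF A] in auto)
qed

lemma poly_values_incl: "A \<subseteq> poly_values R A y"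
  by (auto intro: poly_values.const)

lemma poly_values_var:
  assumes A: "subring A R" and y: "y \<in> carrier R"
  shows "y \<in> poly_values R A y"
  using poly_values.step[of \<zero> A \<one> R y] poly_values.const[of \<one> A] subringE(2,3)[OF A] y by auto

lemma poly_values_least:
  assumes "subring K R" "A \<subseteq> K" "y \<in> K"
  shows "poly_values R A y \<subseteq> K"
proof
  fix t assume "t \<in> poly_values R A y"
  then show "t \<in> K"
    by induct (use assms subringE[OF assms(1)] in auto)
qed

lemma poly_values_cases:
  assumes A: "subring A R" and I: "submod R A I" and "y \<in> carrier R" "t \<in> poly_values R I y"
  obtains c s where "c \<in> I" "s \<in> poly_values R I y" "t = c \<oplus> y \<otimes> s"
  using assms(4)
proof cases
  case const
  then show ?thesis
    using that[of t \<zero>] submodD(1,2)[OF I] assms(3) by (auto intro: poly_values.const)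
next
  case (step c s) then show ?thesis using that by blast
qed

lemma subring_pow: "subring A R \<Longrightarrow> y \<in> A \<Longrightarrow> y [^] (n::nat) \<in> A"
  by (induct n) (auto simp: subringE)

lemma submod_power_span:
  assumes A: "subring A R" and I: "submod R A I" and y: "y \<in> carrier R"
  shows "submod R A (power_span R I y n)"
proof (induct n)
  case 0
  show ?case using subringE(1)[OF A] by (intro submodI) auto
next
  case (Suc n)
  note s = submodD[OF Suc]
  note AC = subsetD[OF subringE(1)[OF A]]
  note i = submodD[OF I]
  show ?case
  proof (rule submodI, goal_cases)
    case 1 show ?case using s i y by auto
  next
    case 2 show ?case using s i y by (auto intro!: exI[of _ \<zero>])
  next
    case (3 a b)
    then obtain s1 c1 s2 c2 where *: "a = s1 \<oplus> c1 \<otimes> y [^] n" "b = s2 \<oplus> c2 \<otimes> y [^] n"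
      "s1 \<in> power_span R I y n" "s2 \<in> power_span R I y n" "c1 \<in> I" "c2 \<in> I" by auto
    have "a \<oplus> b = (s1 \<oplus> s2) \<oplus> (c1 \<oplus> c2) \<otimes> y [^] n"
      unfolding *(1,2) using s(1)[OF *(3)] s(1)[OF *(4)] i(1)[OF *(5)] i(1)[OF *(6)] nat_pow_closed[OF y, of n]
      by algebra
    then show ?case using s(3)[OF *(3,4)] i(3)[OF *(5,6)] by auto
  next
    case (4 a b)
    then obtain s2 c2 where *: "b = s2 \<oplus> c2 \<otimes> y [^] n"
      "s2 \<in> power_span R I y n" "c2 \<in> I" by auto
    have "a \<otimes> b = (a \<otimes> s2) \<oplus> (a \<otimes> c2) \<otimes> y [^] n"
      unfolding *(1) using s(1)[OF *(2)] i(1)[OF *(3)] AC[OF 4(1)] nat_pow_closed[OF y, of n]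
      by algebra
    then show ?case using s(4)[OF 4(1) *(2)] i(4)[OF 4(1) *(3)] by auto
  qed
qed

lemma power_span_var:
  assumes A: "subring A R" and I: "submod R A I" and y: "y \<in> carrier R"
    and "s \<in> power_span R I y n"
  shows "y \<otimes> s \<in> power_span R I y (Suc n)"
  using assms(4)
proof (induct n arbitrary: s)
  case 0 then show ?case using submodD(2)[OF I] y by (auto intro!: exI[of _ \<zero>])
next
  case (Suc n)
  from Suc(2) obtain t c where *: "s = t \<oplus> c \<otimes> y [^] n" "t \<in> power_span R I y n" "c \<in> I" by auto
  have "y \<otimes> s = y \<otimes> t \<oplus> c \<otimes> y [^] Suc n"
    unfolding *(1) nat_pow_Suc using submodD(1)[OF submod_power_span[OF A I y] *(2)]
      submodD(1)[OF I *(3)] nat_pow_closed[OF y, of n] y by algebra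
  moreover have "y \<otimes> t \<in> power_span R I y (Suc n)" using Suc(1) * by blast
  ultimately show ?case using *(3) by (subst power_span.simps) blast
qed

lemma power_span_peel:
  assumes A: "subring A R" and I: "submod R A I" and y: "y \<in> carrier R"
    and "s \<in> power_span R I y (Suc n)"
  shows "\<exists>c\<in>I. \<exists>t\<in>power_span R I y n. s = c \<oplus> y \<otimes> t"
  using assms(4)
proof (induct n arbitrary: s)
  case 0 then show ?case using submodD(1)[OF I] y by auto
next
  case (Suc n)
  from Suc(2) obtain t c where *: "s = t \<oplus> c \<otimes> y [^] Suc n" "t \<in> power_span R I y (Suc n)" "c \<in> I"
    by (subst (asm) power_span.simps) blast
  from Suc(1)[OF *(2)] obtain d t' where t': "d \<in> I" "t' \<in> power_span R I y n" "t = d \<oplus> y \<otimes> t'" by blast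
  have "s = d \<oplus> y \<otimes> (t' \<oplus> c \<otimes> y [^] n)"
    unfolding * t'(3) nat_pow_Suc using submodD(1)[OF submod_power_span[OF A I y] t'(2)]
      submodD(1)[OF I *(3)] submodD(1)[OF I t'(1)] nat_pow_closed[OF y, of n] y by algebra
  then show ?case using t' *(3) by auto
qed

lemma power_span_subset_poly_values:
  assumes A: "subring A R" and I: "submod R A I" and y: "y \<in> carrier R"
  shows "power_span R I y n \<subseteq> poly_values R I y"
proof (induct n)
  case 0 show ?case using submodD(2)[OF I] by (auto intro: poly_values.const)
next
  case (Suc n)
  show ?case
  proof
    fix s assume "s \<in> power_span R I y (Suc n)"
    from power_span_peel[OF A I y this] show "s \<in> poly_values R I y"
      using Suc by (auto intro: poly_values.step)
  qed
qed

lemma power_in_power_span: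
  assumes A: "subring A R" and y: "y \<in> carrier R" and "j < n"
  shows "y [^] j \<in> power_span R A y n"
  using assms(3)
proof (induct n)
  case (Suc n)
  note s = submodD[OF submod_power_span[OF A subring_submod[OF A] y, of n]]
  show ?case
  proof (cases "j = n")
    case True
    have "y [^] n = \<zero> \<oplus> \<one> \<otimes> y [^] n" using y by simp
    then show ?thesis unfolding True power_span.simps using s(2) subringE(3)[OF A] by blast
  next
    case False
    with Suc have *: "y [^] j \<in> power_span R A y n" by auto
    have "y [^] j = y [^] j \<oplus> \<zero> \<otimes> y [^] n" using y by simp
    then show ?thesis unfolding power_span.simps using * subringE(2)[OF A] by blast
  qed
qed simp

text \<open>The relation for \<open>y [^] n\<close> lowers every higher power. Its coefficients lie
  in \<open>A\<close>, and \<open>I\<close> is stable under multiplication by \<open>A\<close>, so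
  the reduction keeps all coefficients in \<open>I\<close>.\<close>

lemma poly_values_subset_power_span:
  assumes A: "subring A R" and I: "submod R A I" "I \<subseteq> A" and y: "y \<in> carrier R"
    and int: "y [^] n \<in> power_span R A y n"
  shows "poly_values R I y \<subseteq> power_span R I y n"
proof
  note s = submodD[OF submod_power_span[OF A I(1) y, of n]]
  note i = submodD[OF I(1)]
  have mI: "m \<otimes> t \<in> power_span R I y k" if "m \<in> I" "t \<in> power_span R A y k" for m t k
    using that(2)
  proof (induct k arbitrary: t)
    case 0 then show ?case using i that by auto
  next
    case (Suc k)
    from Suc(2) obtain t' c where *: "t = t' \<oplus> c \<otimes> y [^] k" "t' \<in> power_span R A y k" "c \<in> A" by auto
    have "m \<otimes> t = m \<otimes> t' \<oplus> (c \<otimes> m) \<otimes> y [^] k"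
      unfolding *(1) using submodD(1)[OF submod_power_span[OF A subring_submod[OF A] y] *(2)]
        subsetD[OF subringE(1)[OF A] *(3)] i(1)[OF that(1)] nat_pow_closed[OF y, of k] by algebra
    then show ?case using Suc(1)[OF *(2)] i(4)[OF *(3) that(1)] by auto
  qed
  \<comment> \<open>To occur as a coefficient of \<open>y [^] 0\<close>, the element
    \<open>c\<close> needs a positive degree bound; degree 0 forces the zero ring, where
    \<open>c = \<zero>\<close>.\<close>
  have base: "c \<in> power_span R I y n" if "c \<in> I" for c
  proof (cases n)
    case 0
    then have "\<one> = \<zero>" using int by simp
    then have "c = \<zero>" using i(1)[OF that] by (metis r_one r_null)
    then show ?thesis using s by auto
  next
    case (Suc k)
    have "c \<otimes> y [^] (0::nat) \<in> power_span R I y n"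
      by (rule mI[OF that]) (rule power_in_power_span[OF A y], simp add: Suc)
    then show ?thesis using i(1)[OF that] by simp
  qed
  fix t assume "t \<in> poly_values R I y"
  then show "t \<in> power_span R I y n"
  proof induct
    case (const c)
    then show ?case by (rule base)
  next
    case (step c t)
    have "y \<otimes> t \<in> power_span R I y (Suc n)" by (rule power_span_var[OF A I(1) y step(3)])
    then obtain t' d where *: "y \<otimes> t = t' \<oplus> d \<otimes> y [^] n" "t' \<in> power_span R I y n" "d \<in> I" by auto
    then have "y \<otimes> t \<in> power_span R I y n" using s(3) mI[OF *(3) int] by auto
    then show ?case using s(3) base[OF step(1)] by blast
  qed
qed

end

section \<open>Local Nakayama lemma\<close>

text \<open>The elements whose image in the localization at \<open>A - I\<close> lies in the localization of \<open>K\<close>; working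
  with them keeps all local arguments inside \<open>R\<close>.\<close>

definition saturation :: "('a, 'm) ring_scheme \<Rightarrow> 'a set \<Rightarrow> 'a set \<Rightarrow> 'a set \<Rightarrow> 'a set" where
  "saturation R A I K = {t \<in> carrier R. \<exists>u\<in>A - I. u \<otimes>\<^bsub>R\<^esub> t \<in> K}"

lemma saturationI: "t \<in> carrier R \<Longrightarrow> u \<in> A \<Longrightarrow> u \<notin> I \<Longrightarrow> u \<otimes>\<^bsub>R\<^esub> t \<in> K \<Longrightarrow> t \<in> saturation R A I K"
  unfolding saturation_def by blast

lemma saturationE:
  assumes "t \<in> saturation R A I K"
  obtains u where "t \<in> carrier R" "u \<in> A" "u \<notin> I" "u \<otimes>\<^bsub>R\<^esub> t \<in> K"
  using assms unfolding saturation_def by blast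

text \<open>Primeness is phrased with the operations of the ambient ring, so that
  \<open>A[x]\<close> with \<open>Q \<inter> A[x]\<close>, and \<open>A[X]\<close> with
  \<open>I[X]\<close>, can take the place of \<open>A\<close> and \<open>I\<close> as plain
  subsets.\<close>

locale prime_pair = cring R for R (structure) +
  fixes A I
  assumes A: "subring A R" and I: "submod R A I" and IA: "I \<subseteq> A"
    and one_notin: "\<one> \<notin> I"
    and prime: "a \<in> A \<Longrightarrow> b \<in> A \<Longrightarrow> a \<otimes> b \<in> I \<Longrightarrow> a \<in> I \<or> b \<in> I"
begin

lemma AC: "a \<in> A \<Longrightarrow> a \<in> carrier R"
  using subringE(1)[OF A] by blast

lemmas subA = subringE[OF A]
lemmas subI = submodD[OF I]

lemma one_in: "\<one> \<in> A" by (rule subA)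

text \<open>The name anticipates localization: elements of \<open>A - I\<close> become units, and
  they stay outside \<open>I\<close> when changed by an element of \<open>I\<close>.\<close>

lemma unit_diff:
  assumes "u \<in> A" "u \<notin> I" "m \<in> I" shows "u \<ominus> m \<in> A" "u \<ominus> m \<notin> I"
proof -
  show "u \<ominus> m \<in> A" using assms IA subA by (auto simp: minus_eq)
  show "u \<ominus> m \<notin> I"
  proof
    assume "u \<ominus> m \<in> I"
    then have "(u \<ominus> m) \<oplus> m \<in> I" using subI assms by blast
    moreover have "(u \<ominus> m) \<oplus> m = u" using assms IA AC by (simp add: minus_eq a_assoc l_neg subsetD)
    ultimately show False using assms by simp
  qed
qed

lemma unit_add:
  assumes "u \<in> A" "u \<notin> I" "m \<in> I" shows "u \<oplus> m \<in> A" "u \<oplus> m \<notin> I"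
proof -
  have "\<ominus> m \<in> I" using submod_neg[OF I A assms(3)] .
  from unit_diff[OF assms(1,2) this] show "u \<oplus> m \<in> A" "u \<oplus> m \<notin> I"
    using assms subI by (simp_all add: minus_eq)
qed

lemma unit_mult: "u \<in> A \<Longrightarrow> u \<notin> I \<Longrightarrow> w \<in> A \<Longrightarrow> w \<notin> I \<Longrightarrow> u \<otimes> w \<in> A \<and> u \<otimes> w \<notin> I"
  using prime[of u w] subA(6)[of u w] by blast

lemma unit_pow: "u \<in> A \<Longrightarrow> u \<notin> I \<Longrightarrow> u [^] (n::nat) \<in> A \<and> u [^] n \<notin> I"
  by (induct n) (auto simp: one_in one_notin unit_mult)

lemma saturation_incl: "K \<subseteq> carrier R \<Longrightarrow> K \<subseteq> saturation R A I K"
  using one_in one_notin by (auto intro!: saturationI[of _ _ \<one>])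

lemma saturation_mono: "K \<subseteq> L \<Longrightarrow> saturation R A I K \<subseteq> saturation R A I L"
  unfolding saturation_def by blast

lemma submod_saturation:
  assumes K: "submod R A K" shows "submod R A (saturation R A I K)"
proof (rule submodI, goal_cases)
  case 1 show ?case unfolding saturation_def by blast
next
  case 2 show ?case using saturation_incl[of K] submodD(1,2)[OF K] by blast
next
  case (3 a b)
  then obtain u w where *: "a \<in> carrier R" "u \<in> A" "u \<notin> I" "u \<otimes> a \<in> K"
    "b \<in> carrier R" "w \<in> A" "w \<notin> I" "w \<otimes> b \<in> K" by (metis saturationE)
  have "(u \<otimes> w) \<otimes> (a \<oplus> b) = w \<otimes> (u \<otimes> a) \<oplus> u \<otimes> (w \<otimes> b)"
    using *(1,5) AC[OF *(2)] AC[OF *(6)] by algebra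
  then have "(u \<otimes> w) \<otimes> (a \<oplus> b) \<in> K" using * submodD[OF K] by simp
  then show ?case using * unit_mult by (intro saturationI[of _ _ "u \<otimes> w"]) auto
next
  case (4 a b)
  then obtain w where *: "b \<in> carrier R" "w \<in> A" "w \<notin> I" "w \<otimes> b \<in> K" by (metis saturationE)
  have "w \<otimes> (a \<otimes> b) = a \<otimes> (w \<otimes> b)"
    using *(1) AC[OF *(2)] AC[OF 4(1)] by algebra
  then show ?case using * submodD[OF K] AC 4 by (intro saturationI[of _ _ w]) auto
qed

lemma saturation_idem:
  "K \<subseteq> carrier R \<Longrightarrow> saturation R A I (saturation R A I K) = saturation R A I K"
proof (rule antisym)
  show "saturation R A I (saturation R A I K) \<subseteq> saturation R A I K"
  proof
    fix t assume "t \<in> saturation R A I (saturation R A I K)"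
    then obtain u w where *: "t \<in> carrier R" "u \<in> A" "u \<notin> I" "w \<in> A" "w \<notin> I" "w \<otimes> (u \<otimes> t) \<in> K"
      by (metis saturationE)
    then show "t \<in> saturation R A I K" using unit_mult[of w u] AC
      by (intro saturationI[of _ _ "w \<otimes> u"]) (auto simp: m_assoc)
  qed
  show "saturation R A I K \<subseteq> saturation R A I (saturation R A I K)"
    by (rule saturation_incl) (auto simp: saturation_def)
qed

lemma saturation_least:
  "K \<subseteq> carrier R \<Longrightarrow> L \<subseteq> saturation R A I K \<Longrightarrow> saturation R A I L \<subseteq> saturation R A I K"
  using saturation_mono[of L "saturation R A I K"] saturation_idem[of K] by simp

lemma subring_saturation:
  assumes K: "subring K R" "A \<subseteq> K" shows "subring (saturation R A I K) R"
proof -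
  have K': "submod R A K" by (rule submodI) (use subringE[OF K(1)] K(2) in auto)
  note s = submodD[OF submod_saturation[OF K']]
  show ?thesis
  proof (rule subringI, goal_cases)
    case 1 show ?case using s by blast
  next
    case 2 show ?case using saturation_incl[of K] subringE[OF K(1)] by blast
  next
    case (3 h) show ?case by (rule submod_neg[OF submod_saturation[OF K'] A 3])
  next
    case (4 a b)
    then obtain u w where *: "a \<in> carrier R" "u \<in> A" "u \<notin> I" "u \<otimes> a \<in> K"
      "b \<in> carrier R" "w \<in> A" "w \<notin> I" "w \<otimes> b \<in> K" by (metis saturationE)
    have "(u \<otimes> w) \<otimes> (a \<otimes> b) = (u \<otimes> a) \<otimes> (w \<otimes> b)"
      using *(1,5) AC[OF *(2)] AC[OF *(6)] by algebra
    then have "(u \<otimes> w) \<otimes> (a \<otimes> b) \<in> K" using * subringE[OF K(1)] by simp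
    then show ?case using * unit_mult by (intro saturationI[of _ _ "u \<otimes> w"]) auto
  next
    case (5 a b) then show ?case by (rule s(3))
  qed
qed

text \<open>Let \<open>N\<close> be spanned by the powers of \<open>y\<close> below
  \<open>n\<close>. The hypothesis reads \<open>N \<subseteq> K + I N\<close> after localization at
  \<open>I\<close>, the conclusion \<open>N \<subseteq> K\<close>. The generators are eliminated one
  at a time, which avoids determinants and lets each equation carry its own denominator
  \<open>u\<close>.\<close>

lemma nakayama:
  assumes y: "y \<in> carrier R" and K: "submod R A K"
    and gen: "\<And>j. j < n \<Longrightarrow> \<exists>u\<in>A - I. \<exists>k\<in>K. \<exists>s\<in>power_span R I y n. u \<otimes> y [^] j = k \<oplus> s"
  shows "power_span R A y n \<subseteq> saturation R A I K"
  using K gen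
proof (induct n arbitrary: K)
  case (0 K)
  then show ?case using submodD(2)[OF submod_saturation[OF 0(1)]] by simp
next
  case (Suc n K)
  note k = submodD[OF Suc(2)]
  note SK = submodD[OF submod_saturation[OF Suc(2)]]
  have yn: "y [^] n \<in> carrier R" using y by simp
  \<comment> \<open>The \<open>I\<close>-multiples of the last generator are absorbed into the
    submodule, so that the remaining \<open>n\<close> generators satisfy the hypothesis with
    \<open>L\<close> in place of \<open>K\<close>.\<close>
  define L where "L = {k \<oplus> m \<otimes> y [^] n | k m. k \<in> K \<and> m \<in> I}"
  have L: "submod R A L"
  proof (rule submodI, goal_cases)
    case 1 show ?case unfolding L_def using k subI yn by auto
  next
    case 2 have "\<zero> = \<zero> \<oplus> \<zero> \<otimes> y [^] n" using yn by simp
    then show ?case unfolding L_def using k subI by blast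
  next
    case (3 a b)
    then obtain k1 m1 k2 m2 where *: "a = k1 \<oplus> m1 \<otimes> y [^] n" "b = k2 \<oplus> m2 \<otimes> y [^] n"
      "k1 \<in> K" "k2 \<in> K" "m1 \<in> I" "m2 \<in> I" unfolding L_def by blast
    have "a \<oplus> b = (k1 \<oplus> k2) \<oplus> (m1 \<oplus> m2) \<otimes> y [^] n"
      unfolding *(1,2) using k(1)[OF *(3)] k(1)[OF *(4)] subI(1)[OF *(5)] subI(1)[OF *(6)] yn by algebra
    then show ?case unfolding L_def using k(3)[OF *(3,4)] subI(3)[OF *(5,6)] by blast
  next
    case (4 a b)
    then obtain k2 m2 where *: "b = k2 \<oplus> m2 \<otimes> y [^] n"
      "k2 \<in> K" "m2 \<in> I" unfolding L_def by blast
    have "a \<otimes> b = (a \<otimes> k2) \<oplus> (a \<otimes> m2) \<otimes> y [^] n"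
      unfolding *(1) using k(1)[OF *(2)] subI(1)[OF *(3)] AC[OF 4(1)] yn by algebra
    then show ?case unfolding L_def using k(4)[OF 4(1) *(2)] subI(4)[OF 4(1) *(3)] by blast
  qed
  have step: "power_span R A y n \<subseteq> saturation R A I L"
  proof (rule Suc(1)[OF L])
    fix j assume "j < n"
    then obtain u k' s where *: "u \<in> A - I" "k' \<in> K" "s \<in> power_span R I y (Suc n)" "u \<otimes> y [^] j = k' \<oplus> s"
      using Suc(3)[of j] by force
    then obtain s' m where s': "s = s' \<oplus> m \<otimes> y [^] n" "s' \<in> power_span R I y n" "m \<in> I" by auto
    have "u \<otimes> y [^] j = (k' \<oplus> m \<otimes> y [^] n) \<oplus> s'"
      unfolding * s' using k(1)[OF *(2)] subI(1)[OF s'(3)] yn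
        submodD(1)[OF submod_power_span[OF A I y] s'(2)] by algebra
    moreover have "k' \<oplus> m \<otimes> y [^] n \<in> L" unfolding L_def using * s' by blast
    ultimately show "\<exists>u\<in>A - I. \<exists>k\<in>L. \<exists>s\<in>power_span R I y n. u \<otimes> y [^] j = k \<oplus> s"
      using *(1) s'(2) by blast
  qed
  obtain u k' s where *: "u \<in> A" "u \<notin> I" "k' \<in> K" "s \<in> power_span R I y (Suc n)" "u \<otimes> y [^] n = k' \<oplus> s"
    using Suc(3)[of n] by force
  then obtain s' m where s': "s = s' \<oplus> m \<otimes> y [^] n" "s' \<in> power_span R I y n" "m \<in> I" by auto
  have "s' \<in> saturation R A I L" using step s'(2) power_span_mono[OF IA] by blast
  then obtain w k2 m2 where w: "s' \<in> carrier R" "w \<in> A" "w \<notin> I" "w \<otimes> s' = k2 \<oplus> m2 \<otimes> y [^] n" "k2 \<in> K" "m2 \<in> I"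
    by (rule saturationE) (auto simp: L_def)
  note C = AC[OF *(1)] AC[OF w(2)] k(1)[OF *(3)] k(1)[OF w(5)] subI(1)[OF s'(3)] subI(1)[OF w(6)] w(1) yn
  \<comment> \<open>Substituting for \<open>s'\<close> leaves an equation in \<open>y [^] n\<close>
    alone. Its coefficient equals \<open>w \<otimes> u\<close> up to an element of \<open>I\<close>,
    hence is a unit after localization.\<close>
  have "(w \<otimes> u \<ominus> (w \<otimes> m \<oplus> m2)) \<otimes> y [^] n
      = w \<otimes> (u \<otimes> y [^] n) \<ominus> (w \<otimes> m \<oplus> m2) \<otimes> y [^] n"
    using C by algebra
  also have "\<dots> = w \<otimes> k' \<oplus> w \<otimes> s' \<oplus> (w \<otimes> m) \<otimes> y [^] n \<ominus> (w \<otimes> m \<oplus> m2) \<otimes> y [^] n"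
    unfolding * s' using C by algebra
  also have "\<dots> = w \<otimes> k' \<oplus> k2"
    unfolding w using C by algebra
  finally have e: "(w \<otimes> u \<ominus> (w \<otimes> m \<oplus> m2)) \<otimes> y [^] n = w \<otimes> k' \<oplus> k2" .
  have "w \<otimes> m \<oplus> m2 \<in> I" using subI w s' by blast
  then have "w \<otimes> u \<ominus> (w \<otimes> m \<oplus> m2) \<in> A" "w \<otimes> u \<ominus> (w \<otimes> m \<oplus> m2) \<notin> I"
    using unit_mult[OF w(2,3) *(1,2)] unit_diff by auto
  moreover have "w \<otimes> k' \<oplus> k2 \<in> K" using k w * by blast
  ultimately have y_in: "y [^] n \<in> saturation R A I K"
    using e yn by (intro saturationI[of _ _ "w \<otimes> u \<ominus> (w \<otimes> m \<oplus> m2)"]) auto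
  have KC: "K \<subseteq> carrier R" using k by blast
  have "L \<subseteq> saturation R A I K"
    unfolding L_def using SK y_in saturation_incl[OF KC] IA by blast
  then have "power_span R A y n \<subseteq> saturation R A I K"
    using step saturation_least[OF KC] by blast
  then show ?case unfolding power_span.simps using SK y_in by blast
qed

end

text \<open>\<open>nil\<close> says that \<open>y\<close> becomes nilpotent in
  \<open>A[y] / I A[y]\<close> after localization at \<open>I\<close>. The hypotheses persist when
  \<open>A\<close> and \<open>I\<close> are enlarged, as long as \<open>u\<close> stays outside the
  new prime.\<close>

locale nilpotent_gen = prime_pair +
  fixes y and n k :: nat and u
  assumes y: "y \<in> carrier R"
    and int: "y [^] n \<in> power_span R A y n"
    and nil: "u \<in> A" "u \<notin> I" "u \<otimes> y [^] k \<in> poly_values R I y"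
begin

abbreviation "T \<equiv> poly_values R A y"
abbreviation "J \<equiv> poly_values R I y"

lemma T: "subring T R" by (rule subring_poly_values[OF A y])

lemmas subT = subringE[OF T]

lemma TC: "t \<in> T \<Longrightarrow> t \<in> carrier R" using subT(1) by blast

lemma AT: "a \<in> A \<Longrightarrow> a \<in> T" using poly_values_incl by blast

lemma J: "submod R T J" by (rule submod_poly_values[OF A I y])

lemma yT: "y \<in> T" by (rule poly_values_var[OF A y])

lemma JP: "J \<subseteq> power_span R I y n"
  by (rule poly_values_subset_power_span[OF A I IA y int])

lemma TP: "T \<subseteq> power_span R A y n"
  by (rule poly_values_subset_power_span[OF A subring_submod[OF A] subset_refl y int])

text \<open>Locally \<open>p\<close> is a unit and \<open>y\<close> is nilpotent modulo
  \<open>I A[y]\<close>, so \<open>v\<close> is a unit modulo \<open>I A[y]\<close>. Nakayama with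
  \<open>K = v A[y]\<close> lifts this to \<open>\<one> \<in> v A[y]\<close>, up to a factor from
  \<open>A - I\<close>.\<close>

lemma unit_multiple:
  assumes p: "p \<in> A" "p \<notin> I" and q: "q \<in> T" and v: "v = p \<oplus> y \<otimes> q"
  shows "\<exists>w\<in>T. w \<otimes> v \<in> A \<and> w \<otimes> v \<notin> I"
proof -
  have C: "p \<in> carrier R" "q \<in> carrier R" "y \<in> carrier R" "v \<in> carrier R"
    using p q y v AC TC by auto
  have vT: "v \<in> T" unfolding v by (intro subT(6,7) AT p yT q)
  define K where "K = {v \<otimes> t | t. t \<in> T}"
  have K: "submod R A K"
  proof (rule submodI, goal_cases)
    case 1 show ?case unfolding K_def using C TC by auto
  next
    case 2 show ?case unfolding K_def using subT(2) C by (auto intro!: exI[of _ \<zero>])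
  next
    case (3 a b)
    then obtain s t where "s \<in> T" "t \<in> T" "a = v \<otimes> s" "b = v \<otimes> t" unfolding K_def by blast
    then have "a \<oplus> b = v \<otimes> (s \<oplus> t)" "s \<oplus> t \<in> T" using C TC subT(7) by (simp_all add: r_distr)
    then show ?case unfolding K_def by blast
  next
    case (4 a b)
    then obtain t where "t \<in> T" "b = v \<otimes> t" unfolding K_def by blast
    then have "a \<otimes> b = v \<otimes> (a \<otimes> t)" "a \<otimes> t \<in> T"
      using C TC AT[OF 4(1)] AC[OF 4(1)] subT(6) by (simp_all add: m_lcomm)
    then show ?case unfolding K_def by blast
  qed
  \<comment> \<open>Modulo \<open>v\<close> one has \<open>p = \<ominus> (y \<otimes> q)\<close>, so
    \<open>p [^] j\<close> is a multiple of \<open>y [^] j\<close>. For \<open>j = k\<close> the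
    factor \<open>u\<close> sends this remainder into \<open>I A[y]\<close>.\<close>
  have pow: "\<exists>s\<in>T. \<exists>t\<in>T. p [^] j = v \<otimes> s \<oplus> y [^] j \<otimes> t" for j :: nat
  proof (induct j)
    case 0
    have "p [^] (0::nat) = v \<otimes> \<zero> \<oplus> y [^] (0::nat) \<otimes> \<one>" using C by simp
    then show ?case using subT(2,3) by blast
  next
    case (Suc j)
    then obtain s t where st: "s \<in> T" "t \<in> T" "p [^] j = v \<otimes> s \<oplus> y [^] j \<otimes> t" by blast
    note D = C TC[OF st(1)] TC[OF st(2)] nat_pow_closed[OF y, of j]
    have p_eq: "p = v \<ominus> y \<otimes> q" unfolding v using C(1-3) by algebra
    have "p [^] Suc j = v \<otimes> s \<otimes> p \<oplus> y [^] j \<otimes> t \<otimes> p"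
      unfolding nat_pow_Suc st using D by algebra
    also have "\<dots> = v \<otimes> s \<otimes> p \<oplus> y [^] j \<otimes> t \<otimes> (v \<ominus> y \<otimes> q)"
      using p_eq by simp
    also have "\<dots> = v \<otimes> (s \<otimes> p \<oplus> y [^] j \<otimes> t) \<oplus> y [^] Suc j \<otimes> (\<ominus> (t \<otimes> q))"
      unfolding nat_pow_Suc using D by algebra
    finally have *: "p [^] Suc j = v \<otimes> (s \<otimes> p \<oplus> y [^] j \<otimes> t) \<oplus> y [^] Suc j \<otimes> (\<ominus> (t \<otimes> q))" .
    have "s \<otimes> p \<oplus> y [^] j \<otimes> t \<in> T" "\<ominus> (t \<otimes> q) \<in> T"
      by (intro subT(5,6,7) st q AT p subring_pow[OF T yT])+
    with * show ?case by blast
  qed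
  obtain s t where st: "s \<in> T" "t \<in> T" "p [^] k = v \<otimes> s \<oplus> y [^] k \<otimes> t" using pow by blast
  have "power_span R A y n \<subseteq> saturation R A I K"
  proof (rule nakayama[OF y K])
    fix j assume "j < n"
    have yj: "y [^] j \<in> T" by (rule subring_pow[OF T yT])
    note D = C TC[OF st(1)] TC[OF st(2)] nat_pow_closed[OF y, of k] AC[OF nil(1)] TC[OF yj]
    have "(u \<otimes> p [^] k) \<otimes> y [^] j = v \<otimes> (u \<otimes> s \<otimes> y [^] j) \<oplus> (t \<otimes> y [^] j) \<otimes> (u \<otimes> y [^] k)"
      unfolding st using D by algebra
    moreover have "v \<otimes> (u \<otimes> s \<otimes> y [^] j) \<in> K"
      unfolding K_def using subT(6)[OF subT(6)[OF AT[OF nil(1)] st(1)] yj] by blast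
    moreover have "(t \<otimes> y [^] j) \<otimes> (u \<otimes> y [^] k) \<in> power_span R I y n"
      by (intro subsetD[OF JP] submodD(4)[OF J _ nil(3)] subT(6) st yj)
    moreover have "u \<otimes> p [^] k \<in> A - I" using unit_mult[OF nil(1,2)] unit_pow[OF p] by blast
    ultimately show "\<exists>u\<in>A - I. \<exists>k\<in>K. \<exists>s\<in>power_span R I y n. u \<otimes> y [^] j = k \<oplus> s" by blast
  qed
  then have "\<one> \<in> saturation R A I K" using TP subT(3) by blast
  then obtain w where "w \<in> A" "w \<notin> I" "w \<otimes> \<one> \<in> K" by (rule saturationE)
  then obtain t where "t \<in> T" "w = v \<otimes> t" unfolding K_def using AC by auto
  then show ?thesis using \<open>w \<in> A\<close> \<open>w \<notin> I\<close> m_comm[OF C(4) TC] by auto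
qed

text \<open>Locally \<open>y\<close> is \<open>z\<close> times an inverse of
  \<open>p \<oplus> y \<otimes> q\<close>, but that inverse is only known to lie in
  \<open>A[y]\<close>. Substituting repeatedly gives \<open>A[y] = A[z] + z^k A[y]\<close> locally.
  The last summand lies in \<open>I A[y]\<close> because \<open>y [^] k\<close> divides
  \<open>z [^] k\<close>, and Nakayama yields \<open>A[y] = A[z]\<close>.\<close>

lemma generator:
  assumes p: "p \<in> A" "p \<notin> I" and q: "q \<in> T" and z: "z = y \<otimes> (p \<oplus> y \<otimes> q)"
  shows "y \<in> saturation R A I (poly_values R A z)"
proof -
  define v where "v = p \<oplus> y \<otimes> q"
  have C: "p \<in> carrier R" "q \<in> carrier R" "y \<in> carrier R" "v \<in> carrier R" "z \<in> carrier R"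
    unfolding v_def z using p q y AC TC by auto
  have vT: "v \<in> T" unfolding v_def by (intro subT(6,7) AT p yT q)
  obtain w where w: "w \<in> T" "w \<otimes> v \<in> A" "w \<otimes> v \<notin> I" using unit_multiple[OF p q v_def] by blast
  define c where "c = w \<otimes> v"
  have c: "c \<in> A" "c \<notin> I" using w c_def by auto
  have cC: "c \<in> carrier R" "w \<in> carrier R" using AC[OF c(1)] TC[OF w(1)] by auto
  have cy: "c \<otimes> y = w \<otimes> z" unfolding c_def z v_def[symmetric] using C cC by algebra
  define K where "K = poly_values R A z"
  have K: "subring K R" unfolding K_def by (rule subring_poly_values[OF A C(5)])
  note subK = subringE[OF K]
  have AK: "a \<in> A \<Longrightarrow> a \<in> K" for a unfolding K_def using poly_values_incl by blast
  have KA: "submod R A K" by (rule submodI) (use subK AK in auto)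
  have zK: "z \<in> K" unfolding K_def by (rule poly_values_var[OF A C(5)])
  \<comment> \<open>Each round splits off the constant term of the remainder and trades
    \<open>c \<otimes> y\<close> for \<open>w \<otimes> z\<close>: it costs one factor
    \<open>c\<close> and gains one factor \<open>z\<close>.\<close>
  have approx: "\<exists>a\<in>K. \<exists>t'\<in>T. c [^] j \<otimes> t = a \<oplus> z [^] j \<otimes> t'" if t: "t \<in> T" for t and j :: nat
  proof (induct j)
    case 0
    have "c [^] (0::nat) \<otimes> t = \<zero> \<oplus> z [^] (0::nat) \<otimes> t" using TC[OF t] by simp
    then show ?case using t subK(2) by blast
  next
    case (Suc j)
    then obtain a t' where at: "a \<in> K" "t' \<in> T" "c [^] j \<otimes> t = a \<oplus> z [^] j \<otimes> t'" by blast
    from poly_values_cases[OF A subring_submod[OF A] y at(2)] obtain b t2 where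
      b: "b \<in> A" "t2 \<in> T" "t' = b \<oplus> y \<otimes> t2" by blast
    have aC: "a \<in> carrier R" using subK(1) at(1) by blast
    note D = C cC aC TC[OF at(2)] TC[OF b(2)] AC[OF b(1)] TC[OF t] nat_pow_closed[OF C(5), of j]
      nat_pow_closed[OF cC(1), of j]
    have "c [^] Suc j \<otimes> t = c \<otimes> (c [^] j \<otimes> t)"
      unfolding nat_pow_Suc using D by algebra
    also have "\<dots> = (c \<otimes> a \<oplus> z [^] j \<otimes> c \<otimes> b) \<oplus> z [^] j \<otimes> ((c \<otimes> y) \<otimes> t2)"
      unfolding at b using D by algebra
    also have "\<dots> = (c \<otimes> a \<oplus> z [^] j \<otimes> c \<otimes> b) \<oplus> z [^] Suc j \<otimes> (w \<otimes> t2)"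
      unfolding cy nat_pow_Suc using D by algebra
    finally have *: "c [^] Suc j \<otimes> t = (c \<otimes> a \<oplus> z [^] j \<otimes> c \<otimes> b) \<oplus> z [^] Suc j \<otimes> (w \<otimes> t2)" .
    have "c \<otimes> a \<oplus> z [^] j \<otimes> c \<otimes> b \<in> K"
      by (intro subK(6,7) at AK c b subring_pow[OF K zK])
    with * show ?case using subT(6)[OF w(1) b(2)] by blast
  qed
  have "power_span R A y n \<subseteq> saturation R A I K"
  proof (rule nakayama[OF y KA])
    fix j assume "j < n"
    have yj: "y [^] j \<in> T" by (rule subring_pow[OF T yT])
    obtain a t where at: "a \<in> K" "t \<in> T" "c [^] k \<otimes> y [^] j = a \<oplus> z [^] k \<otimes> t" using approx[OF yj] by blast
    have aC: "a \<in> carrier R" using subK(1) at(1) by blast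
    have zk: "z [^] k = y [^] k \<otimes> v [^] k" unfolding z v_def[symmetric] using C by (simp add: nat_pow_distrib)
    note D = C cC aC TC[OF at(2)] TC[OF yj] AC[OF nil(1)] nat_pow_closed[OF C(3), of k]
      nat_pow_closed[OF C(4), of k] nat_pow_closed[OF cC(1), of k]
    have "(u \<otimes> c [^] k) \<otimes> y [^] j = u \<otimes> (c [^] k \<otimes> y [^] j)" using D by algebra
    also have "\<dots> = u \<otimes> a \<oplus> (v [^] k \<otimes> t) \<otimes> (u \<otimes> y [^] k)"
      unfolding at zk using D by algebra
    finally have "(u \<otimes> c [^] k) \<otimes> y [^] j = u \<otimes> a \<oplus> (v [^] k \<otimes> t) \<otimes> (u \<otimes> y [^] k)" .
    moreover have "u \<otimes> a \<in> K" by (intro AK nil at subK(6))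
    moreover have "(v [^] k \<otimes> t) \<otimes> (u \<otimes> y [^] k) \<in> power_span R I y n"
      by (intro subsetD[OF JP] submodD(4)[OF J _ nil(3)] subT(6) at subring_pow[OF T vT])
    moreover have "u \<otimes> c [^] k \<in> A - I" using unit_mult[OF nil(1,2)] unit_pow[OF c] by blast
    ultimately show "\<exists>u\<in>A - I. \<exists>k\<in>K. \<exists>s\<in>power_span R I y n. u \<otimes> y [^] j = k \<oplus> s" by blast
  qed
  then show ?thesis using TP yT unfolding K_def by blast
qed

end

section \<open>Integral extensions at a prime\<close>

lemma (in cring) submod_ideal: "submod R (carrier R) P \<Longrightarrow> ideal P R"
proof (rule idealI)
  assume P: "submod R (carrier R) P"
  show "subgroup P (add_monoid R)"
  proof (rule add.subgroupI)
    show "P \<subseteq> carrier R" "P \<noteq> {}" using submodD(1,2)[OF P] by auto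
    show "\<ominus> a \<in> P" if "a \<in> P" for a
      by (rule submod_neg[OF P carrier_is_subring that])
    show "a \<oplus> b \<in> P" if "a \<in> P" "b \<in> P" for a b by (rule submodD(3)[OF P that])
  qed
  fix a x assume "a \<in> P" "x \<in> carrier R"
  then show "x \<otimes> a \<in> P" "a \<otimes> x \<in> P" using submodD(1,4)[OF P] m_comm by force+
qed (rule ring_axioms)

lemma (in ideal) ideal_submod: "submod R (carrier R) I"
  by (rule submodI) (auto simp: I_l_closed)

text \<open>\<open>P\<close> is maximal among the ideals containing \<open>I0\<close> and disjoint
  from \<open>W\<close>. The last clause keeps maximality in usable form: adjoining an element
  outside \<open>P\<close> produces an ideal that meets \<open>W\<close>.\<close>

lemma (in cring) primeideal_avoiding:
  assumes I0: "submod R (carrier R) I0" and W: "\<one> \<in> W" "\<And>a b. a \<in> W \<Longrightarrow> b \<in> W \<Longrightarrow> a \<otimes> b \<in> W"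
    and disj: "I0 \<inter> W = {}"
  obtains P where "primeideal P R" "I0 \<subseteq> P" "P \<inter> W = {}"
    "\<And>m. m \<in> carrier R \<Longrightarrow> m \<notin> P \<Longrightarrow> \<exists>p\<in>P. \<exists>r\<in>carrier R. p \<oplus> m \<otimes> r \<in> W"
proof -
  define F where "F = {P. submod R (carrier R) P \<and> I0 \<subseteq> P \<and> P \<inter> W = {}}"
  have "\<exists>M\<in>F. \<forall>X\<in>F. M \<subseteq> X \<longrightarrow> X = M"
  proof (rule subset_Zorn_nonempty)
    show "F \<noteq> {}" using I0 disj F_def by blast
    fix C assume C: "C \<noteq> {}" "subset.chain F C"
    have CF': "C \<subseteq> F" and ch': "\<forall>P\<in>C. \<forall>P'\<in>C. P \<subseteq> P' \<or> P' \<subseteq> P"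
      using C(2) unfolding subset_chain_def by simp_all
    have CF: "submod R (carrier R) P \<and> I0 \<subseteq> P \<and> P \<inter> W = {}" if "P \<in> C" for P
      using subsetD[OF CF' that] by (simp add: F_def)
    have ch: "P \<subseteq> P' \<or> P' \<subseteq> P" if "P \<in> C" "P' \<in> C" for P P'
      using bspec[OF bspec[OF ch' that(1)] that(2)] .
    obtain P0 where P0: "P0 \<in> C" using C by blast
    have "submod R (carrier R) (\<Union>C)"
    proof (rule submodI)
      have CS: "submod R (carrier R) P" if "P \<in> C" for P using CF[OF that] by simp
      show "\<Union>C \<subseteq> carrier R" using submodD(1)[OF CS] by (rule Union_least[OF subsetI])
      show "\<zero> \<in> \<Union>C" using submodD(2)[OF CS[OF P0]] P0 by (rule UnionI[rotated])
      show "a \<oplus> b \<in> \<Union>C" if ab: "a \<in> \<Union>C" "b \<in> \<Union>C" for a b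
      proof -
        obtain P P' where "P \<in> C" "P' \<in> C" "a \<in> P" "b \<in> P'" using ab by blast
        then obtain P where "P \<in> C" "a \<in> P" "b \<in> P" using ch[of P P'] by blast
        then show ?thesis using submodD(3)[OF CS[of P]] by blast
      qed
      show "a \<otimes> b \<in> \<Union>C" if ab: "a \<in> carrier R" "b \<in> \<Union>C" for a b
        using submodD(4)[OF CS ab(1)] ab(2) by blast
    qed
    moreover have "I0 \<subseteq> \<Union>C" using CF[OF P0] P0 by blast
    moreover have "\<Union>C \<inter> W = {}" using CF by (simp add: Int_Union2)
    ultimately show "\<Union>C \<in> F" unfolding F_def by simp
  qed
  then obtain P where P: "submod R (carrier R) P" "I0 \<subseteq> P" "P \<inter> W = {}"
    and max: "\<And>X. submod R (carrier R) X \<Longrightarrow> I0 \<subseteq> X \<Longrightarrow> X \<inter> W = {} \<Longrightarrow> P \<subseteq> X \<Longrightarrow> X = P"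
    unfolding F_def by auto
  note p = submodD[OF P(1)]
  have ext: "\<exists>p\<in>P. \<exists>r\<in>carrier R. p \<oplus> m \<otimes> r \<in> W" if m: "m \<in> carrier R" "m \<notin> P" for m
  proof (rule ccontr)
    assume neg: "\<not> ?thesis"
    define X where "X = {p \<oplus> m \<otimes> r | p r. p \<in> P \<and> r \<in> carrier R}"
    have "submod R (carrier R) X"
    proof (rule submodI, goal_cases)
      case 1 show ?case unfolding X_def using p(1) m by auto
    next
      case 2 have "\<zero> = \<zero> \<oplus> m \<otimes> \<zero>" using m by simp
      then show ?case unfolding X_def using p(2) by blast
    next
      case (3 a b)
      then obtain p1 r1 p2 r2 where *: "a = p1 \<oplus> m \<otimes> r1" "b = p2 \<oplus> m \<otimes> r2" "p1 \<in> P" "p2 \<in> P"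
        "r1 \<in> carrier R" "r2 \<in> carrier R" unfolding X_def by blast
      have "a \<oplus> b = (p1 \<oplus> p2) \<oplus> m \<otimes> (r1 \<oplus> r2)" unfolding *(1,2)
        using m(1) * p(1)[OF *(3)] p(1)[OF *(4)] by algebra
      then show ?case unfolding X_def using p(3)[OF *(3,4)] * by blast
    next
      case (4 a b)
      then obtain p2 r2 where *: "b = p2 \<oplus> m \<otimes> r2" "p2 \<in> P" "r2 \<in> carrier R" unfolding X_def by blast
      have "a \<otimes> b = (a \<otimes> p2) \<oplus> m \<otimes> (a \<otimes> r2)" unfolding *(1)
        using m(1) 4(1) * p(1)[OF *(2)] by algebra
      then show ?case unfolding X_def using p(4)[OF 4(1) *(2)] * 4(1) by blast
    qed
    moreover have PX: "P \<subseteq> X"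
    proof
      fix a assume "a \<in> P"
      moreover from this have "a = a \<oplus> m \<otimes> \<zero>" using p(1) m by simp
      ultimately show "a \<in> X" unfolding X_def by blast
    qed
    moreover have "X \<inter> W = {}" unfolding X_def using neg by blast
    ultimately have "X = P" using max P(2) by blast
    moreover have "m = \<zero> \<oplus> m \<otimes> \<one>" using m by simp
    then have "m \<in> X" unfolding X_def using p(2) by blast
    ultimately show False using m by simp
  qed
  have "primeideal P R"
  proof (rule primeidealI[OF submod_ideal[OF P(1)] is_cring])
    show "carrier R \<noteq> P" using W P(3) by auto
    fix a b assume ab: "a \<in> carrier R" "b \<in> carrier R" "a \<otimes> b \<in> P"
    show "a \<in> P \<or> b \<in> P"
    proof (rule ccontr)
      assume "\<not> (a \<in> P \<or> b \<in> P)"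
      then obtain p1 r1 p2 r2 where *: "p1 \<in> P" "p2 \<in> P" "r1 \<in> carrier R" "r2 \<in> carrier R"
        "p1 \<oplus> a \<otimes> r1 \<in> W" "p2 \<oplus> b \<otimes> r2 \<in> W" using ext[OF ab(1)] ext[OF ab(2)] by blast
      note C = p(1)[OF *(1)] p(1)[OF *(2)] *(3,4) ab(1,2)
      have "(p1 \<oplus> a \<otimes> r1) \<otimes> (p2 \<oplus> b \<otimes> r2) = (p2 \<oplus> b \<otimes> r2) \<otimes> p1 \<oplus> (a \<otimes> r1) \<otimes> p2 \<oplus> (r1 \<otimes> r2) \<otimes> (a \<otimes> b)"
        using C by algebra
      moreover have "(p2 \<oplus> b \<otimes> r2) \<otimes> p1 \<oplus> (a \<otimes> r1) \<otimes> p2 \<oplus> (r1 \<otimes> r2) \<otimes> (a \<otimes> b) \<in> P"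
        by (intro p(3,4) * ab) (use C in auto)
      ultimately show False using W(2)[OF *(5,6)] P(3) by auto
    qed
  qed
  then show ?thesis using that P ext by blast
qed

section \<open>A base prime with exactly one prime above it\<close>

locale integral_prime = prime_pair +
  fixes Q
  assumes int: "x \<in> carrier R \<Longrightarrow> \<exists>n. x [^] (n::nat) \<in> power_span R A x n"
    and Q: "primeideal Q R" and QA: "Q \<inter> A = I"
    and unique: "primeideal P R \<Longrightarrow> P \<inter> A = I \<Longrightarrow> P = Q"
begin

lemma Q_submod: "submod R (carrier R) Q"
  using Q by (intro ideal.ideal_submod) (simp add: primeideal_def)

lemmas subQ = submodD[OF Q_submod]

lemma Q_prime: "a \<in> carrier R \<Longrightarrow> b \<in> carrier R \<Longrightarrow> a \<otimes> b \<in> Q \<Longrightarrow> a \<in> Q \<or> b \<in> Q"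
  using primeideal.I_prime[OF Q] .

lemma Q_one: "\<one> \<notin> Q"
  using QA one_notin one_in by blast

lemma IQ: "a \<in> A \<Longrightarrow> a \<in> Q \<longleftrightarrow> a \<in> I"
  using QA by blast

lemma Q_add_iff: "a \<in> carrier R \<Longrightarrow> b \<in> Q \<Longrightarrow> a \<oplus> b \<in> Q \<longleftrightarrow> a \<in> Q"
proof
  assume a: "a \<in> carrier R" "b \<in> Q" "a \<oplus> b \<in> Q"
  have "\<ominus> b \<in> Q" by (rule submod_neg[OF Q_submod carrier_is_subring a(2)])
  then have "(a \<oplus> b) \<oplus> \<ominus> b \<in> Q" using a subQ by blast
  then show "a \<in> Q" using a subQ(1)[OF a(2)] by (simp add: a_assoc r_neg)
qed (use subQ in blast)

text \<open>If the principal ideal of \<open>v\<close> avoided \<open>A - I\<close>, a prime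
  \<open>P\<close> containing it and maximal with this property would contract to \<open>I\<close>
  by integrality; then \<open>P = Q\<close> would contain \<open>v\<close>.\<close>

lemma multiple_in_base:
  assumes v: "v \<in> carrier R" "v \<notin> Q"
  shows "\<exists>s\<in>carrier R. s \<otimes> v \<in> A \<and> s \<otimes> v \<notin> I"
proof (rule ccontr)
  assume neg: "\<not> ?thesis"
  define X where "X = {s \<otimes> v | s. s \<in> carrier R}"
  have X: "submod R (carrier R) X"
  proof (rule submodI, goal_cases)
    case 1 show ?case unfolding X_def using v by auto
  next
    case 2 have "\<zero> = \<zero> \<otimes> v" using v by simp
    then show ?case unfolding X_def by blast
  next
    case (3 a b)
    then obtain s t where "a = s \<otimes> v" "b = t \<otimes> v" "s \<in> carrier R" "t \<in> carrier R" unfolding X_def by blast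
    then have "a \<oplus> b = (s \<oplus> t) \<otimes> v" "s \<oplus> t \<in> carrier R" using v by (simp_all add: l_distr)
    then show ?case unfolding X_def by blast
  next
    case (4 a b)
    then obtain t where "b = t \<otimes> v" "t \<in> carrier R" unfolding X_def by blast
    then have "a \<otimes> b = (a \<otimes> t) \<otimes> v" "a \<otimes> t \<in> carrier R" using v 4 by (simp_all add: m_assoc)
    then show ?case unfolding X_def by blast
  qed
  have "X \<inter> (A - I) = {}" unfolding X_def using neg by blast
  then obtain P where P: "primeideal P R" "X \<subseteq> P" "P \<inter> (A - I) = {}"
    and max: "\<And>m. m \<in> carrier R \<Longrightarrow> m \<notin> P \<Longrightarrow> \<exists>p\<in>P. \<exists>r\<in>carrier R. p \<oplus> m \<otimes> r \<in> A - I"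
    using primeideal_avoiding[OF X, of "A - I"] one_in one_notin unit_mult by (metis DiffD1 DiffD2 DiffI)
  have Pm: "submod R (carrier R) P" using P(1) by (intro ideal.ideal_submod) (simp add: primeideal_def)
  note p = submodD[OF Pm]
  \<comment> \<open>If \<open>m \<in> I\<close> is outside \<open>P\<close>, maximality makes some
    \<open>m \<otimes> s\<close> congruent modulo \<open>P\<close> to an element \<open>u\<close> of
    \<open>A - I\<close>. An integral equation of \<open>s\<close>, multiplied by
    \<open>m [^] n\<close>, then makes \<open>u [^] n\<close> congruent to an element of
    \<open>I\<close>, contradicting that \<open>P\<close> avoids \<open>A - I\<close>.\<close>
  have "I \<subseteq> P"
  proof
    fix m assume m: "m \<in> I"
    have mC: "m \<in> carrier R" using m subI by blast
    show "m \<in> P"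
    proof (rule ccontr)
      assume "m \<notin> P"
      then obtain p' s where ps: "p' \<in> P" "s \<in> carrier R" "p' \<oplus> m \<otimes> s \<in> A - I" using max mC by blast
      define u where "u = p' \<oplus> m \<otimes> s"
      have u: "u \<in> A" "u \<notin> I" using ps u_def by auto
      note C = mC ps(2) p(1)[OF ps(1)] AC[OF u(1)]
      have ms: "m \<otimes> s \<ominus> u = \<ominus> p'" unfolding u_def using C(1-3) by algebra
      have "\<ominus> p' \<in> P" by (rule submod_neg[OF Pm carrier_is_subring ps(1)])
      then have ms': "m \<otimes> s \<ominus> u \<in> P" using ms by simp
      have pw: "(m \<otimes> s) [^] j \<ominus> u [^] j \<in> P" for j :: nat
      proof (induct j)
        case 0 show ?case using p(2) by (simp add: minus_eq r_neg)
      next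
        case (Suc j)
        note D = C nat_pow_closed[OF C(4), of j] nat_pow_closed[OF m_closed[OF C(1,2)], of j]
        have "(m \<otimes> s) [^] Suc j \<ominus> u [^] Suc j = (m \<otimes> s) \<otimes> ((m \<otimes> s) [^] j \<ominus> u [^] j) \<oplus> u [^] j \<otimes> (m \<otimes> s \<ominus> u)"
          unfolding nat_pow_Suc using D by algebra
        then show ?case using p(3,4) Suc ms' D by simp
      qed
      \<comment> \<open>Up to coefficients from \<open>A\<close>, the terms are
        \<open>m [^] j \<otimes> s [^] l\<close> with \<open>l < j\<close>, congruent to
        \<open>m [^] (j - l) \<otimes> u [^] l\<close>. The strict inequality leaves a factor
        \<open>m\<close>, hence an element of \<open>I\<close>.\<close>
      have cl: "\<exists>i\<in>I. m [^] j \<otimes> t \<ominus> i \<in> P" if "t \<in> power_span R A s j" for j t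
        using that
      proof (induct j arbitrary: t)
        case 0 then show ?case using p(2) subI(2) by (auto intro!: bexI[of _ \<zero>] simp: minus_eq)
      next
        case (Suc j)
        then obtain t' c where t: "t = t' \<oplus> c \<otimes> s [^] j" "t' \<in> power_span R A s j" "c \<in> A" by auto
        from Suc(1)[OF t(2)] obtain i where i: "i \<in> I" "m [^] j \<otimes> t' \<ominus> i \<in> P" by blast
        have t'C: "t' \<in> carrier R"
          using submodD(1)[OF submod_power_span[OF A subring_submod[OF A] ps(2)] t(2)] .
        note D = C nat_pow_closed[OF C(4), of j] nat_pow_closed[OF C(1), of j] nat_pow_closed[OF C(2), of j]
          AC[OF t(3)] subI(1)[OF i(1)] t'C
        have e: "(m \<otimes> s) [^] j = m [^] j \<otimes> s [^] j" using C by (simp add: nat_pow_distrib)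
        have "m [^] Suc j \<otimes> t \<ominus> (m \<otimes> i \<oplus> (u [^] j \<otimes> c) \<otimes> m) =
           m \<otimes> (m [^] j \<otimes> t' \<ominus> i) \<oplus> (c \<otimes> m) \<otimes> ((m \<otimes> s) [^] j \<ominus> u [^] j)"
          unfolding nat_pow_Suc t e using D by algebra
        also have "\<dots> \<in> P" by (intro p(3,4) i pw) (use D in auto)
        finally have "m [^] Suc j \<otimes> t \<ominus> (m \<otimes> i \<oplus> (u [^] j \<otimes> c) \<otimes> m) \<in> P" .
        moreover have "m \<otimes> i \<oplus> (u [^] j \<otimes> c) \<otimes> m \<in> I"
          by (intro subI(3,4) i m subA(6) t subring_pow[OF A] u subsetD[OF IA])
        ultimately show ?case by blast
      qed
      obtain n where n: "s [^] (n::nat) \<in> power_span R A s n" using int ps(2) by blast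
      from cl[OF n] obtain i where i: "i \<in> I" "m [^] n \<otimes> s [^] n \<ominus> i \<in> P" by blast
      note D = C nat_pow_closed[OF C(4), of n] nat_pow_closed[OF C(1), of n] nat_pow_closed[OF C(2), of n] subI(1)[OF i(1)]
      have e: "(m \<otimes> s) [^] n = m [^] n \<otimes> s [^] n" using C by (simp add: nat_pow_distrib)
      have "u [^] n \<ominus> i = (m [^] n \<otimes> s [^] n \<ominus> i) \<oplus> (\<ominus> \<one>) \<otimes> ((m \<otimes> s) [^] n \<ominus> u [^] n)"
        unfolding e using D by algebra
      also have "\<dots> \<in> P" by (intro p(3,4) i pw) auto
      finally have "u [^] n \<ominus> i \<in> P" .
      moreover have "u [^] n \<ominus> i \<in> A - I" using unit_diff[OF _ _ i(1)] unit_pow[OF u, of n] by blast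
      ultimately show False using P(3) by blast
    qed
  qed
  then have "P \<inter> A = I" using P(3) IA by blast
  then have "P = Q" using unique P(1) by blast
  moreover have "v = \<one> \<otimes> v" using v by simp
  then have "v \<in> X" unfolding X_def by blast
  ultimately show False using v P(2) by blast
qed

text \<open>Take \<open>s\<close> with \<open>s \<otimes> v \<in> A - I\<close> and an integral
  equation of \<open>s\<close> of degree \<open>n = Suc m\<close>. The cofactor is
  \<open>v [^] m \<otimes> s [^] n\<close>: for \<open>j \<le> m\<close> the product
  \<open>v [^] m \<otimes> s [^] j\<close> equals
  \<open>v [^] (m - j) \<otimes> (s \<otimes> v) [^] j\<close>, so the equation places the cofactor
  in \<open>A[v]\<close>. Its product with \<open>v\<close> is
  \<open>(s \<otimes> v) [^] n\<close>.\<close>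

lemma integral_unit_multiple:
  assumes v: "v \<in> carrier R" "v \<notin> Q"
  shows "\<exists>w\<in>poly_values R A v. w \<otimes> v \<in> A \<and> w \<otimes> v \<notin> I"
proof -
  obtain s where s: "s \<in> carrier R" "s \<otimes> v \<in> A" "s \<otimes> v \<notin> I" using multiple_in_base[OF v] by blast
  define V where "V = poly_values R A v"
  have V: "subring V R" unfolding V_def by (rule subring_poly_values[OF A v(1)])
  have vV: "v \<in> V" unfolding V_def by (rule poly_values_var[OF A v(1)])
  have AV: "a \<in> A \<Longrightarrow> a \<in> V" for a unfolding V_def using poly_values_incl by blast
  note subV = subringE[OF V]
  obtain n where n: "s [^] (n::nat) \<in> power_span R A s n" using int s(1) by blast
  have "n \<noteq> 0"
  proof
    assume "n = 0"
    then have "\<one> = \<zero>" using n by simp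
    then show False using one_notin subI(2) by simp
  qed
  then obtain m where m: "n = Suc m" by (cases n) auto
  have cl: "v [^] k \<otimes> t \<in> V" if "t \<in> power_span R A s j" "j \<le> Suc k" for j k t
    using that
  proof (induct j arbitrary: t)
    case 0 then show ?case using subV(2) v by simp
  next
    case (Suc j)
    then obtain t' c where t: "t = t' \<oplus> c \<otimes> s [^] j" "t' \<in> power_span R A s j" "c \<in> A" by auto
    have t'C: "t' \<in> carrier R"
      using submodD(1)[OF submod_power_span[OF A subring_submod[OF A] s(1)] t(2)] .
    have k: "v [^] k = v [^] (k - j) \<otimes> v [^] j" using v(1) Suc(3) by (simp add: nat_pow_mult)
    have e: "(s \<otimes> v) [^] j = s [^] j \<otimes> v [^] j" using s v by (simp add: nat_pow_distrib)
    note D = s(1) v(1) t'C AC[OF t(3)] nat_pow_closed[OF v(1), of j] nat_pow_closed[OF v(1), of "k - j"]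
      nat_pow_closed[OF s(1), of j]
    have "v [^] k \<otimes> t = v [^] k \<otimes> t' \<oplus> v [^] (k - j) \<otimes> c \<otimes> (s \<otimes> v) [^] j"
      unfolding t e k using D by algebra
    moreover have "v [^] k \<otimes> t' \<in> V" using Suc t by simp
    moreover have "v [^] (k - j) \<otimes> c \<otimes> (s \<otimes> v) [^] j \<in> V"
      by (intro subV(6) subring_pow[OF V] vV AV s t)
    ultimately show ?case using subV(7) by simp
  qed
  have "v [^] m \<otimes> s [^] n \<in> V" using cl[OF n] m by simp
  moreover have "v [^] m \<otimes> s [^] n \<otimes> v = (s \<otimes> v) [^] n"
    unfolding m using s v nat_pow_closed[OF s(1), of m] nat_pow_closed[OF v(1), of m]
    by (simp add: nat_pow_distrib, algebra)
  ultimately show ?thesis using unit_pow[OF s(2,3), of n] unfolding V_def by metis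
qed

text \<open>Modulo \<open>I A[x]\<close> the integral equation becomes
  \<open>x [^] j \<otimes> v = \<zero>\<close>, once the low coefficients in \<open>I\<close> are
  dropped. The first coefficient outside \<open>I\<close> is the constant term of \<open>v\<close>,
  and \<open>x \<in> Q\<close>, so \<open>v \<notin> Q\<close>. A multiple of \<open>v\<close>
  formed inside \<open>A[x]\<close> lies in \<open>A - I\<close>, which leaves the power of
  \<open>x\<close>.\<close>

lemma nilpotent_mod:
  assumes x: "x \<in> Q"
  shows "\<exists>u k. u \<in> A \<and> u \<notin> I \<and> u \<otimes> x [^] (k::nat) \<in> poly_values R I x"
proof -
  have xC: "x \<in> carrier R" using x subQ by blast
  define V where "V = poly_values R A x"
  define J where "J = poly_values R I x"
  have V: "subring V R" unfolding V_def by (rule subring_poly_values[OF A xC])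
  note subV = subringE[OF V]
  have xV: "x \<in> V" unfolding V_def by (rule poly_values_var[OF A xC])
  have AV: "a \<in> A \<Longrightarrow> a \<in> V" for a unfolding V_def using poly_values_incl by blast
  have J: "submod R V J" unfolding V_def J_def by (rule submod_poly_values[OF A I xC])
  have PV: "power_span R A x n \<subseteq> V" for n
    unfolding V_def by (rule power_span_subset_poly_values[OF A subring_submod[OF A] xC])
  \<comment> \<open>The polynomial \<open>x [^] n \<oplus> s\<close> is monic, so the search for a
    coefficient outside \<open>I\<close> stops at the latest with the leading one: at
    \<open>n = 0\<close> it is \<open>\<one>\<close>, which is not in \<open>Q\<close>.\<close>
  have cl: "\<exists>j::nat. \<exists>v\<in>V. v \<notin> Q \<and> (x [^] n \<oplus> s) \<ominus> x [^] j \<otimes> v \<in> J" if "s \<in> power_span R A x n" for n s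
    using that
  proof (induct n arbitrary: s)
    case 0
    have "(x [^] (0::nat) \<oplus> s) \<ominus> x [^] (0::nat) \<otimes> \<one> = \<zero>" using 0 by (simp add: minus_eq r_neg)
    then show ?case using subV(3) Q_one submodD(2)[OF J]
      by (intro exI[of _ "0::nat"] bexI[of _ \<one>]) auto
  next
    case (Suc n)
    from power_span_peel[OF A subring_submod[OF A] xC Suc(2)]
    obtain c t where t: "c \<in> A" "t \<in> power_span R A x n" "s = c \<oplus> x \<otimes> t" by blast
    have tV: "t \<in> V" using t PV by blast
    then have tC: "t \<in> carrier R" using subV by blast
    note D = xC tC AC[OF t(1)] nat_pow_closed[OF xC, of n]
    show ?case
    proof (cases "c \<in> I")
      case False
      have e: "x [^] Suc n \<oplus> s = c \<oplus> (x [^] n \<oplus> t) \<otimes> x" unfolding nat_pow_Suc t using D by algebra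
      have "(x [^] n \<oplus> t) \<otimes> x \<in> Q" using subQ(4)[OF _ x] D by simp
      then have nQ: "x [^] Suc n \<oplus> s \<notin> Q" unfolding e using Q_add_iff D False IQ[OF t(1)] by simp
      have VV: "x [^] Suc n \<oplus> s \<in> V" unfolding e
        by (intro subV(6,7) AV t tV xV subring_pow[OF V])
      have "(x [^] Suc n \<oplus> s) \<ominus> x [^] (0::nat) \<otimes> (x [^] Suc n \<oplus> s) = \<zero>"
        using subsetD[OF subV(1) VV] by (simp add: minus_eq r_neg)
      then show ?thesis using VV nQ submodD(2)[OF J] by metis
    next
      case True
      from Suc(1)[OF t(2)] obtain j :: nat and v where v: "v \<in> V" "v \<notin> Q" "(x [^] n \<oplus> t) \<ominus> x [^] j \<otimes> v \<in> J" by blast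
      have vC: "v \<in> carrier R" using v subV by blast
      have "(x [^] Suc n \<oplus> s) \<ominus> x [^] Suc j \<otimes> v = c \<oplus> x \<otimes> ((x [^] n \<oplus> t) \<ominus> x [^] j \<otimes> v)"
        unfolding nat_pow_Suc t using D vC nat_pow_closed[OF xC, of j] by algebra
      also have "\<dots> \<in> J" using True v(3) unfolding J_def by (auto intro: poly_values.step)
      finally show ?thesis using v by blast
    qed
  qed
  obtain n where n: "x [^] (n::nat) \<in> power_span R A x n" using int xC by blast
  have "\<ominus> (x [^] n) \<in> power_span R A x n"
    by (rule submod_neg[OF submod_power_span[OF A subring_submod[OF A] xC] A n])
  from cl[OF this] obtain j :: nat and v where v: "v \<in> V" "v \<notin> Q" "(x [^] n \<oplus> \<ominus> (x [^] n)) \<ominus> x [^] j \<otimes> v \<in> J" by blast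
  have vC: "v \<in> carrier R" using v subV by blast
  obtain w where w: "w \<in> poly_values R A v" "w \<otimes> v \<in> A" "w \<otimes> v \<notin> I"
    using integral_unit_multiple[OF vC v(2)] by blast
  have wV: "w \<in> V" using poly_values_least[OF V _ v(1)] AV w(1) by blast
  have wC: "w \<in> carrier R" using subV wV by blast
  have "(\<ominus> w) \<otimes> ((x [^] n \<oplus> \<ominus> (x [^] n)) \<ominus> x [^] j \<otimes> v) \<in> J"
    by (rule submodD(4)[OF J subV(5)[OF wV] v(3)])
  moreover have "(\<ominus> w) \<otimes> ((x [^] n \<oplus> \<ominus> (x [^] n)) \<ominus> x [^] j \<otimes> v) = (w \<otimes> v) \<otimes> x [^] j"
    using wC vC nat_pow_closed[OF xC, of n] nat_pow_closed[OF xC, of j] by algebra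
  ultimately show ?thesis unfolding J_def using w by metis
qed

text \<open>Over the base \<open>V = A[x]\<close> with the prime \<open>Q \<inter> V\<close>, the
  element \<open>z = y \<otimes> v\<close> already belongs to the base. Hence
  \<open>V[z] = V\<close>, and \<open>generator\<close> puts \<open>y\<close> into \<open>V\<close>
  up to a factor from \<open>V - Q\<close>.\<close>

lemma local_generator:
  assumes x: "x \<in> Q" and y: "y \<in> Q"
    and v: "v \<in> poly_values R (poly_values R A x) y" "v \<notin> Q" "y \<otimes> v \<in> poly_values R A x"
  shows "y \<in> saturation R A I (poly_values R A x)"
proof -
  have C: "x \<in> carrier R" "y \<in> carrier R" using x y subQ by auto
  define V where "V = poly_values R A x"
  have V: "subring V R" unfolding V_def by (rule subring_poly_values[OF A C(1)])
  note subV = subringE[OF V]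
  have AV: "A \<subseteq> V" unfolding V_def by (rule poly_values_incl)
  have Vc: "a \<in> V \<Longrightarrow> a \<in> carrier R" for a using subV by blast
  interpret V: prime_pair R V "Q \<inter> V"
  proof (rule prime_pair.intro[OF cring_axioms prime_pair_axioms.intro])
    show "subring V R" by fact
    show "submod R V (Q \<inter> V)" by (rule submodI) (use subQ subV Vc in auto)
    show "Q \<inter> V \<subseteq> V" by simp
    show "\<one> \<notin> Q \<inter> V" using Q_one by simp
    show "a \<in> Q \<inter> V \<or> b \<in> Q \<inter> V" if "a \<in> V" "b \<in> V" "a \<otimes> b \<in> Q \<inter> V" for a b
      using that Q_prime[of a b] Vc by blast
  qed
  obtain n where n: "y [^] (n::nat) \<in> power_span R A y n" using int C by blast
  obtain u k where u: "u \<in> A" "u \<notin> I" "u \<otimes> y [^] (k::nat) \<in> poly_values R I y" using nilpotent_mod[OF y] by blast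
  interpret V: nilpotent_gen R V "Q \<inter> V" y n k u
  proof unfold_locales
    show "y \<in> carrier R" by fact
    show "y [^] n \<in> power_span R V y n" using n power_span_mono[OF AV] by blast
    show "u \<in> V" using u AV by blast
    show "u \<notin> Q \<inter> V" using u IQ by blast
    have "I \<subseteq> Q \<inter> V" using QA AV by blast
    from poly_values_mono[OF this] show "u \<otimes> y [^] k \<in> poly_values R (Q \<inter> V) y" using u by blast
  qed
  from poly_values_cases[OF V subring_submod[OF V] C(2) v(1)[folded V_def]]
  obtain p q where pq: "p \<in> V" "q \<in> poly_values R V y" "v = p \<oplus> y \<otimes> q" by blast
  have qC: "q \<in> carrier R" using V.TC pq by blast
  have "y \<otimes> q \<in> Q" using subQ(4)[OF qC y] m_comm[OF qC C(2)] by simp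
  then have "p \<notin> Q \<inter> V" using v(2) pq(3) Q_add_iff[OF Vc[OF pq(1)]] by auto
  from V.generator[OF pq(1) this pq(2) refl]
  have "y \<in> saturation R V (Q \<inter> V) (poly_values R V (y \<otimes> v))" unfolding pq(3) .
  moreover have "poly_values R V (y \<otimes> v) \<subseteq> V"
    by (rule poly_values_least[OF V subset_refl v(3)[folded V_def]])
  ultimately obtain c where c: "c \<in> V" "c \<notin> Q" "c \<otimes> y \<in> V" by (auto elim!: saturationE)
  \<comment> \<open>The denominator \<open>c\<close> found over \<open>V\<close> lies in
    \<open>A[x]\<close>; the cofactor \<open>w\<close> turns it into one from \<open>A - I\<close>
    without leaving \<open>V\<close>.\<close>
  obtain w where w: "w \<in> poly_values R A c" "w \<otimes> c \<in> A" "w \<otimes> c \<notin> I"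
    using integral_unit_multiple[OF Vc[OF c(1)] c(2)] by blast
  have wV: "w \<in> V" using poly_values_least[OF V AV c(1)] w(1) by blast
  have "(w \<otimes> c) \<otimes> y = w \<otimes> (c \<otimes> y)" using Vc[OF wV] Vc[OF c(1)] C by algebra
  then show ?thesis using w c subV(6)[OF wV c(3)] C unfolding V_def
    by (intro saturationI[of _ _ "w \<otimes> c"]) auto
qed

end

section \<open>Localization and subintegrality\<close>

text \<open>Numerators from \<open>K\<close> and denominators from \<open>V\<close>, inside the
  localization of the overring. This covers the image of the localized base ring, the Nagata
  subring, and the extension of an intermediate ring to either setting.\<close>

definition fractions :: "('a, 'm) ring_scheme \<Rightarrow> 'a set \<Rightarrow> 'a set \<Rightarrow> 'a set \<Rightarrow> ('a \<times> 'a) set set" where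
  "fractions A W K V = {fraction A W f g | f g. f \<in> K \<and> g \<in> V}"

context multiplicative_set
begin

interpretation L: cring "localization A W" by (rule localization_cring)

lemma subring_fractions:
  assumes K: "subring K A" and V: "V \<subseteq> K" "V \<subseteq> W" "\<one> \<in> V" "\<And>a b. a \<in> V \<Longrightarrow> b \<in> V \<Longrightarrow> a \<otimes> b \<in> V"
  shows "subring (fractions A W K V) (localization A W)"
proof -
  note subK = subringE[OF K]
  have KC: "a \<in> carrier A" if "a \<in> K" for a using subK(1) that by blast
  have VW: "a \<in> W" "a \<in> K" "a \<in> carrier A" if "a \<in> V" for a using V that KC by blast+
  have fr: "fraction A W f g \<in> fractions A W K V" if "f \<in> K" "g \<in> V" for f g
    unfolding fractions_def using that by blast
  have frC: "fraction A W f g \<in> carrier (localization A W)" if "f \<in> K" "g \<in> V" for f g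
    using fraction_closed KC VW that by blast
  show ?thesis
  proof (rule L.subringI, goal_cases)
    case 1 show ?case unfolding fractions_def using frC by auto
  next
    case 2 show ?case unfolding fraction_one using fr subK(3) V(3) by blast
  next
    case (3 h)
    then obtain f g where fg: "h = fraction A W f g" "f \<in> K" "g \<in> V" unfolding fractions_def by blast
    have "fraction A W (\<ominus> f) g \<oplus>\<^bsub>localization A W\<^esub> fraction A W f g = fraction A W (\<ominus> f \<otimes> g \<oplus> f \<otimes> g) (g \<otimes> g)"
      using fg KC VW by (simp add: fraction_add)
    also have "\<dots> = \<zero>\<^bsub>localization A W\<^esub>"
    proof -
      have "(\<ominus> f \<otimes> g \<oplus> f \<otimes> g) \<otimes> \<one> = \<zero> \<otimes> (g \<otimes> g)" using KC[OF fg(2)] VW(3)[OF fg(3)] by algebra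
      then show ?thesis unfolding fraction_zero using KC[OF fg(2)] VW[OF fg(3)] one_closed
        by (intro fraction_eqI) auto
    qed
    finally have "\<ominus>\<^bsub>localization A W\<^esub> h = fraction A W (\<ominus> f) g"
      unfolding fg(1) by (rule L.minus_equality) (use frC fg subK in auto)
    then show ?case using fr fg subK by simp
  next
    case (4 a b)
    then obtain f g f' g' where *: "a = fraction A W f g" "f \<in> K" "g \<in> V" "b = fraction A W f' g'" "f' \<in> K" "g' \<in> V"
      unfolding fractions_def by blast
    show ?case unfolding * using * KC VW by (subst fraction_mult) (auto intro!: fr subK V(4))
  next
    case (5 a b)
    then obtain f g f' g' where *: "a = fraction A W f g" "f \<in> K" "g \<in> V" "b = fraction A W f' g'" "f' \<in> K" "g' \<in> V"
      unfolding fractions_def by blast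
    show ?case unfolding * using * KC VW by (subst fraction_add) (auto intro!: fr subK V(4))
  qed
qed

lemma subring_contraction:
  assumes T: "subring T (localization A W)"
  shows "subring {t \<in> carrier A. fraction A W t \<one> \<in> T} A"
proof -
  note subT = subringE[OF T]
  have neg: "fraction A W (\<ominus> t) \<one> = \<ominus>\<^bsub>localization A W\<^esub> fraction A W t \<one>" if "t \<in> carrier A" for t
  proof -
    have "fraction A W (\<ominus> t) \<one> \<oplus>\<^bsub>localization A W\<^esub> fraction A W t \<one> = \<zero>\<^bsub>localization A W\<^esub>"
      using that by (simp add: fraction_add fraction_zero l_neg)
    then show ?thesis using that by (intro L.minus_equality[symmetric]) (auto simp: fraction_closed)
  qed
  show ?thesis
  proof (rule subringI, goal_cases)
    case 1 show ?case by blast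
  next
    case 2 show ?case using subT(3) by (simp add: fraction_one)
  next
    case (3 h) then show ?case using neg subT(5) by auto
  next
    case (4 a b)
    then have "fraction A W (a \<otimes> b) \<one> = fraction A W a \<one> \<otimes>\<^bsub>localization A W\<^esub> fraction A W b \<one>"
      by (simp add: fraction_mult)
    then show ?case using 4 subT(6) by auto
  next
    case (5 a b)
    then have "fraction A W (a \<oplus> b) \<one> = fraction A W a \<one> \<oplus>\<^bsub>localization A W\<^esub> fraction A W b \<one>"
      by (simp add: fraction_add)
    then show ?case using 5 subT(7) by auto
  qed
qed

lemma fraction_mem_iff:
  assumes T: "subring T (localization A W)" and a: "a \<in> carrier A" "s \<in> W"
    and s: "fraction A W \<one> s \<in> T" "fraction A W s \<one> \<in> T"
  shows "fraction A W a s \<in> T \<longleftrightarrow> fraction A W a \<one> \<in> T"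
proof -
  note subT = subringE[OF T]
  note sC = W_carrier[OF a(2)]
  have "fraction A W a \<one> = fraction A W a s \<otimes>\<^bsub>localization A W\<^esub> fraction A W s \<one>"
  proof -
    have "fraction A W a s \<otimes>\<^bsub>localization A W\<^esub> fraction A W s \<one> = fraction A W (a \<otimes> s) s"
      using a sC by (simp add: fraction_mult)
    also have "\<dots> = fraction A W a \<one>" by (rule fraction_eqI) (use a sC in auto)
    finally show ?thesis by simp
  qed
  moreover have "fraction A W a s = fraction A W a \<one> \<otimes>\<^bsub>localization A W\<^esub> fraction A W \<one> s"
    using a sC by (simp add: fraction_mult)
  ultimately show ?thesis using s subT(6) by metis
qed

end

section \<open>Chained localizations in terms of elements\<close>

context prime_pair
begin

lemma multiplicative_complement: "multiplicative_set R (A - I)"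
  by (intro multiplicative_set.intro is_cring submonoid.intro)
    (use AC one_in one_notin unit_mult in auto)

interpretation M: multiplicative_set R "A - I" by (rule multiplicative_complement)

text \<open>This identifies \<open>saturation\<close> with the preimage of the localized
  \<open>K\<close> under the canonical map. Denominators from \<open>A - I\<close> can be cleared
  within \<open>K\<close> because \<open>A \<subseteq> K\<close>.\<close>

lemma fraction_in_fractions_iff:
  assumes K: "subring K R" "A \<subseteq> K" and t: "t \<in> carrier R"
  shows "fraction R (A - I) t \<one> \<in> fractions R (A - I) K (A - I) \<longleftrightarrow> t \<in> saturation R A I K" (is "?l = ?r")
proof -
  note subK = subringE[OF K(1)]
  have KC: "a \<in> carrier R" if "a \<in> K" for a using subK(1) that by blast
  have "?r" if "?l"
  proof -
    from that obtain f g where fg: "f \<in> K" "g \<in> A - I" "fraction R (A - I) t \<one> = fraction R (A - I) f g"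
      unfolding fractions_def by blast
    then obtain u where u: "u \<in> A - I" "u \<otimes> (t \<otimes> g) = u \<otimes> (f \<otimes> \<one>)"
      using M.fraction_eq_iff[OF t _ KC[OF fg(1)] fg(2), of \<one>] one_in one_notin by blast
    have "(u \<otimes> g) \<otimes> t = u \<otimes> (t \<otimes> g)" using u(1) fg(2) AC t by (simp add: m_ac)
    also have "\<dots> \<in> K" unfolding u(2) using subK(6)[of u f] K(2) u(1) fg KC by auto
    finally show ?thesis using unit_mult[of u g] u(1) fg(2) t by (intro saturationI[of _ _ "u \<otimes> g"]) auto
  qed
  moreover have "?l" if "?r"
  proof -
    from that obtain u where u: "u \<in> A" "u \<notin> I" "u \<otimes> t \<in> K" by (rule saturationE)
    have "fraction R (A - I) t \<one> = fraction R (A - I) (u \<otimes> t) u"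
      by (rule M.fraction_eqI) (use u t AC one_in one_notin m_comm in auto)
    then show ?thesis unfolding fractions_def using u by blast
  qed
  ultimately show ?thesis by blast
qed

lemma base_fractions:
  "fraction_map R (A - I) ` carrier (localization (subring_of R A) (A - I)) = fractions R (A - I) A (A - I)"
proof -
  have c: "cring (subring_of R A)"
    using subcring_iff[OF subA(1)] subcringI'[OF A] by blast
  interpret S: multiplicative_set "subring_of R A" "A - I"
    by (intro multiplicative_set.intro c submonoid.intro)
      (use one_in one_notin unit_mult in auto)
  have e: "fraction_map R (A - I) (fraction (subring_of R A) (A - I) a s) = fraction R (A - I) a s"
    if "a \<in> A" "s \<in> A - I" for a s
    by (rule fraction_map_fraction[OF S.multiplicative_set_axioms M.multiplicative_set_axioms])
      (use that subA(1) in auto)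
  have "carrier (localization (subring_of R A) (A - I)) =
      {fraction (subring_of R A) (A - I) a s | a s. a \<in> A \<and> s \<in> A - I}"
  proof
    show "carrier (localization (subring_of R A) (A - I)) \<subseteq>
      {fraction (subring_of R A) (A - I) a s | a s. a \<in> A \<and> s \<in> A - I}"
    proof
      fix x assume "x \<in> carrier (localization (subring_of R A) (A - I))"
      then obtain a s where "a \<in> carrier (subring_of R A)" "s \<in> A - I" "x = fraction (subring_of R A) (A - I) a s"
        by (rule S.fraction_cases)
      then show "x \<in> {fraction (subring_of R A) (A - I) a s | a s. a \<in> A \<and> s \<in> A - I}" by auto
    qed
  qed (use S.fraction_closed in auto)
  note c = this
  show ?thesis
  proof (intro equalityI subsetI)
    fix x assume "x \<in> fraction_map R (A - I) ` carrier (localization (subring_of R A) (A - I))"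
    then obtain z where z: "x = fraction_map R (A - I) z" "z \<in> carrier (localization (subring_of R A) (A - I))" by (rule imageE)
    then obtain a s where "z = fraction (subring_of R A) (A - I) a s" "a \<in> A" "s \<in> A - I"
      unfolding c mem_Collect_eq by (elim exE conjE) rule
    then show "x \<in> fractions R (A - I) A (A - I)" unfolding fractions_def z(1) mem_Collect_eq
      using e by (intro exI conjI) simp_all
  next
    fix x assume "x \<in> fractions R (A - I) A (A - I)"
    then obtain a s where as: "x = fraction R (A - I) a s" "a \<in> A" "s \<in> A - I"
      unfolding fractions_def by blast
    show "x \<in> fraction_map R (A - I) ` carrier (localization (subring_of R A) (A - I))"
      unfolding as(1) e[OF as(2,3), symmetric] using as(2,3) S.fraction_closed
      by (intro imageI) simp
  qed
qed

text \<open>Denominators are units of every intermediate ring, so these rings are compared through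
  the elements \<open>t / 1\<close>. Incomparable elements \<open>x\<close>, \<open>y\<close> make
  the localizations of \<open>A[x]\<close> and \<open>A[y]\<close> incomparable, and incomparable
  rings contain such elements.\<close>

lemma chained_at_iff:
  "chained_at R A I \<longleftrightarrow> (\<forall>x\<in>carrier R. \<forall>y\<in>carrier R.
     x \<in> saturation R A I (poly_values R A y) \<or> y \<in> saturation R A I (poly_values R A x))"
proof -
  define W where "W = A - I"
  define fr where "fr = fraction R W"
  define L where "L = localization R W"
  interpret L: cring L unfolding L_def W_def by (rule M.localization_cring)
  have W1: "\<one> \<in> W" unfolding W_def using one_in one_notin by blast
  have V: "subring (poly_values R A y) R" "A \<subseteq> poly_values R A y" if "y \<in> carrier R" for y
    using subring_poly_values[OF A that] poly_values_incl by auto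
  have F: "subring (fractions R W K W) L" "fractions R W A W \<subseteq> fractions R W K W"
    if "subring K R" "A \<subseteq> K" for K
  proof -
    show "subring (fractions R W K W) L" unfolding L_def W_def
      by (rule M.subring_fractions) (use that one_in one_notin unit_mult in auto)
    show "fractions R W A W \<subseteq> fractions R W K W" unfolding fractions_def using that by blast
  qed
  have C: "chained_at R A I \<longleftrightarrow> (\<forall>T1 T2. subring T1 L \<longrightarrow> fractions R W A W \<subseteq> T1 \<longrightarrow>
      subring T2 L \<longrightarrow> fractions R W A W \<subseteq> T2 \<longrightarrow> T1 \<subseteq> T2 \<or> T2 \<subseteq> T1)"
    unfolding chained_at_def base_fractions chained_def intermediate_rings_def chain_subset_def
      W_def L_def by blast
  show ?thesis
  proof
    assume ch: "chained_at R A I"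
    show "\<forall>x\<in>carrier R. \<forall>y\<in>carrier R.
     x \<in> saturation R A I (poly_values R A y) \<or> y \<in> saturation R A I (poly_values R A x)"
    proof (intro ballI)
      fix x y assume xy: "x \<in> carrier R" "y \<in> carrier R"
      have in_own: "fr z \<one> \<in> fractions R W (poly_values R A z) W" if "z \<in> carrier R" for z
        unfolding fr_def fractions_def using poly_values_var[OF A that] W1 by blast
      have "fractions R W (poly_values R A x) W \<subseteq> fractions R W (poly_values R A y) W \<or>
        fractions R W (poly_values R A y) W \<subseteq> fractions R W (poly_values R A x) W"
        using ch F V xy unfolding C by meson
      then have "fr x \<one> \<in> fractions R W (poly_values R A y) W \<or> fr y \<one> \<in> fractions R W (poly_values R A x) W"
        using in_own xy by blast
      then show "x \<in> saturation R A I (poly_values R A y) \<or> y \<in> saturation R A I (poly_values R A x)"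
          unfolding fr_def W_def
        using fraction_in_fractions_iff[OF V[OF xy(2)] xy(1)] fraction_in_fractions_iff[OF V[OF xy(1)] xy(2)] by blast
    qed
  next
    assume sat: "\<forall>x\<in>carrier R. \<forall>y\<in>carrier R.
     x \<in> saturation R A I (poly_values R A y) \<or> y \<in> saturation R A I (poly_values R A x)"
    \<comment> \<open>With \<open>y\<close> in \<open>T2\<close> but not in \<open>T1\<close>, no
      \<open>x\<close> of \<open>T1\<close> can have \<open>y\<close> locally in
      \<open>A[x]\<close>. So every such \<open>x\<close> is locally in \<open>A[y]\<close>, hence
      in \<open>T2\<close>.\<close>
    have sub: "T1 \<subseteq> T2" if "subring T1 L" "subring T2 L" "fractions R W A W \<subseteq> T1" "fractions R W A W \<subseteq> T2"
      and y: "y \<in> carrier R" "fr y \<one> \<in> T2" "fr y \<one> \<notin> T1"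
      and sat: "\<And>x. x \<in> carrier R \<Longrightarrow> x \<in> saturation R A I (poly_values R A y) \<or> y \<in> saturation R A I (poly_values R A x)"
      for T1 T2 y
    proof
      have units: "fr \<one> s \<in> T" "fr s \<one> \<in> T" if "s \<in> W" "fractions R W A W \<subseteq> T" for s T
        using that one_in W1 unfolding fr_def fractions_def W_def by blast+
      have mem: "fr a s \<in> T \<longleftrightarrow> fr a \<one> \<in> T" if "subring T L" "fractions R W A W \<subseteq> T" "a \<in> carrier R" "s \<in> W" for a s T
        unfolding fr_def W_def
        by (rule M.fraction_mem_iff) (use that units[of s T] in \<open>auto simp: L_def W_def fr_def\<close>)
      have closed: "fr t \<one> \<in> T" if T: "subring T L" "fractions R W A W \<subseteq> T"
        and z: "z \<in> carrier R" "fr z \<one> \<in> T" and t: "t \<in> saturation R A I (poly_values R A z)" for t z T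
      proof -
        define K where "K = {t \<in> carrier R. fr t \<one> \<in> T}"
        have K: "subring K R" unfolding K_def fr_def W_def
          by (rule M.subring_contraction) (use T in \<open>simp add: L_def W_def\<close>)
        have "A \<subseteq> K" unfolding K_def fr_def using T(2) W1 AC unfolding fractions_def by blast
        then have "poly_values R A z \<subseteq> K" using z by (intro poly_values_least[OF K]) (auto simp: K_def)
        with t obtain u where u: "t \<in> carrier R" "u \<in> A" "u \<notin> I" "u \<otimes> t \<in> K" by (auto elim!: saturationE)
        have "fr t \<one> = fr (u \<otimes> t) u" unfolding fr_def W_def
          by (rule M.fraction_eqI) (use u AC one_in one_notin m_comm in auto)
        also have "\<dots> \<in> T" using mem[OF T, of "u \<otimes> t" u] u AC unfolding K_def W_def by auto
        finally show ?thesis .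
      qed
      fix h assume h: "h \<in> T1"
      then have "h \<in> carrier L" using subringE(1)[OF that(1)] by blast
      then obtain x s where xs: "h = fr x s" "x \<in> carrier R" "s \<in> W"
        unfolding L_def W_def fr_def by (rule M.fraction_cases)
      have x1: "fr x \<one> \<in> T1" using mem[OF that(1,3) xs(2,3)] h xs(1) by simp
      have "x \<in> saturation R A I (poly_values R A y)"
        using sat[OF xs(2)] closed[OF that(1,3) xs(2) x1] y(3) by blast
      then have "fr x \<one> \<in> T2" using closed[OF that(2,4) y(1,2)] by blast
      then show "h \<in> T2" using mem[OF that(2,4) xs(2,3)] xs(1) by simp
    qed
    show "chained_at R A I" unfolding C
    proof (intro allI impI)
      fix T1 T2 assume T: "subring T1 L" "fractions R W A W \<subseteq> T1" "subring T2 L" "fractions R W A W \<subseteq> T2"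
      show "T1 \<subseteq> T2 \<or> T2 \<subseteq> T1"
      proof (cases "\<exists>y\<in>carrier R. fr y \<one> \<in> T2 \<and> fr y \<one> \<notin> T1")
        case True
        then show ?thesis using sub[OF T(1,3,2,4)] sat by blast
      next
        case False
        have "T2 \<subseteq> T1"
        proof
          fix h assume h: "h \<in> T2"
          then have "h \<in> carrier L" using subringE(1)[OF T(3)] by blast
          then obtain x s where xs: "h = fr x s" "x \<in> carrier R" "s \<in> W"
            unfolding L_def W_def fr_def by (rule M.fraction_cases)
          have units: "fr \<one> s \<in> T2" "fr s \<one> \<in> T2" "fr \<one> s \<in> T1" "fr s \<one> \<in> T1"
            using T xs(3) one_in W1 unfolding fr_def fractions_def W_def by blast+
          have "fr x s \<in> T2 \<longleftrightarrow> fr x \<one> \<in> T2" unfolding fr_def W_def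
            by (rule M.fraction_mem_iff) (use T units xs in \<open>auto simp: L_def W_def fr_def\<close>)
          moreover have "fr x s \<in> T1 \<longleftrightarrow> fr x \<one> \<in> T1" unfolding fr_def W_def
            by (rule M.fraction_mem_iff) (use T units xs in \<open>auto simp: L_def W_def fr_def\<close>)
          ultimately show "h \<in> T1" using False h xs by blast
        qed
        then show ?thesis by blast
      qed
    qed
  qed
qed

end

section \<open>Consequences of subintegrality at a prime\<close>

lemma (in cring) integral_extension_power_span:
  assumes "integral_extension R A" "subring A R" "x \<in> carrier R"
  shows "\<exists>n. x [^] (n::nat) \<in> power_span R A x n"
proof -
  have sum: "(\<Oplus>i\<in>{..<n}. c i \<otimes> (x [^] i)) \<in> power_span R A x n" if "c \<in> {..<n} \<rightarrow> A" for n :: nat and c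
    using that
  proof (induct n)
    case 0 then show ?case by simp
  next
    case (Suc n)
    then have c: "c \<in> {..<n} \<rightarrow> A" "c n \<in> A" by auto
    have cC: "c i \<in> carrier R" if "i < Suc n" for i using Suc(2) that subringE(1)[OF assms(2)] by auto
    have s: "(\<Oplus>i\<in>{..<n}. c i \<otimes> (x [^] i)) \<in> carrier R" using cC assms(3) by (intro finsum_closed) auto
    have "(\<Oplus>i\<in>{..<Suc n}. c i \<otimes> (x [^] i)) = c n \<otimes> x [^] n \<oplus> (\<Oplus>i\<in>{..<n}. c i \<otimes> (x [^] i))"
      unfolding lessThan_Suc by (rule finsum_insert) (use cC assms(3) in auto)
    also have "\<dots> = (\<Oplus>i\<in>{..<n}. c i \<otimes> (x [^] i)) \<oplus> c n \<otimes> x [^] n"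
      using s cC assms(3) by (intro a_comm) auto
    finally show ?case unfolding power_span.simps using Suc(1)[OF c(1)] c(2) by blast
  qed
  obtain n c where nc: "c \<in> {..<n::nat} \<rightarrow> A" "x [^] n \<oplus> (\<Oplus>i\<in>{..<n}. c i \<otimes> (x [^] i)) = \<zero>"
    using assms(1,3) unfolding integral_extension_def by blast
  have sC: "(\<Oplus>i\<in>{..<n}. c i \<otimes> (x [^] i)) \<in> carrier R"
    using nc(1) subringE(1)[OF assms(2)] assms(3) by (intro finsum_closed) auto
  have "x [^] n = \<ominus> (\<Oplus>i\<in>{..<n}. c i \<otimes> (x [^] i))"
    using nc(2) sC assms(3) by (intro minus_equality[symmetric]) auto
  then have "x [^] n \<in> power_span R A x n"
    using submod_neg[OF submod_power_span[OF assms(2) subring_submod[OF assms(2)] assms(3)] assms(2) sum[OF nc(1)]] by simp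
  then show ?thesis by blast
qed

lemma (in cring) prime_pair_of_primeideal:
  assumes A: "subring A R" and I: "primeideal I (subring_of R A)"
  shows "prime_pair R A I"
proof (rule prime_pair.intro[OF is_cring prime_pair_axioms.intro])
  interpret I: primeideal I "subring_of R A" by fact
  show "subring A R" by fact
  show "submod R A I"
  proof (rule submodI)
    show "I \<subseteq> carrier R" using I.a_subset subringE(1)[OF A] by auto
    show "\<zero> \<in> I" using additive_subgroup.zero_closed[OF I.is_additive_subgroup] by simp
    show "a \<oplus> b \<in> I" if "a \<in> I" "b \<in> I" for a b using additive_subgroup.a_closed[OF I.is_additive_subgroup that] by simp
    show "a \<otimes> b \<in> I" if "a \<in> A" "b \<in> I" for a b using I.I_l_closed[OF that(2)] that(1) by simp
  qed
  show "I \<subseteq> A" using I.a_subset by simp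
  show "\<one> \<notin> I" using I.one_imp_carrier I.I_notcarr by auto
  show "a \<in> I \<or> b \<in> I" if "a \<in> A" "b \<in> A" "a \<otimes> b \<in> I" for a b
    using I.I_prime that by simp
qed

text \<open>Fractions with numerator in \<open>Q\<close> form an ideal that contains the
  generators.\<close>

lemma (in cring) extended_prime_fraction:
  assumes Q: "primeideal Q R" and x: "x \<in> extended_prime R Q"
  shows "\<exists>q\<in>Q. \<exists>t\<in>carrier R - Q. x = fraction R (carrier R - Q) q t"
proof -
  interpret Q: primeideal Q R by fact
  have one: "\<one> \<notin> Q" using Q.one_imp_carrier Q.I_notcarr by blast
  interpret M: multiplicative_set R "carrier R - Q"
    by (intro multiplicative_set.intro is_cring submonoid.intro) (use one Q.I_prime in auto)
  interpret L: cring "localization R (carrier R - Q)" by (rule M.localization_cring)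
  define X where "X = {fraction R (carrier R - Q) q t | q t. q \<in> Q \<and> t \<in> carrier R - Q}"
  have QC: "q \<in> carrier R" if "q \<in> Q" for q using that Q.a_subset by blast
  have X: "submod (localization R (carrier R - Q)) (carrier (localization R (carrier R - Q))) X"
  proof (rule submodI, goal_cases)
    case 1 show ?case unfolding X_def using M.fraction_closed QC by blast
  next
    case 2 show ?case unfolding X_def M.fraction_zero using Q.zero_closed M.one_closed by blast
  next
    case (3 a b)
    then obtain q t q' t' where *: "a = fraction R (carrier R - Q) q t" "b = fraction R (carrier R - Q) q' t'"
      "q \<in> Q" "t \<in> carrier R - Q" "q' \<in> Q" "t' \<in> carrier R - Q" unfolding X_def by blast
    then have "a \<oplus>\<^bsub>localization R (carrier R - Q)\<^esub> b = fraction R (carrier R - Q) (q \<otimes> t' \<oplus> q' \<otimes> t) (t \<otimes> t')"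
      by (simp only: M.fraction_add QC)
    moreover have "q \<otimes> t' \<oplus> q' \<otimes> t \<in> Q" using * Q.I_r_closed by auto
    moreover have "t \<otimes> t' \<in> carrier R - Q" using * M.m_closed by blast
    ultimately show ?case unfolding X_def by blast
  next
    case (4 a b)
    then obtain q t q' t' where *: "a = fraction R (carrier R - Q) q t" "b = fraction R (carrier R - Q) q' t'"
      "q \<in> carrier R" "t \<in> carrier R - Q" "q' \<in> Q" "t' \<in> carrier R - Q" unfolding X_def by (blast elim: M.fraction_cases)
    then have "a \<otimes>\<^bsub>localization R (carrier R - Q)\<^esub> b = fraction R (carrier R - Q) (q \<otimes> q') (t \<otimes> t')"
      by (simp only: M.fraction_mult QC)
    moreover have "q \<otimes> q' \<in> Q" using * Q.I_l_closed by auto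
    moreover have "t \<otimes> t' \<in> carrier R - Q" using * M.m_closed by blast
    ultimately show ?case unfolding X_def by blast
  qed
  have "(\<lambda>p. fraction R (carrier R - Q) p \<one>) ` Q \<subseteq> X" unfolding X_def using one by blast
  then have "extended_prime R Q \<subseteq> X"
    unfolding extended_prime_def local_ring_at_def
    by (rule L.genideal_minimal[OF L.submod_ideal[OF X]])
  then show ?thesis using x unfolding X_def by blast
qed

text \<open>Surjectivity of the residual map: the class of \<open>s / 1\<close> comes from some
  \<open>a / t\<close> with \<open>t \<in> A - Q\<close>, and clearing denominators gives
  \<open>t \<otimes> s \<ominus> a \<in> Q\<close>.\<close>

lemma (in cring) subintegral_residue:
  assumes A: "subring A R" and sub: "subintegral R A" and Q: "primeideal Q R" and s: "s \<in> carrier R"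
  shows "\<exists>u\<in>A - Q. \<exists>r\<in>A. u \<otimes> s \<ominus> r \<in> Q"
proof -
  interpret Q: primeideal Q R by fact
  have one: "\<one> \<notin> Q" using Q.one_imp_carrier Q.I_notcarr by blast
  define W where "W = carrier R - Q"
  interpret M: multiplicative_set R W unfolding W_def
    by (intro multiplicative_set.intro is_cring submonoid.intro) (use one Q.I_prime in auto)
  interpret L: cring "localization R W" by (rule M.localization_cring)
  have AC: "a \<in> carrier R" if "a \<in> A" for a using that subringE(1)[OF A] by blast
  have c: "cring (subring_of R A)"
    using subcring_iff[OF subringE(1)[OF A]] subcringI'[OF A] by blast
  define V where "V = A - Q \<inter> A"
  have VA: "V = A - Q" unfolding V_def by blast
  have AQ: "a \<in> Q \<or> b \<in> Q" if "a \<in> A" "b \<in> A" "a \<otimes> b \<in> Q" for a b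
    using Q.I_prime AC that by blast
  interpret S: multiplicative_set "subring_of R A" V unfolding VA
    by (intro multiplicative_set.intro c submonoid.intro)
      (use one subringE(3)[OF A] subringE(6)[OF A] AQ in auto)
  define Res where "Res = residual_map R Q"
  have surj: "Res ` carrier (residue_field (subring_of R A) (Q \<inter> A)) = carrier (residue_field R Q)"
    using sub Q unfolding subintegral_def prime_spectrum_def ring_iso_def bij_betw_def Res_def by auto
  define E where "E = extended_prime R Q"
  have E_id: "ideal E (localization R W)"
    unfolding E_def extended_prime_def local_ring_at_def W_def[symmetric]
    proof (rule L.genideal_ideal)
    show "(\<lambda>p. fraction R W p \<one>) ` Q \<subseteq> carrier (localization R W)"
      using M.fraction_closed[OF subsetD[OF Q.a_subset] M.one_closed] by blast
  qed
  interpret E: ideal E "localization R W" by (rule E_id)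
  have sL: "fraction R W s \<one> \<in> carrier (localization R W)" by (rule M.fraction_closed[OF s]) simp
  have "E +>\<^bsub>localization R W\<^esub> fraction R W s \<one> \<in> Res ` carrier (residue_field (subring_of R A) (Q \<inter> A))"
    unfolding surj
    unfolding residue_field_def FactRing_def local_ring_at_def W_def[symmetric] E_def[symmetric]
    using L.a_rcosetsI[OF E.a_subset sL] by simp
  then obtain C where C: "C \<in> carrier (residue_field (subring_of R A) (Q \<inter> A))"
    "Res C = E +>\<^bsub>localization R W\<^esub> fraction R W s \<one>" by (elim imageE) simp
  interpret LA: cring "localization (subring_of R A) V" by (rule S.localization_cring)
  have "ideal (extended_prime (subring_of R A) (Q \<inter> A)) (localization (subring_of R A) V)"
    unfolding extended_prime_def local_ring_at_def
    unfolding V_def[symmetric] by (simp add: V_def[symmetric], rule LA.genideal_ideal) (use S.fraction_closed S.one_closed in auto)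
  then interpret EA: ideal "extended_prime (subring_of R A) (Q \<inter> A)" "localization (subring_of R A) V" .
  obtain z where z: "z \<in> carrier (localization (subring_of R A) V)"
      "C = extended_prime (subring_of R A) (Q \<inter> A) +>\<^bsub>localization (subring_of R A) V\<^esub> z"
    using C(1) unfolding residue_field_def FactRing_def local_ring_at_def A_RCOSETS_def'
    by (auto simp: V_def)
  have zC: "z \<in> C" unfolding z(2) by (rule EA.a_rcos_self[OF z(1)])
  obtain a t where at: "a \<in> A" "t \<in> V" "z = fraction (subring_of R A) V a t"
    using S.fraction_cases[OF z(1)] by auto
  have fz: "fraction_map R W z = fraction R W a t" unfolding at(3)
    by (rule fraction_map_fraction[OF S.multiplicative_set_axioms M.multiplicative_set_axioms])
      (use at AC in \<open>auto simp: V_def W_def\<close>)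
  have tW: "t \<in> W" using at AC unfolding V_def W_def by blast
  have atL: "fraction R W a t \<in> carrier (localization R W)" by (rule M.fraction_closed[OF AC[OF at(1)] tW])
  \<comment> \<open>\<open>residual_map\<close> is a union over all representatives of the coset
    \<open>C\<close>. The contribution of the single representative \<open>z\<close> suffices to
    place \<open>a / t\<close> in the coset of \<open>s / 1\<close>.\<close>
  have "E +>\<^bsub>localization R W\<^esub> fraction R W a t \<subseteq> Res C"
    unfolding Res_def residual_map_def local_ring_at_def W_def[symmetric] E_def[symmetric] fz[symmetric]
    using zC by blast
  then have "fraction R W a t \<in> E +>\<^bsub>localization R W\<^esub> fraction R W s \<one>"
    using E.a_rcos_self[OF atL] C(2) by blast
  then obtain e where e: "e \<in> E" "fraction R W a t = e \<oplus>\<^bsub>localization R W\<^esub> fraction R W s \<one>"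
    unfolding a_r_coset_def' by blast
  obtain q t' where q: "q \<in> Q" "t' \<in> W" "e = fraction R W q t'"
    using extended_prime_fraction[OF Q e(1)[unfolded E_def]] unfolding W_def by blast
  have qC: "q \<in> carrier R" using q Q.a_subset by blast
  have t'C: "t' \<in> carrier R" "t' \<notin> Q" "t \<in> carrier R" using q tW unfolding W_def by auto
  have "fraction R W a t = fraction R W (q \<oplus> s \<otimes> t') t'"
    unfolding e(2) q(3) using qC q(2) s t'C by (subst M.fraction_add) auto
  then obtain w where w: "w \<in> W" "w \<otimes> (a \<otimes> t') = w \<otimes> ((q \<oplus> s \<otimes> t') \<otimes> t)"
    using M.fraction_eq_iff[OF AC[OF at(1)] tW _ q(2), of "q \<oplus> s \<otimes> t'"] qC s t'C by auto
  have wC: "w \<in> carrier R" "w \<notin> Q" using w unfolding W_def by auto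
  note D = wC(1) AC[OF at(1)] t'C(1,3) qC s
  \<comment> \<open>Cross-multiplication gives membership in \<open>Q\<close> with the extra factor
    \<open>w \<otimes> t'\<close>; both \<open>w\<close> and \<open>t'\<close> are outside the prime
    \<open>Q\<close> and can be removed.\<close>
  have "(w \<otimes> t') \<otimes> (t \<otimes> s \<ominus> a) = w \<otimes> ((q \<oplus> s \<otimes> t') \<otimes> t) \<ominus> w \<otimes> (a \<otimes> t') \<ominus> (w \<otimes> t) \<otimes> q"
    using D by algebra
  also have "\<dots> = (\<ominus> (w \<otimes> t)) \<otimes> q" unfolding w(2) using D by algebra
  also have "\<dots> \<in> Q" by (rule Q.I_l_closed[OF q(1)]) (use D in auto)
  finally have "(w \<otimes> t') \<otimes> (t \<otimes> s \<ominus> a) \<in> Q" .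
  then have "t \<otimes> s \<ominus> a \<in> Q"
    using Q.I_prime[of "w \<otimes> t'" "t \<otimes> s \<ominus> a"] Q.I_prime[of w t'] D wC t'C by auto
  then show ?thesis using at VA by blast
qed

text \<open>Surjectivity on spectra provides \<open>Q\<close>, injectivity its uniqueness.\<close>

lemma (in cring) subintegral_integral_prime:
  assumes A: "subring A R" and sub: "subintegral R A" and IP: "primeideal I (subring_of R A)"
  obtains Q where "integral_prime R A I Q"
proof -
  interpret prime_pair R A I by (rule prime_pair_of_primeideal[OF A IP])
  have bij: "bij_betw (\<lambda>Q. Q \<inter> A) (prime_spectrum R) (prime_spectrum (subring_of R A))"
    using sub unfolding subintegral_def by blast
  have "I \<in> prime_spectrum (subring_of R A)" using IP unfolding prime_spectrum_def by simp
  then have "I \<in> (\<lambda>Q. Q \<inter> A) ` prime_spectrum R" using bij unfolding bij_betw_def by simp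
  then obtain Q where Q: "primeideal Q R" "Q \<inter> A = I"
    unfolding prime_spectrum_def by blast
  have "integral_prime R A I Q"
  proof (rule integral_prime.intro[OF prime_pair_axioms integral_prime_axioms.intro])
    show "\<exists>n. x [^] (n::nat) \<in> power_span R A x n" if "x \<in> carrier R" for x
      using integral_extension_power_span[OF _ A that] sub unfolding subintegral_def by blast
    show "P = Q" if "primeideal P R" "P \<inter> A = I" for P
      using bij that Q unfolding bij_betw_def inj_on_def prime_spectrum_def by simp
  qed (use Q in auto)
  then show ?thesis by (rule that)
qed

section \<open>Polynomials of unit content\<close>

text \<open>\<open>A[X]\<close>, \<open>I[X]\<close> and \<open>Q[X]\<close> all become subsets of
  the one ring \<open>UP R\<close>, so module and primeness arguments do not change the ambient
  ring.\<close>

definition polys :: "('a, 'm) ring_scheme \<Rightarrow> 'a set \<Rightarrow> (nat \<Rightarrow> 'a) set" where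
  "polys R K = {p \<in> carrier (UP R). \<forall>n. coeff (UP R) p n \<in> K}"

lemma coeff_UP: "p \<in> carrier (UP R) \<Longrightarrow> coeff (UP R) p n = p n"
  by (simp add: UP_def)

lemma polysI: "p \<in> carrier (UP R) \<Longrightarrow> (\<And>n. coeff (UP R) p n \<in> K) \<Longrightarrow> p \<in> polys R K"
  unfolding polys_def by blast

lemma polysD: "p \<in> polys R K \<Longrightarrow> p \<in> carrier (UP R)" "p \<in> polys R K \<Longrightarrow> coeff (UP R) p n \<in> K"
  unfolding polys_def by auto

lemma polys_mono: "K \<subseteq> L \<Longrightarrow> polys R K \<subseteq> polys R L"
  unfolding polys_def by blast

lemma (in cring) finsum_submod:
  assumes K: "submod R A K" and "finite F" "\<And>i. i \<in> F \<Longrightarrow> f i \<in> K"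
  shows "(\<Oplus>i\<in>F. f i) \<in> K"
  using assms(2,3)
proof (induct F rule: finite_induct)
  case empty then show ?case using submodD(2)[OF K] by simp
next
  case (insert a F)
  then have "(\<Oplus>i\<in>insert a F. f i) = f a \<oplus> (\<Oplus>i\<in>F. f i)"
    using submodD(1)[OF K] by (intro finsum_insert) auto
  then show ?case using insert submodD(3)[OF K] by simp
qed

locale polynomials = cring R for R (structure)

sublocale polynomials \<subseteq> UP: UP_cring R "UP R"
  by unfold_locales

context polynomials
begin

abbreviation "P \<equiv> UP R"
abbreviation "cf \<equiv> coeff P"
abbreviation "C a \<equiv> monom P a 0"
abbreviation "X i \<equiv> monom P \<one> i"

lemma submod_polys:
  assumes K: "submod R A K" and A: "A \<subseteq> carrier R"
  shows "submod P (polys R A) (polys R K)"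
proof (rule submodI, goal_cases)
  case 1 show ?case using polysD by blast
next
  case 2 show ?case by (rule polysI) (use submodD(2)[OF K] in auto)
next
  case (3 a b) then show ?case
    by (intro polysI) (use submodD(3)[OF K] polysD[of _ R K] in auto)
next
  case (4 a b)
  note D = polysD[OF 4(1)] polysD[OF 4(2)]
  show ?case
  proof (rule polysI)
    show "a \<otimes>\<^bsub>P\<^esub> b \<in> carrier P" using D by simp
    fix n
    have "(\<Oplus>i\<in>{..n}. cf a i \<otimes> cf b (n - i)) \<in> K"
      by (rule finsum_submod[OF K]) (use D submodD(4)[OF K] in auto)
    then show "cf (a \<otimes>\<^bsub>P\<^esub> b) n \<in> K" using D by (simp add: UP.coeff_mult)
  qed
qed

lemma subring_polys:
  assumes A: "subring A R" shows "subring (polys R A) P"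
proof -
  note s = submodD[OF submod_polys[OF subring_submod[OF A] subringE(1)[OF A]]]
  show ?thesis
  proof (rule UP.P.subringI, goal_cases)
    case 1 show ?case using polysD by blast
  next
    case 2 show ?case by (rule polysI) (use subringE(2,3)[OF A] in auto)
  next
    case (3 h) then show ?case
      by (intro polysI) (use subringE(5)[OF A] polysD[of _ R A] in auto)
  qed (use s(3,4) in auto)
qed

lemma C_polys: "a \<in> K \<Longrightarrow> \<zero> \<in> K \<Longrightarrow> a \<in> carrier R \<Longrightarrow> monom P a n \<in> polys R K"
  by (rule polysI) auto

lemma coeff_monom_mult:
  assumes "a \<in> carrier R" "p \<in> carrier P"
  shows "cf (monom P a i \<otimes>\<^bsub>P\<^esub> p) n = (if i \<le> n then a \<otimes> cf p (n - i) else \<zero>)"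
proof -
  have "cf (monom P a i \<otimes>\<^bsub>P\<^esub> p) n = (\<Oplus>j\<in>{..n}. cf (monom P a i) j \<otimes> cf p (n - j))"
    using assms by (simp add: UP.coeff_mult)
  also have "\<dots> = (\<Oplus>j\<in>{..n}. if i = j then a \<otimes> cf p (n - j) else \<zero>)"
    by (rule finsum_cong') (use assms in auto)
  also have "\<dots> = (if i \<le> n then a \<otimes> cf p (n - i) else \<zero>)"
  proof (cases "i \<le> n")
    case True
    then show ?thesis using assms by (subst finsum_singleton) auto
  next
    case False
    have "(\<Oplus>j\<in>{..n}. if i = j then a \<otimes> cf p (n - j) else \<zero>) = (\<Oplus>j\<in>{..n}. \<zero>)"
      by (rule finsum_cong') (use False in auto)
    then show ?thesis using False by simp
  qed
  finally show ?thesis .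
qed

lemma C_add: "a \<in> carrier R \<Longrightarrow> b \<in> carrier R \<Longrightarrow> C (a \<oplus> b) = C a \<oplus>\<^bsub>P\<^esub> C b"
  by (rule UP.monom_add)

lemma C_mult: "a \<in> carrier R \<Longrightarrow> b \<in> carrier R \<Longrightarrow> C (a \<otimes> b) = C a \<otimes>\<^bsub>P\<^esub> C b"
  using UP.monom_mult[of a b 0 0] by simp

lemma C_pow: "a \<in> carrier R \<Longrightarrow> C (a [^] (n::nat)) = C a [^]\<^bsub>P\<^esub> n"
  using UP.monom_pow[of a 0 n] by simp

text \<open>Integral equations carry over to constant polynomials. Together with
  \<open>C_poly_values\<close>, which does the same for nilpotency modulo \<open>I\<close>, this
  supplies \<open>nilpotent_gen\<close> over \<open>A[X]\<close>.\<close>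

lemma C_power_span:
  assumes A: "subring A R" and K: "submod R A K" and x: "x \<in> carrier R" "s \<in> power_span R K x n"
  shows "C s \<in> power_span P (polys R K) (C x) n"
  using x(2)
proof (induct n arbitrary: s)
  case 0 then show ?case by simp
next
  case (Suc n)
  then obtain t c where t: "s = t \<oplus> c \<otimes> x [^] n" "t \<in> power_span R K x n" "c \<in> K" by auto
  have "t \<in> carrier R" "c \<in> carrier R"
    using submodD(1)[OF submod_power_span[OF A K x(1)] t(2)] submodD(1)[OF K t(3)] .
  then have "C s = C t \<oplus>\<^bsub>P\<^esub> C c \<otimes>\<^bsub>P\<^esub> C x [^]\<^bsub>P\<^esub> n"
    unfolding t(1) using x by (simp add: C_add C_mult C_pow)
  moreover have "C c \<in> polys R K" using C_polys[OF t(3)] submodD(1,2)[OF K] t(3) by blast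
  ultimately show ?case unfolding power_span.simps using Suc(1)[OF t(2)] by blast
qed

lemma C_poly_values:
  assumes A: "subring A R" and K: "submod R A K" and x: "x \<in> carrier R" "s \<in> poly_values R K x"
  shows "C s \<in> poly_values P (polys R K) (C x)"
  using x(2)
proof induct
  case (const c)
  then show ?case using C_polys[OF const] submodD(1,2)[OF K] by (blast intro: poly_values.const)
next
  case (step c t)
  have KC: "K \<subseteq> carrier R" using submodD(1)[OF K] by blast
  have tC: "t \<in> carrier R"
    using subringE(1)[OF subring_poly_values[OF carrier_is_subring x(1)]] poly_values_mono[OF KC] step(2) by blast
  have "C (c \<oplus> x \<otimes> t) = C c \<oplus>\<^bsub>P\<^esub> C x \<otimes>\<^bsub>P\<^esub> C t"
    using step(1) KC tC x by (simp add: C_add C_mult subsetD)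
  moreover have "C c \<in> polys R K" using C_polys[OF step(1)] submodD(1,2)[OF K] step(1) by blast
  ultimately show ?case using step(3) by (simp add: poly_values.step)
qed

lemma poly_zero: "p \<in> carrier P \<Longrightarrow> (\<And>n. cf p n = \<zero>) \<Longrightarrow> p = \<zero>\<^bsub>P\<^esub>"
  by (rule UP.up_eqI) auto

end

text \<open>Gauss's argument: let \<open>n\<close> and \<open>m\<close> be the lowest indices with
  coefficients outside \<open>I\<close>. In the coefficient of the product at \<open>n + m\<close>,
  every summand except \<open>cf f n \<otimes> cf g m\<close> has a factor in
  \<open>I\<close>.\<close>

lemma (in prime_pair) prime_pair_polys: "prime_pair (UP R) (polys R A) (polys R I)"
proof -
  interpret polynomials R ..
  show ?thesis
  proof (rule prime_pair.intro[OF UP.UP_cring prime_pair_axioms.intro])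
    show "subring (polys R A) P" by (rule subring_polys[OF A])
    show "submod P (polys R A) (polys R I)" by (rule submod_polys[OF I subA(1)])
    show "polys R I \<subseteq> polys R A" by (rule polys_mono[OF IA])
    show "\<one>\<^bsub>P\<^esub> \<notin> polys R I" using polysD(2)[of "\<one>\<^bsub>P\<^esub>" R I 0] one_notin by auto
    fix f g assume fg: "f \<in> polys R A" "g \<in> polys R A" "f \<otimes>\<^bsub>P\<^esub> g \<in> polys R I"
    show "f \<in> polys R I \<or> g \<in> polys R I"
    proof (rule ccontr)
      assume neg: "\<not> ?thesis"
      define n where "n = (LEAST n. cf f n \<notin> I)"
      define m where "m = (LEAST n. cf g n \<notin> I)"
      have "\<exists>n. cf f n \<notin> I" "\<exists>n. cf g n \<notin> I" using neg polysI polysD(1)[OF fg(1)] polysD(1)[OF fg(2)] by blast+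
      then have nm: "cf f n \<notin> I" "cf g m \<notin> I"
        using LeastI_ex[of "\<lambda>n. cf f n \<notin> I"] LeastI_ex[of "\<lambda>n. cf g n \<notin> I"] unfolding n_def m_def by blast+
      have less: "cf f i \<in> I" if "i < n" for i using not_less_Least that unfolding n_def by blast
      have less': "cf g i \<in> I" if "i < m" for i using not_less_Least that unfolding m_def by blast
      note D = polysD[OF fg(1)] polysD[OF fg(2)]
      have c: "cf f i \<in> carrier R" "cf g i \<in> carrier R" for i using D by auto
      have "cf (f \<otimes>\<^bsub>P\<^esub> g) (n + m) = (\<Oplus>i\<in>insert n ({..n+m} - {n}). cf f i \<otimes> cf g (n + m - i))"
        using D by (simp add: UP.coeff_mult insert_absorb)
      also have "\<dots> = cf f n \<otimes> cf g (n + m - n) \<oplus> (\<Oplus>i\<in>{..n+m} - {n}. cf f i \<otimes> cf g (n + m - i))"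
        by (rule finsum_insert) (use c in auto)
      finally have e: "cf (f \<otimes>\<^bsub>P\<^esub> g) (n + m) = cf f n \<otimes> cf g m \<oplus> (\<Oplus>i\<in>{..n+m} - {n}. cf f i \<otimes> cf g (n + m - i))"
        by simp
      have "(\<Oplus>i\<in>{..n+m} - {n}. cf f i \<otimes> cf g (n + m - i)) \<in> I"
      proof (rule finsum_submod[OF I])
        fix i assume "i \<in> {..n+m} - {n}"
        then consider "i < n" | "n + m - i < m" by force
        then show "cf f i \<otimes> cf g (n + m - i) \<in> I"
        proof cases
          case 1 then show ?thesis using subI(4)[OF D(4) less] m_comm[OF c] by metis
        next
          case 2 then show ?thesis using subI(4)[OF D(2) less'] by blast
        qed
      qed simp
      moreover have "cf f n \<otimes> cf g m \<in> A" "cf f n \<otimes> cf g m \<notin> I" using unit_mult[of "cf f n" "cf g m"] D nm by auto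
      ultimately have "cf (f \<otimes>\<^bsub>P\<^esub> g) (n + m) \<notin> I" unfolding e using unit_add by blast
      then show False using polysD(2)[OF fg(3)] by blast
    qed
  qed
qed

section \<open>Unit content and prime ideals\<close>

context cring
begin

lemma proper_in_prime:
  assumes K: "submod R (carrier R) K" "\<one> \<notin> K"
  obtains M where "primeideal M R" "K \<subseteq> M"
  by (rule primeideal_avoiding[OF K(1), of "{\<one>}"]) (use K(2) in auto)

text \<open>An ideal is proper iff some prime contains it. In this form the polynomials of unit
  content are those lying in no \<open>M[X]\<close>, and Gauss's argument makes them
  multiplicatively closed.\<close>

lemma unit_content_iff:
  "p \<in> unit_content R \<longleftrightarrow> p \<in> carrier (UP R) \<and> (\<forall>M. primeideal M R \<longrightarrow> (\<exists>n. coeff (UP R) p n \<notin> M))"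
proof -
  interpret polynomials R ..
  have "Idl\<^bsub>R\<^esub> (range (cf p)) = carrier R \<longleftrightarrow> (\<forall>M. primeideal M R \<longrightarrow> (\<exists>n. cf p n \<notin> M))"
    if p: "p \<in> carrier P"
  proof
    assume *: "Idl\<^bsub>R\<^esub> (range (cf p)) = carrier R"
    show "\<forall>M. primeideal M R \<longrightarrow> (\<exists>n. cf p n \<notin> M)"
    proof (intro allI impI, rule ccontr)
      fix M assume M: "primeideal M R" "\<nexists>n. cf p n \<notin> M"
      interpret M: primeideal M R by fact
      have "Idl\<^bsub>R\<^esub> (range (cf p)) \<subseteq> M" by (rule genideal_minimal[OF M.is_ideal]) (use M in auto)
      then show False using * M.I_notcarr M.a_subset by blast
    qed
  next
    assume *: "\<forall>M. primeideal M R \<longrightarrow> (\<exists>n. cf p n \<notin> M)"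
    have r: "range (cf p) \<subseteq> carrier R" using p by auto
    interpret J: ideal "Idl\<^bsub>R\<^esub> (range (cf p))" R by (rule genideal_ideal[OF r])
    have "\<one> \<in> Idl\<^bsub>R\<^esub> (range (cf p))"
    proof (rule ccontr)
      assume "\<not> ?thesis"
      then obtain M where M: "primeideal M R" "Idl\<^bsub>R\<^esub> (range (cf p)) \<subseteq> M"
        using proper_in_prime[OF J.ideal_submod] by blast
      then show False using * genideal_self[OF r] by blast
    qed
    then show "Idl\<^bsub>R\<^esub> (range (cf p)) = carrier R" by (rule J.one_imp_carrier)
  qed
  then show ?thesis unfolding unit_content_def by auto
qed

end

section \<open>The Nagata ring of a subring\<close>

context polynomials
begin

text \<open>Polynomials are functions of finite support and the subring shares the zero, so this is
  an equality of sets; coefficients and products are compared with those of \<open>P\<close>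
  below.\<close>

lemma carrier_UP_sub:
  assumes A: "subring A R" shows "carrier (UP (subring_of R A)) = polys R A"
proof -
  have "up (subring_of R A) = {p \<in> up R. \<forall>n. p n \<in> A}"
    unfolding up_def using subringE(1)[OF A] by auto
  then show ?thesis unfolding polys_def by (auto simp: coeff_UP) (auto simp: UP_def)
qed

lemma cring_sub: "subring A R \<Longrightarrow> cring (subring_of R A)"
  using subcring_iff[OF subringE(1)] subcringI' by blast

lemma coeff_UP_sub:
  "subring A R \<Longrightarrow> p \<in> polys R A \<Longrightarrow> coeff (UP (subring_of R A)) p n = cf p n"
  using coeff_UP carrier_UP_sub polysD(1) by metis

lemma finsum_sub:
  assumes A: "subring A R" and "finite F" "\<And>i. i \<in> F \<Longrightarrow> f i \<in> A"
  shows "finsum (subring_of R A) f F = finsum R f F"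
proof -
  interpret S: cring "subring_of R A" by (rule cring_sub[OF A])
  have AC: "a \<in> A \<Longrightarrow> a \<in> carrier R" for a using subringE(1)[OF A] by blast
  show ?thesis using assms(2,3)
  proof (induct F rule: finite_induct)
    case (insert a F)
    have "finsum (subring_of R A) f (insert a F) = f a \<oplus> finsum (subring_of R A) f F"
      using insert by (subst S.finsum_insert) auto
    moreover have "finsum R f (insert a F) = f a \<oplus> finsum R f F"
      using insert AC by (intro finsum_insert) auto
    ultimately show ?case using insert by simp
  qed simp
qed

lemma mult_UP_sub:
  assumes A: "subring A R" and pq: "p \<in> polys R A" "q \<in> polys R A"
  shows "p \<otimes>\<^bsub>UP (subring_of R A)\<^esub> q = p \<otimes>\<^bsub>P\<^esub> q"
proof -
  interpret S: cring "subring_of R A" by (rule cring_sub[OF A])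
  interpret S: UP_cring "subring_of R A" "UP (subring_of R A)" by unfold_locales
  note c = carrier_UP_sub[OF A]
  have pqc: "p \<in> carrier P" "q \<in> carrier P" using pq polysD by auto
  have r: "p \<otimes>\<^bsub>UP (subring_of R A)\<^esub> q \<in> polys R A" using S.UP_mult_closed[of p q] pq c by simp
  show ?thesis
  proof (rule UP.up_eqI)
    fix n
    have "cf (p \<otimes>\<^bsub>UP (subring_of R A)\<^esub> q) n = coeff (UP (subring_of R A)) (p \<otimes>\<^bsub>UP (subring_of R A)\<^esub> q) n"
      using coeff_UP_sub[OF A r] by simp
    also have "\<dots> = finsum (subring_of R A) (\<lambda>i. cf p i \<otimes> cf q (n - i)) {..n}"
      using S.coeff_mult[of p q n] pq c by (simp add: coeff_UP_sub[OF A])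
    also have "\<dots> = finsum R (\<lambda>i. cf p i \<otimes> cf q (n - i)) {..n}"
      by (rule finsum_sub[OF A]) (use polysD(2)[OF pq(1)] polysD(2)[OF pq(2)] subringE(6)[OF A] in auto)
    also have "\<dots> = cf (p \<otimes>\<^bsub>P\<^esub> q) n" using pqc by (simp add: UP.coeff_mult)
    finally show "cf (p \<otimes>\<^bsub>UP (subring_of R A)\<^esub> q) n = cf (p \<otimes>\<^bsub>P\<^esub> q) n" .
  qed (use r polysD pqc in auto)
qed

lemma unit_content_sub_iff:
  assumes A: "subring A R"
  shows "p \<in> unit_content (subring_of R A) \<longleftrightarrow>
    p \<in> polys R A \<and> (\<forall>M. primeideal M (subring_of R A) \<longrightarrow> p \<notin> polys R M)"
proof -
  interpret S: cring "subring_of R A" by (rule cring_sub[OF A])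
  show ?thesis unfolding S.unit_content_iff carrier_UP_sub[OF A]
    using coeff_UP_sub[OF A] polysD(1)[of p R A] by (auto simp: polys_def)
qed

lemma primeideal_contraction:
  assumes A: "subring A R" and Q: "primeideal Q R"
  shows "primeideal (Q \<inter> A) (subring_of R A)"
proof -
  interpret S: cring "subring_of R A" by (rule cring_sub[OF A])
  interpret Q: primeideal Q R by fact
  note q = submodD[OF Q.ideal_submod]
  have AC: "a \<in> A \<Longrightarrow> a \<in> carrier R" for a using subringE(1)[OF A] by blast
  have "submod (subring_of R A) (carrier (subring_of R A)) (Q \<inter> A)"
    by (rule submodI) (use q(2,3,4) subringE(2,6,7)[OF A] AC in auto)
  then show ?thesis
    by (intro primeidealI S.submod_ideal S.is_cring)
      (use subringE(3)[OF A] Q.one_imp_carrier Q.I_notcarr Q.I_prime AC in auto)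
qed

text \<open>A prime of \<open>R\<close> containing all coefficients would contract to a prime of
  \<open>A\<close> containing them.\<close>

lemma unit_content_sub_subset:
  assumes A: "subring A R" shows "unit_content (subring_of R A) \<subseteq> unit_content R"
proof
  fix p assume p: "p \<in> unit_content (subring_of R A)"
  then have pA: "p \<in> polys R A" and pM: "\<And>M. primeideal M (subring_of R A) \<Longrightarrow> p \<notin> polys R M"
    unfolding unit_content_sub_iff[OF A] by auto
  show "p \<in> unit_content R" unfolding unit_content_iff
  proof (intro conjI allI impI)
    show pc: "p \<in> carrier P" using polysD pA by blast
    fix Q assume "primeideal Q R"
    from pM[OF primeideal_contraction[OF A this]] show "\<exists>n. cf p n \<notin> Q"
      using pA pc unfolding polys_def by auto
  qed
qed

lemma unit_content_sub_monoid:
  assumes A: "subring A R"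
  shows "\<one>\<^bsub>P\<^esub> \<in> unit_content (subring_of R A)"
    "p \<in> unit_content (subring_of R A) \<Longrightarrow> q \<in> unit_content (subring_of R A) \<Longrightarrow>
      p \<otimes>\<^bsub>P\<^esub> q \<in> unit_content (subring_of R A)"
proof -
  have s: "subring (polys R A) P" by (rule subring_polys[OF A])
  have pp: "prime_pair P (polys R A) (polys R M)" if "primeideal M (subring_of R A)" for M
    by (rule prime_pair.prime_pair_polys[OF prime_pair_of_primeideal[OF A that]])
  show "\<one>\<^bsub>P\<^esub> \<in> unit_content (subring_of R A)"
    unfolding unit_content_sub_iff[OF A] using subringE(3)[OF s] prime_pair.one_notin[OF pp] by blast
  show "p \<otimes>\<^bsub>P\<^esub> q \<in> unit_content (subring_of R A)"
    if "p \<in> unit_content (subring_of R A)" "q \<in> unit_content (subring_of R A)"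
    using that subringE(6)[OF s] prime_pair.prime[OF pp, of _ p q]
    unfolding unit_content_sub_iff[OF A] by blast
qed

lemma subring_of_carrier: "subring_of R (carrier R) = R"
  by simp

lemma multiplicative_unit_content: "multiplicative_set P (unit_content R)"
proof -
  note * = unit_content_sub_monoid[OF carrier_is_subring, unfolded subring_of_carrier]
  show ?thesis
    by (intro multiplicative_set.intro UP.UP_cring submonoid.intro)
      (use * in \<open>auto simp: unit_content_def\<close>)
qed

lemma Nagata_subring_eq:
  assumes A: "subring A R"
  shows "Nagata_subring R A = fractions P (unit_content R) (polys R A) (unit_content (subring_of R A))"
proof -
  interpret S: polynomials "subring_of R A" by (intro polynomials.intro cring_sub[OF A])
  interpret M: multiplicative_set P "unit_content R" by (rule multiplicative_unit_content)
  interpret MS: multiplicative_set "UP (subring_of R A)" "unit_content (subring_of R A)"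
    by (rule S.multiplicative_unit_content)
  note c = carrier_UP_sub[OF A]
  have e: "fraction_map P (unit_content R) (fraction (UP (subring_of R A)) (unit_content (subring_of R A)) f g)
     = fraction P (unit_content R) f g"
    if "f \<in> polys R A" "g \<in> unit_content (subring_of R A)" for f g
    by (rule fraction_map_fraction[OF MS.multiplicative_set_axioms M.multiplicative_set_axioms])
      (use that c polysD mult_UP_sub[OF A] unit_content_sub_subset[OF A] in auto)
  show ?thesis unfolding Nagata_subring_def Nagata_def
  proof (intro equalityI subsetI)
    fix x assume "x \<in> fraction_map P (unit_content R) ` carrier (localization (UP (subring_of R A)) (unit_content (subring_of R A)))"
    then obtain z where z: "x = fraction_map P (unit_content R) z"
      "z \<in> carrier (localization (UP (subring_of R A)) (unit_content (subring_of R A)))" by (rule imageE)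
    obtain f g where fg: "f \<in> carrier (UP (subring_of R A))" "g \<in> unit_content (subring_of R A)"
      "z = fraction (UP (subring_of R A)) (unit_content (subring_of R A)) f g"
      by (rule MS.fraction_cases[OF z(2)])
    then have "x = fraction P (unit_content R) f g" using e z(1) c by simp
    then show "x \<in> fractions P (unit_content R) (polys R A) (unit_content (subring_of R A))"
      unfolding fractions_def using fg(1,2) c by blast
  next
    fix x assume "x \<in> fractions P (unit_content R) (polys R A) (unit_content (subring_of R A))"
    then obtain f g where fg: "f \<in> polys R A" "g \<in> unit_content (subring_of R A)"
      "x = fraction P (unit_content R) f g" unfolding fractions_def by blast
    show "x \<in> fraction_map P (unit_content R) ` carrier (localization (UP (subring_of R A)) (unit_content (subring_of R A)))"
      unfolding fg(3) e[OF fg(1,2), symmetric]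
      by (intro imageI MS.fraction_closed) (use fg c in auto)
  qed
qed

text \<open>The annihilator of \<open>a\<close> is an ideal containing the coefficients of
  \<open>h\<close>, hence the unit ideal.\<close>

lemma unit_content_annihilator:
  assumes h: "h \<in> unit_content R" and a: "a \<in> carrier R" "\<And>n. cf h n \<otimes> a = \<zero>"
  shows "a = \<zero>"
proof -
  define K where "K = {c \<in> carrier R. c \<otimes> a = \<zero>}"
  have "submod R (carrier R) K" unfolding K_def
    by (rule submodI) (use a(1) in \<open>auto simp: l_distr m_assoc\<close>)
  moreover have "range (cf h) \<subseteq> K" unfolding K_def using a h by (auto simp: unit_content_def)
  ultimately have "Idl\<^bsub>R\<^esub> (range (cf h)) \<subseteq> K" by (intro genideal_minimal submod_ideal)
  then have "\<one> \<in> K" using h by (auto simp: unit_content_def)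
  then show ?thesis unfolding K_def using a by simp
qed

text \<open>McCoy's argument: if \<open>h e = 0\<close>, then the leading coefficient of \<open>e\<close> can be removed by
  multiplying with any coefficient of \<open>h\<close>.\<close>

lemma unit_content_regular:
  assumes h: "h \<in> unit_content R" and e: "e \<in> carrier P" "h \<otimes>\<^bsub>P\<^esub> e = \<zero>\<^bsub>P\<^esub>"
  shows "e = \<zero>\<^bsub>P\<^esub>"
proof -
  have hc: "h \<in> carrier P" using h unfolding unit_content_def by blast
  have "e = \<zero>\<^bsub>P\<^esub>" if "e \<in> carrier P" "h \<otimes>\<^bsub>P\<^esub> e = \<zero>\<^bsub>P\<^esub>" "\<And>n. n \<ge> N \<Longrightarrow> cf e n = \<zero>" for N e
    using that
  proof (induct N arbitrary: e)
    case 0 then show ?case by (intro poly_zero) auto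
  next
    case (Suc N)
    have c: "cf h i \<in> carrier R" "cf e i \<in> carrier R" for i
      using UP.coeff_closed hc Suc(2) by blast+
    \<comment> \<open>If all higher coefficients of \<open>h\<close> kill \<open>e\<close>, the
      coefficient of the product at \<open>i + N\<close> reduces to
      \<open>cf h i \<otimes> cf e N\<close>, because indices below \<open>i\<close> meet
      coefficients of \<open>e\<close> above \<open>N\<close>, which vanish. So multiplying
      \<open>e\<close> by \<open>cf h i\<close> lowers the bound, and \<open>h\<close> still kills
      the result.\<close>
    have ann: "\<forall>k. cf h i \<otimes> cf e k = \<zero>" if "\<And>i' k. i' > i \<Longrightarrow> cf h i' \<otimes> cf e k = \<zero>" for i
    proof -
      have "cf (h \<otimes>\<^bsub>P\<^esub> e) (i + N) = (\<Oplus>j\<in>{..i+N}. cf h j \<otimes> cf e (i + N - j))"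
        using hc Suc(2) by (simp add: UP.coeff_mult)
      also have "\<dots> = (\<Oplus>j\<in>{..i+N}. if i = j then cf h j \<otimes> cf e (i + N - j) else \<zero>)"
      proof (rule finsum_cong')
        fix j assume j: "j \<in> {..i + N}"
        show "cf h j \<otimes> cf e (i + N - j) = (if i = j then cf h j \<otimes> cf e (i + N - j) else \<zero>)"
        proof (cases "j < i")
          case True then show ?thesis using Suc(4)[of "i + N - j"] c by simp
        next
          case False then show ?thesis using that[of j] by simp
        qed
      qed (use c in auto)
      also have "\<dots> = cf h i \<otimes> cf e N"
        using finsum_singleton[of i "{..i+N}" "\<lambda>j. cf h j \<otimes> cf e (i + N - j)"] c by simp
      finally have eN: "cf h i \<otimes> cf e N = \<zero>" using Suc(3) by simp
      have he: "C (cf h i) \<otimes>\<^bsub>P\<^esub> e \<in> carrier P" using c Suc(2) by simp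
      have "C (cf h i) \<otimes>\<^bsub>P\<^esub> e = \<zero>\<^bsub>P\<^esub>"
      proof (rule Suc(1)[OF he])
        have "h \<otimes>\<^bsub>P\<^esub> (C (cf h i) \<otimes>\<^bsub>P\<^esub> e) = C (cf h i) \<otimes>\<^bsub>P\<^esub> (h \<otimes>\<^bsub>P\<^esub> e)"
          using hc Suc(2) c by (intro UP.P.m_lcomm) auto
        then show "h \<otimes>\<^bsub>P\<^esub> (C (cf h i) \<otimes>\<^bsub>P\<^esub> e) = \<zero>\<^bsub>P\<^esub>" using Suc(3) c by simp
        fix n assume n: "n \<ge> N"
        show "cf (C (cf h i) \<otimes>\<^bsub>P\<^esub> e) n = \<zero>"
          using coeff_monom_mult[OF c(1) Suc(2)] eN Suc(4)[of n] c n by (cases "n = N") auto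
      qed
      then have "cf (C (cf h i) \<otimes>\<^bsub>P\<^esub> e) k = \<zero>" for k by simp
      then show ?thesis using coeff_monom_mult[OF c(1) Suc(2), of i 0] by simp
    qed
    obtain D where D: "\<And>i. i > D \<Longrightarrow> cf h i = \<zero>" using UP.deg_aboveD[OF _ hc] by blast
    have all: "\<forall>k. cf h i \<otimes> cf e k = \<zero>" if "i \<ge> D - d" for d i
      using that
    proof (induct d arbitrary: i)
      case 0 show ?case by (rule ann) (use 0 D c in auto)
    next
      case (Suc d) show ?case by (rule ann) (use Suc in auto)
    qed
    have "cf h i \<otimes> cf e k = \<zero>" for i k using all[of D i] by simp
    then have "cf e k = \<zero>" for k using unit_content_annihilator[OF h c(2)] by blast
    then show ?case by (intro poly_zero Suc(2))
  qed
  moreover obtain N where "\<And>n. n > N \<Longrightarrow> cf e n = \<zero>" using UP.deg_aboveD[OF _ e(1)] by blast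
  then have "\<And>n. n \<ge> Suc N \<Longrightarrow> cf e n = \<zero>" by simp
  ultimately show ?thesis using e by blast
qed

text \<open>Denominators of the Nagata ring are not zero divisors, so equalities of fractions can be
  read as equalities of polynomials.\<close>

lemma unit_content_cancel:
  assumes h: "h \<in> unit_content R" and pq: "p \<in> carrier P" "q \<in> carrier P" "h \<otimes>\<^bsub>P\<^esub> p = h \<otimes>\<^bsub>P\<^esub> q"
  shows "p = q"
proof -
  have hc: "h \<in> carrier P" using h unfolding unit_content_def by blast
  have "h \<otimes>\<^bsub>P\<^esub> (p \<ominus>\<^bsub>P\<^esub> q) = h \<otimes>\<^bsub>P\<^esub> p \<ominus>\<^bsub>P\<^esub> h \<otimes>\<^bsub>P\<^esub> q" using hc pq(1,2) by algebra
  also have "\<dots> = \<zero>\<^bsub>P\<^esub>" unfolding pq(3) using hc pq(2) by algebra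
  finally have "p \<ominus>\<^bsub>P\<^esub> q = \<zero>\<^bsub>P\<^esub>" by (rule unit_content_regular[OF h UP.P.minus_closed[OF pq(1,2)]])
  then show ?thesis using pq UP.P.r_right_minus_eq by simp
qed

text \<open>The union \<open>D\<close> of the contents of the elements of \<open>K\<close> is an
  ideal: contents are added by shifting one polynomial past the degree of the other.
  \<open>D\<close> lies in no prime, so it contains \<open>\<one>\<close>, and then so does the
  content of a single element. In effect, the maximal ideals of \<open>A(X)\<close> are extended
  from \<open>A\<close>; this is what glues local statements.\<close>

lemma ideal_contains_unit_content:
  assumes A: "subring A R" and K: "submod P (polys R A) K" "K \<subseteq> polys R A"
    and prime: "\<And>M. primeideal M (subring_of R A) \<Longrightarrow> \<exists>h\<in>K. h \<notin> polys R M"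
  shows "\<exists>h\<in>K. h \<in> unit_content (subring_of R A)"
proof -
  interpret S: cring "subring_of R A" by (rule cring_sub[OF A])
  note k = submodD[OF K(1)]
  have AC: "a \<in> A \<Longrightarrow> a \<in> carrier R" for a using subringE(1)[OF A] by blast
  \<comment> \<open>The ideal of \<open>A\<close> generated by the coefficients of \<open>h\<close>,
    as the intersection of all ideals of \<open>A\<close> that contain them.\<close>
  define con where "con h = {a \<in> A. \<forall>J. submod R A J \<longrightarrow> J \<subseteq> A \<longrightarrow> (\<forall>n. cf h n \<in> J) \<longrightarrow> a \<in> J}" for h
  define D where "D = (\<Union>h\<in>K. con h)"
  have D: "submod R A D"
  proof (rule submodI, goal_cases)
    case 1 show ?case unfolding D_def con_def using AC by blast
  next
    case 2
    have "\<zero> \<in> con \<zero>\<^bsub>P\<^esub>" unfolding con_def using subringE(2)[OF A] submodD(2) by simp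
    then show ?case unfolding D_def using k(2) by blast
  next
    case (3 a b)
    then obtain h h' where h: "h \<in> K" "a \<in> con h" "h' \<in> K" "b \<in> con h'" unfolding D_def by blast
    have hc: "h \<in> carrier P" "h' \<in> carrier P" using h k(1) by auto
    obtain N where N: "\<And>n. n > N \<Longrightarrow> cf h n = \<zero>" using UP.deg_aboveD[OF _ hc(1)] by blast
    \<comment> \<open>\<open>Suc N\<close> exceeds every index of a nonzero coefficient of
      \<open>h\<close>, so the coefficients of \<open>h\<close> and \<open>h'\<close> occupy
      disjoint positions.\<close>
    define g where "g = h \<oplus>\<^bsub>P\<^esub> X (Suc N) \<otimes>\<^bsub>P\<^esub> h'"
    have X: "X (Suc N) \<in> polys R A" by (rule C_polys) (use subringE(2,3)[OF A] in auto)
    have gK: "g \<in> K" unfolding g_def using k(3,4) h X by blast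
    have g1: "cf g n = cf h n" if "n \<le> N" for n
      unfolding g_def using hc that by (simp add: coeff_monom_mult del: UP.coeff_mult)
    have g2: "cf g (n + Suc N) = cf h' n" for n
      unfolding g_def using hc N by (simp add: coeff_monom_mult del: UP.coeff_mult)
    have "a \<oplus> b \<in> con g"
    proof -
      have "a \<oplus> b \<in> J" if J: "submod R A J" "J \<subseteq> A" "\<forall>n. cf g n \<in> J" for J
      proof -
        have "cf h n \<in> J" for n
          using g1[of n] N[of n] J(3) submodD(2)[OF J(1)] by (cases "n \<le> N") (metis, simp)
        moreover have "cf h' n \<in> J" for n using g2[of n] J(3) by metis
        ultimately have "a \<in> J" "b \<in> J" using h J unfolding con_def by blast+
        then show ?thesis by (rule submodD(3)[OF J(1)])
      qed
      moreover have "a \<in> A" "b \<in> A" using h unfolding con_def by auto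
      ultimately show ?thesis unfolding con_def using subringE(7)[OF A] by blast
    qed
    then show ?case unfolding D_def using gK by blast
  next
    case (4 a b)
    then obtain h where h: "h \<in> K" "b \<in> con h" unfolding D_def by blast
    have "b \<in> A" and bJ: "\<And>J. submod R A J \<Longrightarrow> J \<subseteq> A \<Longrightarrow> \<forall>n. cf h n \<in> J \<Longrightarrow> b \<in> J"
      using h(2) unfolding con_def by auto
    then have "a \<otimes> b \<in> con h"
      unfolding con_def using subringE(6)[OF A 4(1)] submodD(4)[OF _ 4(1) bJ] by blast
    then show ?case unfolding D_def using h by blast
  qed
  have DA: "D \<subseteq> A" unfolding D_def con_def by blast
  have "\<one> \<in> D"
  proof (rule ccontr)
    assume "\<one> \<notin> D"
    moreover have "submod (subring_of R A) (carrier (subring_of R A)) D"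
      by (rule submodI) (use DA submodD[OF D] in auto)
    ultimately obtain M where M: "primeideal M (subring_of R A)" "D \<subseteq> M"
      using S.proper_in_prime[of D] by auto
    from prime[OF M(1)] obtain h where h: "h \<in> K" "h \<notin> polys R M" by blast
    have hA: "h \<in> polys R A" using h K by blast
    then obtain n where n: "cf h n \<notin> M" using h(2) unfolding polys_def by blast
    have "cf h n \<in> con h" unfolding con_def using polysD(2)[OF hA] by blast
    then show False using n M(2) h(1) unfolding D_def by blast
  qed
  then obtain h where h: "h \<in> K" "\<one> \<in> con h" unfolding D_def by blast
  have "h \<notin> polys R M" if M: "primeideal M (subring_of R A)" for M
  proof
    interpret M: prime_pair R A M by (rule prime_pair_of_primeideal[OF A M])
    assume "h \<in> polys R M"
    then have "\<one> \<in> M" using h(2) M.I M.IA unfolding con_def polys_def by blast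
    then show False using M.one_notin by blast
  qed
  then show ?thesis using h(1) K(2) unfolding unit_content_sub_iff[OF A] by blast
qed

end

section \<open>Comparing elements at a prime\<close>

locale subintegral_prime = integral_prime R A I Q + polynomials R for R (structure) and A I Q +
  assumes residue: "s \<in> carrier R \<Longrightarrow> \<exists>u\<in>A - Q. \<exists>r\<in>A. u \<otimes> s \<ominus> r \<in> Q"
begin

abbreviation "pv \<equiv> poly_values R A"
abbreviation "sat y \<equiv> saturation R A I (pv y)"

lemma sat_subring: "y \<in> carrier R \<Longrightarrow> subring (sat y) R"
  using subring_saturation[OF subring_poly_values[OF A] poly_values_incl] .

lemma pv_carrier: "y \<in> carrier R \<Longrightarrow> pv y \<subseteq> carrier R"
  using subringE(1)[OF subring_poly_values[OF A]] .

lemma pv_sat: "y \<in> carrier R \<Longrightarrow> pv y \<subseteq> sat y"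
  using saturation_incl[OF pv_carrier] .

lemma sat_trans:
  assumes y: "y \<in> carrier R" and x: "x \<in> sat y" shows "sat x \<subseteq> sat y"
proof (rule saturation_least[OF pv_carrier[OF y]])
  have "A \<subseteq> sat y" using pv_sat[OF y] poly_values_incl by blast
  then show "pv x \<subseteq> sat y" by (rule poly_values_least[OF sat_subring[OF y] _ x])
qed

text \<open>As the residue fields agree, a base element \<open>r\<close> can be subtracted from a
  multiple \<open>u \<otimes> s\<close> so that the rest lies in \<open>Q\<close>. Up to factors
  from \<open>A - I\<close>, the elements \<open>s\<close> and \<open>x\<close> generate the same
  ring.\<close>

lemma translate_into_Q:
  assumes s: "s \<in> carrier R"
  obtains x u r where "x \<in> Q" "u \<in> A" "u \<notin> I" "r \<in> A" "u \<otimes> s = x \<oplus> r" "s \<in> sat x" "x \<in> pv s"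
proof -
  obtain u r where ur: "u \<in> A" "u \<notin> Q" "r \<in> A" "u \<otimes> s \<ominus> r \<in> Q" using residue[OF s] by blast
  define x where "x = u \<otimes> s \<ominus> r"
  have D: "u \<in> carrier R" "r \<in> carrier R" "s \<in> carrier R" "x \<in> carrier R"
    using ur s AC x_def by auto
  have e: "u \<otimes> s = x \<oplus> r" unfolding x_def using D(1-3) by algebra
  have "x = \<ominus> r \<oplus> s \<otimes> u" unfolding x_def using D(1-3) by algebra
  then have "x \<in> pv s" using ur subA(5) by (auto intro: poly_values.intros)
  moreover have "u \<otimes> s = r \<oplus> x \<otimes> \<one>" unfolding e using D by (simp add: a_comm)
  then have "u \<otimes> s \<in> pv x" using ur one_in by (auto intro: poly_values.intros)
  then have "s \<in> sat x" using ur IQ s by (intro saturationI[of _ _ u]) auto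
  moreover have "x \<in> Q" "u \<notin> I" using ur IQ x_def by auto
  ultimately show ?thesis using that ur e by blast
qed

text \<open>The linear coefficient of the relation \<open>g x = f(x + X\<^sup>i y)\<close> gives \<open>y v \<in> A[x]\<close> or \<open>x v \<in> A[y]\<close>
  with \<open>v \<notin> Q\<close>, according to whether the linear coefficient of \<open>f\<close> is nonzero modulo \<open>I\<close>.\<close>

lemma comparable_of_relation:
  assumes x: "x \<in> Q" and y: "y \<in> Q"
    and g: "g \<in> polys R A" "g \<notin> polys R I"
    and f: "C x \<otimes>\<^bsub>P\<^esub> g \<in> poly_values P (polys R A) (C x \<oplus>\<^bsub>P\<^esub> monom P y i)"
  shows "x \<in> sat y \<or> y \<in> sat x"
proof -
  have xy: "x \<in> carrier R" "y \<in> carrier R" using x y subQ(1) by auto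
  define z where "z = C x \<oplus>\<^bsub>P\<^esub> monom P y i"
  have zC: "z \<in> carrier P" unfolding z_def using xy by simp
  have PA: "subring (polys R A) P" by (rule subring_polys[OF A])
  note c1 = UP.P.poly_values_cases[OF PA subring_submod[OF PA] zC]
  from c1[OF f[folded z_def]] obtain p0 w where
    w: "p0 \<in> polys R A" "w \<in> poly_values P (polys R A) z" "C x \<otimes>\<^bsub>P\<^esub> g = p0 \<oplus>\<^bsub>P\<^esub> z \<otimes>\<^bsub>P\<^esub> w" by blast
  from c1[OF w(2)] obtain p1 q where
    q: "p1 \<in> polys R A" "q \<in> poly_values P (polys R A) z" "w = p1 \<oplus>\<^bsub>P\<^esub> z \<otimes>\<^bsub>P\<^esub> q" by blast
  define T where "T = poly_values R (pv x) y"
  have px: "subring (pv x) R" and py: "subring (pv y) R" using subring_poly_values[OF A] xy by auto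
  have T: "subring T R" unfolding T_def by (rule subring_poly_values[OF px xy(2)])
  note subT = subringE[OF T]
  have xT: "x \<in> T" unfolding T_def using poly_values_incl poly_values_var[OF A xy(1)] by blast
  have yT: "y \<in> T" unfolding T_def by (rule poly_values_var[OF px xy(2)])
  have AT: "A \<subseteq> T" unfolding T_def using poly_values_incl by blast
  have PT: "subring (polys R T) P" by (rule subring_polys[OF T])
  have zT: "z \<in> polys R T" unfolding z_def
    by (intro subringE(7)[OF PT] C_polys) (use xT yT xy subT(2) in auto)
  have zQ: "z \<in> polys R Q" unfolding z_def
    by (intro submodD(3)[OF submod_polys[OF Q_submod subset_refl]] C_polys) (use x y xy subQ(2) in auto)
  have qT: "q \<in> polys R T"
    using UP.P.poly_values_least[OF PT polys_mono[OF AT] zT] q(2) by blast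
  have qC: "q \<in> carrier P" using polysD(1)[OF qT] .
  define k where "k = z \<otimes>\<^bsub>P\<^esub> q"
  have kT: "k \<in> polys R T" unfolding k_def by (rule subringE(6)[OF PT zT qT])
  have "q \<otimes>\<^bsub>P\<^esub> z \<in> polys R Q"
    by (rule submodD(4)[OF submod_polys[OF Q_submod subset_refl] _ zQ]) (use qC in \<open>auto intro: polysI\<close>)
  then have kQ: "k \<in> polys R Q" unfolding k_def using UP.P.m_comm[OF zC qC] by simp
  have kC: "k \<in> carrier P" using polysD(1)[OF kT] .
  have gC: "g \<in> carrier P" "p0 \<in> carrier P" "p1 \<in> carrier P" using polysD(1) g w q by auto
  have wC: "w \<in> carrier P" unfolding q(3) using gC zC qC by simp
  have cw: "cf w n = cf p1 n \<oplus> cf k n" for n unfolding q(3) k_def[symmetric] using gC kC by simp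
  have D: "cf p0 n \<in> carrier R" "cf p1 n \<in> carrier R" "cf k n \<in> carrier R" "cf g n \<in> carrier R" for n
    using gC kC by auto
  have E: "cf p0 n \<in> A" "cf p1 n \<in> A" "cf k n \<in> T" "cf g n \<in> A" "cf k n \<in> Q" for n
    using polysD(2) g w q kT kQ by blast+
  have coef: "x \<otimes> cf g n = cf p0 n \<oplus> (x \<otimes> (cf p1 n \<oplus> cf k n) \<oplus> (if i \<le> n then y \<otimes> cf w (n - i) else \<zero>))" for n
  proof -
    have "x \<otimes> cf g n = cf (C x \<otimes>\<^bsub>P\<^esub> g) n" using xy gC by (simp add: coeff_monom_mult del: UP.coeff_mult)
    also have "\<dots> = cf p0 n \<oplus> cf (z \<otimes>\<^bsub>P\<^esub> w) n" unfolding w(3) using gC zC wC by (simp del: UP.coeff_mult)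
    also have "z \<otimes>\<^bsub>P\<^esub> w = C x \<otimes>\<^bsub>P\<^esub> w \<oplus>\<^bsub>P\<^esub> monom P y i \<otimes>\<^bsub>P\<^esub> w"
      unfolding z_def by (rule UP.P.l_distr) (use xy wC in auto)
    also have "cf \<dots> n = x \<otimes> cf w n \<oplus> (if i \<le> n then y \<otimes> cf w (n - i) else \<zero>)"
      using xy wC by (simp add: coeff_monom_mult del: UP.coeff_mult)
    finally show ?thesis unfolding cw[of n] .
  qed
  have TC: "t \<in> carrier R" if "t \<in> T" for t using subT(1) that by blast
  have Ql: "y \<otimes> t \<in> Q" "x \<otimes> t \<in> Q" if "t \<in> T" for t
    using subQ(4)[OF TC[OF that] y] subQ(4)[OF TC[OF that] x] m_comm[OF TC[OF that]] xy by auto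
  show ?thesis
  proof (cases "p1 \<in> polys R I")
    case False
    then obtain e where e: "cf p1 e \<notin> I" using gC unfolding polys_def by blast
    from poly_values_cases[OF px subring_submod[OF px] xy(2) E(3)[of "e + i", unfolded T_def]]
    obtain a t where at: "a \<in> pv x" "t \<in> T" "cf k (e + i) = a \<oplus> y \<otimes> t" unfolding T_def by blast
    have atC: "a \<in> carrier R" "t \<in> carrier R" using pv_carrier[OF xy(1)] at TC by auto
    \<comment> \<open>At index \<open>e + i\<close> the summand \<open>monom P y i\<close>
      contributes \<open>y \<otimes> cf p1 e\<close>. The part \<open>y \<otimes> t\<close> of
      \<open>cf k (e + i)\<close> is moved into \<open>v\<close>, where it appears as
      \<open>x \<otimes> t\<close> and stays in \<open>Q\<close>; what remains on the other side
      lies in \<open>A[x]\<close>.\<close>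
    define v where "v = cf p1 e \<oplus> (cf k e \<oplus> x \<otimes> t)"
    have vT: "v \<in> T" unfolding v_def by (intro subT(6,7) subsetD[OF AT] E xT at)
    have "cf k e \<oplus> x \<otimes> t \<in> Q" using subQ(3) E(5) Ql(2)[OF at(2)] by blast
    then have vQ: "v \<notin> Q" unfolding v_def using Q_add_iff[OF D(2)] e IQ[OF E(2)] by blast
    have "y \<otimes> v = (cf p0 (e+i) \<oplus> (x \<otimes> (cf p1 (e+i) \<oplus> (a \<oplus> y \<otimes> t)) \<oplus> y \<otimes> (cf p1 e \<oplus> cf k e)))
        \<ominus> cf p0 (e+i) \<ominus> x \<otimes> (cf p1 (e+i) \<oplus> a)"
      unfolding v_def using D(1)[of "e+i"] D(2)[of "e+i"] D(2)[of e] D(3)[of e] atC xy by algebra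
    also have "\<dots> = x \<otimes> cf g (e + i) \<ominus> cf p0 (e+i) \<ominus> x \<otimes> (cf p1 (e+i) \<oplus> a)"
      using coef[of "e + i"] unfolding at(3) cw by simp
    also have "\<dots> \<in> pv x"
      unfolding a_minus_def
      by (intro subringE(5,6,7)[OF px] at(1) poly_values_var[OF A xy(1)] subsetD[OF poly_values_incl E(1)]
        subsetD[OF poly_values_incl E(2)] subsetD[OF poly_values_incl E(4)])
    finally have "y \<otimes> v \<in> pv x" .
    then show ?thesis using local_generator[OF x y vT[unfolded T_def] vQ] by blast
  next
    case True
    then have p1I: "cf p1 n \<in> I" for n using polysD(2) by blast
    obtain d where d: "cf g d \<notin> I" using g(2) gC unfolding polys_def by blast
    \<comment> \<open>For \<open>d < i\<close> the summand \<open>monom P y i\<close> does not reach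
      the coefficient at \<open>d\<close>, hence the value \<open>\<zero>\<close>.\<close>
    define b where "b = (if i \<le> d then cf p1 (d - i) else \<zero>)"
    define c where "c = (if i \<le> d then cf k (d - i) else \<zero>)"
    have bA: "b \<in> A" and cT: "c \<in> T" unfolding b_def c_def using E subA(2) subT(2) by auto
    \<comment> \<open>Again \<open>A[x, y]\<close>, but generated in the other order: now a
      coefficient has to be split into an element of \<open>A[y]\<close> and a multiple of
      \<open>x\<close>.\<close>
    define T' where "T' = poly_values R (pv y) x"
    have T': "subring T' R" unfolding T'_def by (rule subring_poly_values[OF py xy(1)])
    note subT' = subringE[OF T']
    have xT': "x \<in> T'" unfolding T'_def by (rule poly_values_var[OF py xy(1)])
    have yT': "y \<in> T'" unfolding T'_def using poly_values_incl poly_values_var[OF A xy(2)] by blast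
    have AT': "A \<subseteq> T'" unfolding T'_def using poly_values_incl by blast
    have TT': "T \<subseteq> T'" unfolding T_def
      by (rule poly_values_least[OF T' poly_values_least[OF T' AT' xT'] yT'])
    have T'T: "T' \<subseteq> T" unfolding T'_def
      by (rule poly_values_least[OF T poly_values_least[OF T AT yT] xT])
    have "c \<in> poly_values R (pv y) x" using cT TT' unfolding T'_def by blast
    from poly_values_cases[OF py subring_submod[OF py] xy(1) this]
    obtain a t where at: "a \<in> pv y" "t \<in> T'" "c = a \<oplus> x \<otimes> t" unfolding T'_def by blast
    have tT: "t \<in> T" using at T'T by blast
    have atC: "a \<in> carrier R" "t \<in> carrier R" "b \<in> carrier R" using pv_carrier[OF xy(2)] at tT TC bA AC by auto
    \<comment> \<open>Here \<open>cf p1 d\<close> is in \<open>I\<close> and the last summand is in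
      \<open>Q\<close>, so \<open>v\<close> stays outside \<open>Q\<close> because
      \<open>cf g d\<close> does.\<close>
    define v where "v = (cf g d \<ominus> cf p1 d) \<oplus> (\<ominus> \<one>) \<otimes> (cf k d \<oplus> y \<otimes> t)"
    have mone: "\<ominus> \<one> \<in> A" using subA(3,5) by blast
    have vT: "v \<in> T'" unfolding v_def a_minus_def
      by (intro subT'(5,6,7) subsetD[OF AT'] E mone subsetD[OF TT' E(3)] yT' at)
    have "(\<ominus> \<one>) \<otimes> (cf k d \<oplus> y \<otimes> t) \<in> Q"
      by (intro subQ(3,4) E Ql tT) auto
    moreover have "cf g d \<ominus> cf p1 d \<in> A" "cf g d \<ominus> cf p1 d \<notin> I" using unit_diff[OF E(4) d p1I] by auto
    ultimately have vQ: "v \<notin> Q" unfolding v_def using Q_add_iff AC IQ by blast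
    have coef': "x \<otimes> cf g d = cf p0 d \<oplus> (x \<otimes> (cf p1 d \<oplus> cf k d) \<oplus> y \<otimes> (b \<oplus> (a \<oplus> x \<otimes> t)))"
      unfolding at(3)[symmetric] coef[of d] cw b_def c_def using xy by simp
    have "x \<otimes> v = x \<otimes> cf g d \<ominus> x \<otimes> cf p1 d \<ominus> x \<otimes> (cf k d \<oplus> y \<otimes> t)"
      unfolding v_def using D(2)[of d] D(3)[of d] D(4)[of d] atC xy by algebra
    also have "\<dots> = cf p0 d \<oplus> y \<otimes> (b \<oplus> a)"
      unfolding coef' using D(1)[of d] D(2)[of d] D(3)[of d] atC xy by algebra
    also have "\<dots> \<in> pv y"
      by (intro subringE(6,7)[OF py] subsetD[OF poly_values_incl E(1)] subsetD[OF poly_values_incl bA] at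
        poly_values_var[OF A xy(2)])
    finally have "x \<otimes> v \<in> pv y" .
    then show ?thesis using local_generator[OF y x vT[unfolded T'_def] vQ] by blast
  qed
qed

lemma comparable_of_comparable_in_Q:
  assumes Q: "\<And>x y. x \<in> Q \<Longrightarrow> y \<in> Q \<Longrightarrow> x \<in> sat y \<or> y \<in> sat x"
    and xy: "x \<in> carrier R" "y \<in> carrier R"
  shows "x \<in> sat y \<or> y \<in> sat x"
proof -
  obtain x1 where x1: "x1 \<in> Q" "x \<in> sat x1" "x1 \<in> pv x" using translate_into_Q[OF xy(1)] by metis
  obtain y1 where y1: "y1 \<in> Q" "y \<in> sat y1" "y1 \<in> pv y" using translate_into_Q[OF xy(2)] by metis
  have c: "x1 \<in> carrier R" "y1 \<in> carrier R" using x1 y1 subQ(1) by auto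
  have "x1 \<in> sat x" "y1 \<in> sat y" using x1 y1 pv_sat xy by blast+
  then show ?thesis using Q[OF x1(1) y1(1)] sat_trans xy c x1 y1 by blast
qed

lemma C_saturation:
  assumes x: "x \<in> carrier R" and a: "a \<in> sat x"
  shows "C a \<in> saturation P (polys R A) (polys R I) (poly_values P (polys R A) (C x))"
proof -
  obtain u where u: "a \<in> carrier R" "u \<in> A" "u \<notin> I" "u \<otimes> a \<in> pv x" using a by (rule saturationE)
  show ?thesis
  proof (rule saturationI)
    show "C u \<in> polys R A" using C_polys[OF u(2)] subA(2) AC u by blast
    show "C u \<notin> polys R I" using polysD(2)[of "C u" R I 0] u AC by auto
    have "C u \<otimes>\<^bsub>P\<^esub> C a = C (u \<otimes> a)" using C_mult u AC by simp
    then show "C u \<otimes>\<^bsub>P\<^esub> C a \<in> poly_values P (polys R A) (C x)"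
      using C_poly_values[OF A subring_submod[OF A] x u(4)] by simp
  qed (use u in simp)
qed

end

section \<open>Recovering the coefficients of a polynomial\<close>

lemma (in polynomials) poly_in_subring:
  assumes K: "subring K P" and X: "\<And>i. X i \<in> K" and F: "F \<in> carrier P" "\<And>i. C (cf F i) \<in> K"
  shows "F \<in> K"
proof -
  have m: "monom P (cf F i) i \<in> K" for i
  proof -
    have "C (cf F i) \<otimes>\<^bsub>P\<^esub> X i = monom P (cf F i) i"
      using UP.monom_mult[of "cf F i" \<one> 0 i] F by simp
    then show ?thesis using subringE(6)[OF K F(2) X] by metis
  qed
  have "(\<Oplus>\<^bsub>P\<^esub>i\<in>{..deg R F}. monom P (cf F i) i) \<in> K"
    by (rule UP.P.finsum_submod[OF subring_submod[OF K]]) (use m in auto)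
  then show ?thesis using UP.up_repr[OF F(1)] by simp
qed

locale comparable_prime = subintegral_prime +
  assumes comparable: "x \<in> carrier R \<Longrightarrow> y \<in> carrier R \<Longrightarrow> x \<in> sat y \<or> y \<in> sat x"
begin

text \<open>By \<open>comparable\<close> and \<open>sat_trans\<close>, local membership
  \<open>x \<in> sat y\<close> is a total preorder.\<close>

lemma maximal_element:
  assumes "finite F" "F \<noteq> {}" "F \<subseteq> carrier R"
  shows "\<exists>s\<in>F. F \<subseteq> sat s"
  using assms
proof (induct F rule: finite_ne_induct)
  case (singleton a)
  then show ?case using pv_sat poly_values_var[OF A] by blast
next
  case (insert a F)
  then obtain s where s: "s \<in> F" "F \<subseteq> sat s" by auto
  have c: "a \<in> carrier R" "s \<in> carrier R" using insert s by auto
  have "a \<in> sat a" using pv_sat[OF c(1)] poly_values_var[OF A c(1)] by blast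
  then show ?case using comparable[OF c] sat_trans[OF c(1), of s] s by blast
qed

lemma nilpotent_gen_polys:
  assumes x: "x \<in> Q"
  obtains n k u where "nilpotent_gen P (polys R A) (polys R I) (C x) n k u"
proof -
  have xC: "x \<in> carrier R" using x subQ(1) by blast
  obtain n where n: "x [^] (n::nat) \<in> power_span R A x n" using int xC by blast
  obtain u k where u: "u \<in> A" "u \<notin> I" "u \<otimes> x [^] (k::nat) \<in> poly_values R I x"
    using nilpotent_mod[OF x] by blast
  have "nilpotent_gen P (polys R A) (polys R I) (C x) n k (C u)"
  proof (rule nilpotent_gen.intro[OF prime_pair_polys nilpotent_gen_axioms.intro])
    show "C x \<in> carrier P" using xC by simp
    show "C x [^]\<^bsub>P\<^esub> n \<in> power_span P (polys R A) (C x) n"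
      using C_power_span[OF A subring_submod[OF A] xC n] C_pow[OF xC] by simp
    show "C u \<in> polys R A" using C_polys[OF u(1)] subA(2) AC u by blast
    show "C u \<notin> polys R I" using polysD(2)[of "C u" R I 0] u AC by auto
    have "C (u \<otimes> x [^] k) = C u \<otimes>\<^bsub>P\<^esub> C x [^]\<^bsub>P\<^esub> k" using u AC xC by (simp add: C_mult C_pow)
    then show "C u \<otimes>\<^bsub>P\<^esub> C x [^]\<^bsub>P\<^esub> k \<in> poly_values P (polys R I) (C x)"
      using C_poly_values[OF A I xC u(3)] by simp
  qed
  then show ?thesis by (rule that)
qed

interpretation pol: prime_pair P "polys R A" "polys R I" by (rule prime_pair_polys)

lemma X_polys: "X i \<in> polys R A"
  by (rule C_polys) (use subA(2,3) in auto)

text \<open>All coefficients of \<open>g\<close> lie locally in \<open>A[x]\<close> for one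
  \<open>x \<in> Q\<close>, so a multiple \<open>h\<close> times \<open>g\<close> equals
  \<open>p\<close> plus \<open>C x\<close> times \<open>q\<close> with
  \<open>p \<in> polys R A\<close>. The second summand is in \<open>Q[X]\<close> while the whole is
  not, so \<open>p\<close> is outside \<open>I[X]\<close> and \<open>unit_multiple\<close> applies
  over \<open>A[X]\<close>. This is what makes it possible to replace denominators.\<close>

lemma multiple_in_base_polys:
  assumes g: "g \<in> carrier P" "g \<notin> polys R Q"
  shows "\<exists>w\<in>carrier P. w \<otimes>\<^bsub>P\<^esub> g \<in> polys R A \<and> w \<otimes>\<^bsub>P\<^esub> g \<notin> polys R I"
proof -
  have "\<exists>s\<in>cf g ` {..deg R g}. cf g ` {..deg R g} \<subseteq> sat s"
    by (rule maximal_element) (use g in auto)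
  then obtain s where "s \<in> cf g ` {..deg R g}" and s': "cf g ` {..deg R g} \<subseteq> sat s" by blast
  then have s: "s \<in> carrier R" "cf g ` {..deg R g} \<subseteq> sat s" using g by auto
  obtain x where x: "x \<in> Q" "s \<in> sat x" using translate_into_Q[OF s(1)] by metis
  have xC: "x \<in> carrier R" using x subQ(1) by blast
  have gx: "cf g i \<in> sat x" for i
  proof (cases "i \<le> deg R g")
    case True then show ?thesis using s(2) sat_trans[OF xC x(2)] by blast
  next
    case False
    then show ?thesis using UP.deg_aboveD[of g i] g subringE(2)[OF sat_subring[OF xC]] by simp
  qed
  define V where "V = poly_values P (polys R A) (C x)"
  have V: "subring V P" "polys R A \<subseteq> V" unfolding V_def
    using UP.P.subring_poly_values[OF pol.A] UP.P.poly_values_incl xC by auto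
  have VS: "V \<subseteq> saturation P (polys R A) (polys R I) V"
    by (rule pol.saturation_incl[OF subringE(1)[OF V(1)]])
  have "g \<in> saturation P (polys R A) (polys R I) V"
  proof (rule poly_in_subring[OF pol.subring_saturation[OF V] _ g(1)])
    show "X i \<in> saturation P (polys R A) (polys R I) V" for i using X_polys V(2) VS by blast
    show "C (cf g i) \<in> saturation P (polys R A) (polys R I) V" for i
      unfolding V_def by (rule C_saturation[OF xC gx])
  qed
  then obtain h where h: "h \<in> polys R A" "h \<notin> polys R I" "h \<otimes>\<^bsub>P\<^esub> g \<in> V" by (rule saturationE)
  have CxC: "C x \<in> carrier P" using xC by simp
  from UP.P.poly_values_cases[OF pol.A subring_submod[OF pol.A] CxC h(3)[unfolded V_def]]
  obtain p q where pq: "p \<in> polys R A" "q \<in> V" "h \<otimes>\<^bsub>P\<^esub> g = p \<oplus>\<^bsub>P\<^esub> C x \<otimes>\<^bsub>P\<^esub> q"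
    unfolding V_def by blast
  have hC: "h \<in> carrier P" "q \<in> carrier P" using polysD(1) h pq subringE(1)[OF V(1)] by auto
  have pcar: "f \<in> polys R (carrier R) \<longleftrightarrow> f \<in> carrier P" for f unfolding polys_def by auto
  have Qpair: "prime_pair R (carrier R) Q"
    by (rule prime_pair_of_primeideal[OF carrier_is_subring]) (use Q in simp)
  interpret Qp: prime_pair P "polys R (carrier R)" "polys R Q"
    by (rule prime_pair.prime_pair_polys[OF Qpair])
  have "h \<notin> polys R Q" using h QA unfolding polys_def by blast
  then have nQ: "h \<otimes>\<^bsub>P\<^esub> g \<notin> polys R Q" using Qp.unit_mult[of h g] g hC pcar by blast
  have "C x \<in> polys R Q" using C_polys[OF x(1)] subQ(2) xC by blast
  then have "q \<otimes>\<^bsub>P\<^esub> C x \<in> polys R Q" using Qp.subI(4) pcar hC by blast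
  then have "C x \<otimes>\<^bsub>P\<^esub> q \<in> polys R Q" using UP.P.m_comm[OF CxC hC(2)] by simp
  then have "p \<notin> polys R Q" using nQ pq(3) Qp.subI(3) by auto
  then have pI: "p \<notin> polys R I" using polys_mono[of I Q] QA by blast
  obtain n k u where "nilpotent_gen P (polys R A) (polys R I) (C x) n k u"
    using nilpotent_gen_polys[OF x(1)] by blast
  from nilpotent_gen.unit_multiple[OF this pq(1) pI _ pq(3)] pq(2)
  obtain w where w: "w \<in> V" "w \<otimes>\<^bsub>P\<^esub> (h \<otimes>\<^bsub>P\<^esub> g) \<in> polys R A" "w \<otimes>\<^bsub>P\<^esub> (h \<otimes>\<^bsub>P\<^esub> g) \<notin> polys R I"
    unfolding V_def by blast
  have wC: "w \<in> carrier P" using w subringE(1)[OF V(1)] by blast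
  show ?thesis
    using w UP.P.m_assoc[OF wC hC(1) g(1)] UP.P.m_closed[OF wC hC(1)] by metis
qed

text \<open>To apply \<open>generator\<close> over \<open>A[X]\<close>, a multiple of
  \<open>F\<close> must equal, up to a base polynomial, \<open>C x\<close> times something whose
  constant part in \<open>x\<close> is outside \<open>I[X]\<close>. The largest coefficient, at
  index \<open>i\<close>, supplies that part. The other monomials have no term at \<open>i\<close>,
  so they cannot cancel it.\<close>

lemma coefficient_in_poly_values:
  assumes F: "F \<in> carrier P"
  shows "C (cf F j) \<in> saturation P (polys R A) (polys R I) (poly_values P (polys R A) F)"
proof -
  \<comment> \<open>\<open>j\<close> may exceed the degree; including it makes \<open>cf F j\<close>
    one of the coefficients compared.\<close>
  define N where "N = max j (deg R F)"
  have cC: "cf F i \<in> carrier R" for i using F by simp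
  have "\<exists>s\<in>cf F ` {..N}. cf F ` {..N} \<subseteq> sat s"
    by (rule maximal_element) (use cC in auto)
  then obtain i where i: "i \<le> N" "cf F ` {..N} \<subseteq> sat (cf F i)" by auto
  obtain x u r where x: "x \<in> Q" "u \<in> A" "u \<notin> I" "r \<in> A" "u \<otimes> cf F i = x \<oplus> r" "cf F i \<in> sat x"
    by (rule translate_into_Q[OF cC])
  have xC: "x \<in> carrier R" using x subQ(1) by blast
  have Fx: "cf F l \<in> sat x" if "l \<le> N" for l using sat_trans[OF xC x(6)] i that by blast
  define V where "V = poly_values P (polys R A) (C x)"
  have CxC: "C x \<in> carrier P" using xC by simp
  have V: "subring V P" "polys R A \<subseteq> V" unfolding V_def
    using UP.P.subring_poly_values[OF pol.A CxC] UP.P.poly_values_incl by auto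
  note subV = subringE[OF V(1)] and subP = subringE[OF pol.A]
  have CA: "C a \<in> polys R A" if "a \<in> A" for a using C_polys[OF that] subA(2) AC that by blast
  have VC: "q \<in> carrier P" if "q \<in> V" for q using subV(1) that by blast
  have PC: "q \<in> carrier P" if "q \<in> polys R A" for q using polysD(1) that .
  \<comment> \<open>These conditions are stable under sums, so they can be verified on single
    monomials. The denominators \<open>w\<close> are constants since multiplication by a constant
    preserves \<open>cf p1 i = \<zero>\<close>.\<close>
  define G where "G = {H \<in> carrier P. \<exists>w\<in>A - I. \<exists>p0\<in>polys R A. \<exists>p1\<in>polys R A. \<exists>q\<in>V. cf p1 i = \<zero> \<and>
    C w \<otimes>\<^bsub>P\<^esub> H = p0 \<oplus>\<^bsub>P\<^esub> C x \<otimes>\<^bsub>P\<^esub> (p1 \<oplus>\<^bsub>P\<^esub> C x \<otimes>\<^bsub>P\<^esub> q)}"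
  have G: "submod P {} G"
  proof (rule submodI, goal_cases)
    case 1 show ?case unfolding G_def by blast
  next
    case 2
    have "C \<one> \<otimes>\<^bsub>P\<^esub> \<zero>\<^bsub>P\<^esub> = \<zero>\<^bsub>P\<^esub> \<oplus>\<^bsub>P\<^esub> C x \<otimes>\<^bsub>P\<^esub> (\<zero>\<^bsub>P\<^esub> \<oplus>\<^bsub>P\<^esub> C x \<otimes>\<^bsub>P\<^esub> \<zero>\<^bsub>P\<^esub>)" using CxC by simp
    then show ?case unfolding G_def using one_in one_notin subP(2) subV(2)
      by (simp, intro bexI[of _ \<one>] bexI[of _ "\<zero>\<^bsub>P\<^esub>"] conjI) (use CxC in auto)
  next
    case (3 a b)
    then obtain w p0 p1 q w' p0' p1' q' where *: "a \<in> carrier P" "b \<in> carrier P"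
      "w \<in> A" "w \<notin> I" "p0 \<in> polys R A" "p1 \<in> polys R A" "q \<in> V" "cf p1 i = \<zero>"
      "C w \<otimes>\<^bsub>P\<^esub> a = p0 \<oplus>\<^bsub>P\<^esub> C x \<otimes>\<^bsub>P\<^esub> (p1 \<oplus>\<^bsub>P\<^esub> C x \<otimes>\<^bsub>P\<^esub> q)"
      "w' \<in> A" "w' \<notin> I" "p0' \<in> polys R A" "p1' \<in> polys R A" "q' \<in> V" "cf p1' i = \<zero>"
      "C w' \<otimes>\<^bsub>P\<^esub> b = p0' \<oplus>\<^bsub>P\<^esub> C x \<otimes>\<^bsub>P\<^esub> (p1' \<oplus>\<^bsub>P\<^esub> C x \<otimes>\<^bsub>P\<^esub> q')"
      unfolding G_def by blast
    note D = *(1,2) PC[OF *(5)] PC[OF *(6)] VC[OF *(7)] PC[OF *(12)] PC[OF *(13)] VC[OF *(14)]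
      PC[OF CA[OF *(3)]] PC[OF CA[OF *(10)]] CxC
    have "C (w \<otimes> w') \<otimes>\<^bsub>P\<^esub> (a \<oplus>\<^bsub>P\<^esub> b) = C w' \<otimes>\<^bsub>P\<^esub> (C w \<otimes>\<^bsub>P\<^esub> a) \<oplus>\<^bsub>P\<^esub> C w \<otimes>\<^bsub>P\<^esub> (C w' \<otimes>\<^bsub>P\<^esub> b)"
      unfolding C_mult[OF AC[OF *(3)] AC[OF *(10)]] using D by algebra
    also have "\<dots> = (C w' \<otimes>\<^bsub>P\<^esub> p0 \<oplus>\<^bsub>P\<^esub> C w \<otimes>\<^bsub>P\<^esub> p0') \<oplus>\<^bsub>P\<^esub> C x \<otimes>\<^bsub>P\<^esub> ((C w' \<otimes>\<^bsub>P\<^esub> p1 \<oplus>\<^bsub>P\<^esub> C w \<otimes>\<^bsub>P\<^esub> p1')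
        \<oplus>\<^bsub>P\<^esub> C x \<otimes>\<^bsub>P\<^esub> (C w' \<otimes>\<^bsub>P\<^esub> q \<oplus>\<^bsub>P\<^esub> C w \<otimes>\<^bsub>P\<^esub> q'))"
      unfolding *(9,16) using D by algebra
    finally have e: "C (w \<otimes> w') \<otimes>\<^bsub>P\<^esub> (a \<oplus>\<^bsub>P\<^esub> b) = \<dots>" .
    have "C w' \<otimes>\<^bsub>P\<^esub> p0 \<oplus>\<^bsub>P\<^esub> C w \<otimes>\<^bsub>P\<^esub> p0' \<in> polys R A" "C w' \<otimes>\<^bsub>P\<^esub> p1 \<oplus>\<^bsub>P\<^esub> C w \<otimes>\<^bsub>P\<^esub> p1' \<in> polys R A"
      by (intro subP(6,7) CA *)+
    moreover have "C w' \<otimes>\<^bsub>P\<^esub> q \<oplus>\<^bsub>P\<^esub> C w \<otimes>\<^bsub>P\<^esub> q' \<in> V"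
      by (intro subV(6,7) subsetD[OF V(2)] CA *)
    moreover have "w \<otimes> w' \<in> A - I" using unit_mult * by blast
    moreover have "cf (C w' \<otimes>\<^bsub>P\<^esub> p1 \<oplus>\<^bsub>P\<^esub> C w \<otimes>\<^bsub>P\<^esub> p1') i = \<zero>"
      using *(3,8,10,15) D AC by (simp add: coeff_monom_mult del: UP.coeff_mult)
    moreover have "a \<oplus>\<^bsub>P\<^esub> b \<in> carrier P" using D by simp
    ultimately show ?case unfolding G_def using e by blast
  qed simp
  have mon: "monom P (cf F l) l \<in> G" if l: "l \<le> N" "l \<noteq> i" for l
  proof -
    obtain w where w: "w \<in> A" "w \<notin> I" "w \<otimes> cf F l \<in> pv x" using Fx[OF l(1)] by (rule saturationE)
    from poly_values_cases[OF A subring_submod[OF A] xC w(3)] obtain a t where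
      a: "a \<in> A" "t \<in> pv x" "w \<otimes> cf F l = a \<oplus> x \<otimes> t" by blast
    from poly_values_cases[OF A subring_submod[OF A] xC a(2)] obtain b s where
      b: "b \<in> A" "s \<in> pv x" "t = b \<oplus> x \<otimes> s" by blast
    have sC: "s \<in> carrier R" using b pv_carrier[OF xC] by blast
    note D = xC sC AC[OF a(1)] AC[OF b(1)] AC[OF w(1)] cC[of l]
    have m: "monom P c l = C c \<otimes>\<^bsub>P\<^esub> X l" if "c \<in> carrier R" for c
      using UP.monom_mult[of c \<one> 0 l] that by simp
    note DC = UP.monom_closed[OF D(1), of 0] UP.monom_closed[OF D(2), of 0] UP.monom_closed[OF D(3), of 0]
      UP.monom_closed[OF D(4), of 0] UP.monom_closed[OF D(5), of 0] UP.monom_closed[OF D(6), of 0]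
      UP.monom_closed[OF one_closed, of l]
    have "C w \<otimes>\<^bsub>P\<^esub> C (cf F l) = C a \<oplus>\<^bsub>P\<^esub> C x \<otimes>\<^bsub>P\<^esub> (C b \<oplus>\<^bsub>P\<^esub> C x \<otimes>\<^bsub>P\<^esub> C s)"
      using arg_cong[OF a(3), of C] D unfolding b(3) by (simp add: C_mult C_add)
    then have "C w \<otimes>\<^bsub>P\<^esub> monom P (cf F l) l =
        (C a \<oplus>\<^bsub>P\<^esub> C x \<otimes>\<^bsub>P\<^esub> (C b \<oplus>\<^bsub>P\<^esub> C x \<otimes>\<^bsub>P\<^esub> C s)) \<otimes>\<^bsub>P\<^esub> X l"
      unfolding m[OF D(6)] using UP.P.m_assoc[OF DC(5,6,7)] by simp
    also have "\<dots> = C a \<otimes>\<^bsub>P\<^esub> X l \<oplus>\<^bsub>P\<^esub> C x \<otimes>\<^bsub>P\<^esub> (C b \<otimes>\<^bsub>P\<^esub> X l \<oplus>\<^bsub>P\<^esub> C x \<otimes>\<^bsub>P\<^esub> (C s \<otimes>\<^bsub>P\<^esub> X l))"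
      using DC by algebra
    finally have e: "C w \<otimes>\<^bsub>P\<^esub> monom P (cf F l) l = \<dots>" .
    have "C s \<in> V" unfolding V_def by (rule C_poly_values[OF A subring_submod[OF A] xC b(2)])
    then have "C s \<otimes>\<^bsub>P\<^esub> X l \<in> V" using subV(6) V(2) X_polys by blast
    moreover have "C a \<otimes>\<^bsub>P\<^esub> X l \<in> polys R A" "C b \<otimes>\<^bsub>P\<^esub> X l \<in> polys R A" using subP(6) CA a b X_polys by auto
    moreover have "cf (C b \<otimes>\<^bsub>P\<^esub> X l) i = \<zero>" using l D by (simp add: coeff_monom_mult del: UP.coeff_mult)
    moreover have "monom P (cf F l) l \<in> carrier P" using cC by simp
    ultimately show ?thesis unfolding G_def using e w by blast
  qed
  define F' where "F' = (\<Oplus>\<^bsub>P\<^esub>l\<in>{..N} - {i}. monom P (cf F l) l)"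
  have "F' \<in> G" unfolding F'_def by (rule UP.P.finsum_submod[OF G]) (use mon in auto)
  then obtain w p0 p1 q where w: "F' \<in> carrier P" "w \<in> A" "w \<notin> I" "p0 \<in> polys R A" "p1 \<in> polys R A" "q \<in> V"
    "cf p1 i = \<zero>" "C w \<otimes>\<^bsub>P\<^esub> F' = p0 \<oplus>\<^bsub>P\<^esub> C x \<otimes>\<^bsub>P\<^esub> (p1 \<oplus>\<^bsub>P\<^esub> C x \<otimes>\<^bsub>P\<^esub> q)"
    unfolding G_def by blast
  have "F = (\<Oplus>\<^bsub>P\<^esub>l\<in>insert i ({..N} - {i}). monom P (cf F l) l)"
    using UP.up_repr_le[of F N] F i(1) unfolding N_def by (simp add: insert_absorb)
  also have "\<dots> = monom P (cf F i) i \<oplus>\<^bsub>P\<^esub> F'"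
    unfolding F'_def by (rule UP.P.finsum_insert) (use cC in auto)
  also have "monom P (cf F i) i = C (cf F i) \<otimes>\<^bsub>P\<^esub> X i"
    using UP.monom_mult[of "cf F i" \<one> 0 i] cC by simp
  finally have Feq: "F = C (cf F i) \<otimes>\<^bsub>P\<^esub> X i \<oplus>\<^bsub>P\<^esub> F'" .
  have ue: "C u \<otimes>\<^bsub>P\<^esub> C (cf F i) = C x \<oplus>\<^bsub>P\<^esub> C r"
  proof -
    have "C (u \<otimes> cf F i) = C (x \<oplus> r)" by (simp only: x(5))
    then show ?thesis unfolding C_mult[OF AC[OF x(2)] cC] C_add[OF xC AC[OF x(4)]] .
  qed
  have XC: "X i \<in> carrier P" "C (cf F i) \<in> carrier P" using cC by auto
  note D = XC w(1) PC[OF CA[OF w(2)]] PC[OF CA[OF x(2)]] PC[OF CA[OF x(4)]] CxC PC[OF w(4)] PC[OF w(5)] VC[OF w(6)]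
  define p where "p = C w \<otimes>\<^bsub>P\<^esub> X i \<oplus>\<^bsub>P\<^esub> C u \<otimes>\<^bsub>P\<^esub> p1"
  define c where "c = C w \<otimes>\<^bsub>P\<^esub> C r \<otimes>\<^bsub>P\<^esub> X i \<oplus>\<^bsub>P\<^esub> C u \<otimes>\<^bsub>P\<^esub> p0"
  define z where "z = C x \<otimes>\<^bsub>P\<^esub> (p \<oplus>\<^bsub>P\<^esub> C x \<otimes>\<^bsub>P\<^esub> (C u \<otimes>\<^bsub>P\<^esub> q))"
  have pA: "p \<in> polys R A" and cA: "c \<in> polys R A"
    unfolding p_def c_def by (intro subP(6,7) CA w x X_polys)+
  have "cf p i = w"
    unfolding p_def using D w(2,7) x(2) AC by (simp add: coeff_monom_mult del: UP.coeff_mult)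
  then have pI: "p \<notin> polys R I" using w(3) polysD(2) by metis
  have "(C u \<otimes>\<^bsub>P\<^esub> C w) \<otimes>\<^bsub>P\<^esub> F = C w \<otimes>\<^bsub>P\<^esub> ((C u \<otimes>\<^bsub>P\<^esub> C (cf F i)) \<otimes>\<^bsub>P\<^esub> X i) \<oplus>\<^bsub>P\<^esub> C u \<otimes>\<^bsub>P\<^esub> (C w \<otimes>\<^bsub>P\<^esub> F')"
    by (subst Feq) (use D in algebra)
  also have "\<dots> = c \<oplus>\<^bsub>P\<^esub> z"
    unfolding ue w(8) c_def z_def p_def using D by algebra
  finally have e: "(C u \<otimes>\<^bsub>P\<^esub> C w) \<otimes>\<^bsub>P\<^esub> F = c \<oplus>\<^bsub>P\<^esub> z" .
  have uqV: "C u \<otimes>\<^bsub>P\<^esub> q \<in> V" using subV(6)[OF subsetD[OF V(2) CA[OF x(2)]] w(6)] .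
  obtain n k u' where ng: "nilpotent_gen P (polys R A) (polys R I) (C x) n k u'"
    using nilpotent_gen_polys[OF x(1)] by blast
  have gen: "C x \<in> saturation P (polys R A) (polys R I) (poly_values P (polys R A) z)"
    by (rule nilpotent_gen.generator[OF ng pA pI uqV[unfolded V_def] z_def])
  define U where "U = poly_values P (polys R A) F"
  have U: "subring U P" "polys R A \<subseteq> U" unfolding U_def
    using UP.P.subring_poly_values[OF pol.A F] UP.P.poly_values_incl by auto
  note subU = subringE[OF U(1)]
  have FU: "F \<in> U" unfolding U_def by (rule UP.P.poly_values_var[OF pol.A F])
  have zC: "z \<in> carrier P" "c \<in> carrier P" unfolding z_def using D PC[OF pA] PC[OF cA] by auto
  \<comment> \<open>\<open>z\<close> differs from a base multiple of \<open>F\<close> by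
    \<open>c\<close>, so \<open>A[X][z]\<close> is contained in \<open>A[X][F]\<close>.\<close>
  have "z = (C u \<otimes>\<^bsub>P\<^esub> C w) \<otimes>\<^bsub>P\<^esub> F \<oplus>\<^bsub>P\<^esub> \<ominus>\<^bsub>P\<^esub> c" unfolding e using zC by algebra
  also have "\<dots> \<in> U" by (intro subU(5,6,7) FU subsetD[OF U(2)] CA x w cA)
  finally have "poly_values P (polys R A) z \<subseteq> U" by (rule UP.P.poly_values_least[OF U])
  then have CxU: "C x \<in> saturation P (polys R A) (polys R I) U"
    using gen pol.saturation_mono by blast
  have US: "subring (saturation P (polys R A) (polys R I) U) P" by (rule pol.subring_saturation[OF U])
  have "polys R A \<subseteq> saturation P (polys R A) (polys R I) U"
    using U(2) pol.saturation_incl[OF subU(1)] by blast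
  then have "V \<subseteq> saturation P (polys R A) (polys R I) U"
    unfolding V_def by (rule UP.P.poly_values_least[OF US _ CxU])
  then have "saturation P (polys R A) (polys R I) V \<subseteq> saturation P (polys R A) (polys R I) U"
    by (rule pol.saturation_least[OF subU(1)])
  moreover have "C (cf F j) \<in> saturation P (polys R A) (polys R I) V"
    unfolding V_def by (rule C_saturation[OF xC Fx]) (simp add: N_def)
  ultimately show ?thesis unfolding U_def by blast
qed

end

section \<open>Subrings of the Nagata ring\<close>

locale nagata_extension = polynomials R for R (structure) + fixes A
  assumes A: "subring A R"
begin

abbreviation "W \<equiv> unit_content R"
abbreviation "V \<equiv> unit_content (subring_of R A)"
abbreviation "PA \<equiv> polys R A"
abbreviation "L \<equiv> localization P W"
abbreviation "fr \<equiv> fraction P W"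

sublocale M: multiplicative_set P W by (rule multiplicative_unit_content)
sublocale L: cring L by (rule M.localization_cring)

lemma PA_subring: "subring PA P" by (rule subring_polys[OF A])
lemma VW: "g \<in> V \<Longrightarrow> g \<in> W" using unit_content_sub_subset[OF A] by blast
lemma VP: "g \<in> V \<Longrightarrow> g \<in> PA" unfolding unit_content_sub_iff[OF A] by blast
lemma PC: "g \<in> PA \<Longrightarrow> g \<in> carrier P" using polysD(1) .
lemma C_PA: "a \<in> A \<Longrightarrow> C a \<in> PA"
  using C_polys subringE(1,2)[OF A] by blast
lemma X_PA: "X i \<in> PA" by (rule C_polys) (use subringE(2,3)[OF A] in auto)

lemma has_FIP_Nagata_iff: "has_FIP (Nagata R) (Nagata_subring R A) \<longleftrightarrow>
    finite {T. subring T L \<and> fractions P W PA V \<subseteq> T}"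
  unfolding has_FIP_def intermediate_rings_def Nagata_subring_eq[OF A] Nagata_def ..

text \<open>The trace of \<open>T\<close> on the polynomial ring. Elements of \<open>V\<close> are
  units of the subrings considered, so the trace decides membership of all fractions with
  denominator in \<open>V\<close>.\<close>

definition numerators :: "((nat \<Rightarrow> 'a) \<times> (nat \<Rightarrow> 'a)) set set \<Rightarrow> (nat \<Rightarrow> 'a) set" where
  "numerators T = {p \<in> carrier P. fr p \<one>\<^bsub>P\<^esub> \<in> T}"

lemma subring_fractions_of:
  assumes K: "subring K P" "PA \<subseteq> K"
  shows "subring (fractions P W K V) L" "fractions P W PA V \<subseteq> fractions P W K V"
proof -
  show "subring (fractions P W K V) L"
    by (rule M.subring_fractions[OF K(1)])
      (use K VP VW unit_content_sub_monoid[OF A] in auto)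
  show "fractions P W PA V \<subseteq> fractions P W K V"
    unfolding fractions_def using K by blast
qed

context
  fixes T assumes T: "subring T L" "fractions P W PA V \<subseteq> T"
begin

lemma numerators_subring: "subring (numerators T) P"
  unfolding numerators_def by (rule M.subring_contraction[OF T(1)])

lemma PA_numerators: "PA \<subseteq> numerators T"
  unfolding numerators_def using T(2) unit_content_sub_monoid(1)[OF A] PC
  unfolding fractions_def by blast

lemma fraction_mem_numerators:
  assumes "f \<in> carrier P" "g \<in> V"
  shows "fr f g \<in> T \<longleftrightarrow> f \<in> numerators T"
proof -
  have "fr \<one>\<^bsub>P\<^esub> g \<in> T" "fr g \<one>\<^bsub>P\<^esub> \<in> T"
    using T(2) VP[OF assms(2)] unit_content_sub_monoid(1)[OF A] subringE(3)[OF PA_subring] assms(2)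
    unfolding fractions_def by blast+
  from M.fraction_mem_iff[OF T(1) assms(1) VW[OF assms(2)] this]
  show ?thesis unfolding numerators_def using assms(1) by simp
qed

lemma numerators_divide:
  assumes "f \<in> carrier P" "g \<in> V" "g \<otimes>\<^bsub>P\<^esub> f \<in> numerators T"
  shows "f \<in> numerators T"
proof -
  have gC: "g \<in> carrier P" using PC VP assms by blast
  have "fr (g \<otimes>\<^bsub>P\<^esub> f) g \<in> T" using fraction_mem_numerators[of "g \<otimes>\<^bsub>P\<^esub> f" g] assms gC by simp
  moreover have "fr f \<one>\<^bsub>P\<^esub> = fr (g \<otimes>\<^bsub>P\<^esub> f) g"
    by (rule M.fraction_eqI) (use assms gC VW M.one_closed UP.P.m_comm in auto)
  ultimately show ?thesis unfolding numerators_def using assms(1) by simp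
qed

end

lemma subring_constants:
  assumes K: "subring K P" shows "subring {t \<in> carrier R. C t \<in> K} R"
proof (rule subringI, goal_cases)
  case 2
  have "C \<one> = \<one>\<^bsub>P\<^esub>" by (rule UP.monom_one)
  then show ?case using subringE(3)[OF K] by simp
next
  case (3 h) then show ?case using subringE(5)[OF K] UP.monom_a_inv[of h 0] by auto
next
  case (4 a b) then show ?case using subringE(6)[OF K] C_mult[of a b] by auto
next
  case (5 a b) then show ?case using subringE(7)[OF K] C_add[of a b] by auto
qed auto

text \<open>The elements of \<open>A\<close> that multiply \<open>t\<close> into \<open>T\<close>
  form an ideal containing the coefficients of \<open>g\<close>, which generate the unit
  ideal.\<close>

lemma content_one:
  assumes g: "g \<in> V" and t: "t \<in> carrier R" and T: "subring T R" "A \<subseteq> T" "\<And>n. t \<otimes> cf g n \<in> T"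
  shows "t \<in> T"
proof -
  interpret S: cring "subring_of R A" by (rule cring_sub[OF A])
  have AC: "a \<in> A \<Longrightarrow> a \<in> carrier R" for a using subringE(1)[OF A] by blast
  define K where "K = {a \<in> A. t \<otimes> a \<in> T}"
  have "submod (subring_of R A) (carrier (subring_of R A)) K"
  proof (rule submodI, goal_cases)
    case 1 show ?case unfolding K_def by auto
  next
    case 2 show ?case unfolding K_def using subringE(2)[OF A] subringE(2)[OF T(1)] t by simp
  next
    case (3 a b) then show ?case
      unfolding K_def using subringE(7)[OF A] subringE(7)[OF T(1)] AC t by (simp add: r_distr)
  next
    case (4 a b)
    then have "t \<otimes> (a \<otimes> b) = a \<otimes> (t \<otimes> b)" unfolding K_def using AC t by (simp add: m_lcomm)
    then show ?case using 4 subringE(6)[OF A] subringE(6)[OF T(1)] T(2) unfolding K_def by auto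
  qed
  moreover have gK: "cf g n \<in> K" for n unfolding K_def using T(3) polysD(2)[OF VP[OF g]] by blast
  ultimately have "\<one> \<in> K"
  proof (rule_tac ccontr)
    assume K: "submod (subring_of R A) (carrier (subring_of R A)) K" and "\<one> \<notin> K"
    then obtain M where M: "primeideal M (subring_of R A)" "K \<subseteq> M"
      using S.proper_in_prime[of K] by auto
    have "g \<in> polys R M" using gK M(2) PC[OF VP[OF g]] by (intro polysI) blast+
    then show False using g M(1) unfolding unit_content_sub_iff[OF A] by blast
  qed
  then show ?thesis unfolding K_def using t by simp
qed

text \<open>An intermediate ring is extended with denominators from \<open>V\<close> only. If
  \<open>t / 1 = f / g\<close>, cancellation turns this into an equality of polynomials, and
  \<open>content_one\<close> recovers \<open>t\<close> from the coefficients of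
  \<open>f\<close>.\<close>

lemma FIP_of_Nagata_FIP:
  assumes "has_FIP (Nagata R) (Nagata_subring R A)" shows "has_FIP R A"
proof -
  define \<Psi> where "\<Psi> T = fractions P W (polys R T) V" for T
  have sub: "T1 \<subseteq> T2" if T1: "subring T1 R" "A \<subseteq> T1" and T2: "subring T2 R" "A \<subseteq> T2" and e: "\<Psi> T1 = \<Psi> T2" for T1 T2
  proof
    fix t assume t: "t \<in> T1"
    have tC: "t \<in> carrier R" using t subringE(1)[OF T1(1)] by blast
    have "C t \<in> polys R T1" using C_polys[OF t] subringE(2)[OF T1(1)] tC by blast
    then have "fr (C t) \<one>\<^bsub>P\<^esub> \<in> \<Psi> T1" unfolding \<Psi>_def fractions_def
      using unit_content_sub_monoid(1)[OF A] by blast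
    then obtain f g where fg: "f \<in> polys R T2" "g \<in> V" "fr (C t) \<one>\<^bsub>P\<^esub> = fr f g"
      unfolding e unfolding \<Psi>_def fractions_def by blast
    have fC: "f \<in> carrier P" "g \<in> carrier P" using polysD(1)[OF fg(1)] PC[OF VP[OF fg(2)]] by auto
    obtain u where u: "u \<in> W" "u \<otimes>\<^bsub>P\<^esub> (C t \<otimes>\<^bsub>P\<^esub> g) = u \<otimes>\<^bsub>P\<^esub> (f \<otimes>\<^bsub>P\<^esub> \<one>\<^bsub>P\<^esub>)"
      using M.fraction_eq_iff[of "C t" "\<one>\<^bsub>P\<^esub>" f g] fg VW fC tC M.one_closed by auto
    have "C t \<otimes>\<^bsub>P\<^esub> g = f"
      using unit_content_cancel[OF u(1), of "C t \<otimes>\<^bsub>P\<^esub> g" f] u(2) fC tC by simp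
    then have "t \<otimes> cf g n = cf f n" for n
      using coeff_monom_mult[OF tC fC(2), of 0 n] by simp
    then show "t \<in> T2" using polysD(2)[OF fg(1)] by (intro content_one[OF fg(2) tC T2]) simp
  qed
  have "inj_on \<Psi> (intermediate_rings R A)"
    unfolding inj_on_def intermediate_rings_def using sub by (intro ballI impI equalityI) auto
  moreover have "\<Psi> ` intermediate_rings R A \<subseteq> {T. subring T L \<and> fractions P W PA V \<subseteq> T}"
  proof
    fix U assume "U \<in> \<Psi> ` intermediate_rings R A"
    then obtain T where T: "subring T R" "A \<subseteq> T" "U = \<Psi> T" unfolding intermediate_rings_def by blast
    show "U \<in> {T. subring T L \<and> fractions P W PA V \<subseteq> T}"
      unfolding T(3) \<Psi>_def using subring_fractions_of[OF subring_polys[OF T(1)] polys_mono[OF T(2)]] by blast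
  qed
  ultimately show ?thesis
    using assms unfolding has_FIP_Nagata_iff unfolding has_FIP_def
    by (intro finite_imageD[of \<Psi>]) (rule finite_subset)
qed

text \<open>Two of the infinitely many subrings \<open>R(X)[x + X\<^sup>i y]\<close> coincide, so that one of them contains \<open>x\<close>
  and \<open>y\<close>.\<close>

lemma relation_of_Nagata_FIP:
  assumes fip: "has_FIP (Nagata R) (Nagata_subring R A)" and xy: "x \<in> carrier R" "y \<in> carrier R"
  shows "\<exists>i. \<exists>g\<in>V. C x \<otimes>\<^bsub>P\<^esub> g \<in> poly_values P PA (C x \<oplus>\<^bsub>P\<^esub> monom P y i)"
proof -
  define z where "z i = C x \<oplus>\<^bsub>P\<^esub> monom P y i" for i
  have zC: "z i \<in> carrier P" for i unfolding z_def using xy by simp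
  define K where "K i = poly_values P PA (z i)" for i
  have K: "subring (K i) P" "PA \<subseteq> K i" for i
    unfolding K_def using UP.P.subring_poly_values[OF PA_subring zC] UP.P.poly_values_incl by auto
  have zK: "z i \<in> K i" for i unfolding K_def by (rule UP.P.poly_values_var[OF PA_subring zC])
  define T where "T i = fractions P W (K i) V" for i
  have T: "subring (T i) L" "fractions P W PA V \<subseteq> T i" for i
    unfolding T_def using subring_fractions_of[OF K] by auto
  have "range T \<subseteq> {T. subring T L \<and> fractions P W PA V \<subseteq> T}" using T by blast
  then have "finite (range T)" using fip unfolding has_FIP_Nagata_iff by (rule finite_subset)
  then have "\<not> inj T" using finite_imageD infinite_UNIV_nat by blast
  then obtain i j where ij: "i \<noteq> j" "T i = T j" unfolding inj_def by blast
  define N where "N = numerators (T i)"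
  have N: "subring N P" "PA \<subseteq> N" unfolding N_def using numerators_subring PA_numerators T by auto
  note subN = subringE[OF N(1)]
  have zN: "z l \<in> N" if "T l = T i" for l
  proof -
    have "fr (z l) \<one>\<^bsub>P\<^esub> \<in> T l"
      unfolding T_def fractions_def using zK unit_content_sub_monoid(1)[OF A] by blast
    then show ?thesis unfolding N_def numerators_def that using zC by blast
  qed
  have zi: "z i \<in> N" and zj: "z j \<in> N" using zN ij by auto
  \<comment> \<open>The difference of \<open>z j\<close> and \<open>z i\<close> is \<open>e\<close>
    times \<open>C y\<close>. As \<open>i \<noteq> j\<close>, the coefficient of \<open>e\<close> at
    \<open>j\<close> is \<open>\<one>\<close>, so \<open>e\<close> has unit content and can be
    divided out in \<open>N\<close>.\<close>
  define e where "e = X j \<ominus>\<^bsub>P\<^esub> X i"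
  have ePA: "e \<in> PA" unfolding e_def a_minus_def by (intro subringE(5,7)[OF PA_subring] X_PA)
  have "e \<notin> polys R I" if I: "primeideal I (subring_of R A)" for I
  proof
    interpret I: prime_pair R A I by (rule prime_pair_of_primeideal[OF A I])
    assume "e \<in> polys R I"
    then have "cf e j \<in> I" by (rule polysD(2))
    moreover have "cf e j = \<one>" unfolding e_def a_minus_def using ij(1) by (simp)
    ultimately show False using I.one_notin by simp
  qed
  then have eV: "e \<in> V" unfolding unit_content_sub_iff[OF A] using ePA by blast
  have m: "monom P y l = X l \<otimes>\<^bsub>P\<^esub> C y" for l
    using UP.monom_mult[of \<one> y l 0] xy by simp
  have CC: "C x \<in> carrier P" "C y \<in> carrier P" "X i \<in> carrier P" "X j \<in> carrier P" using xy by auto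
  have "e \<otimes>\<^bsub>P\<^esub> C y = z j \<oplus>\<^bsub>P\<^esub> \<ominus>\<^bsub>P\<^esub> z i"
    unfolding e_def z_def m[of i] m[of j] using CC by algebra
  also have "\<dots> \<in> N" by (intro subN(5,7) zi zj)
  finally have "C y \<in> N"
    unfolding N_def by (intro numerators_divide[OF T CC(2) eV])
  then have "monom P y i \<in> N" unfolding m[of i] using subN(6) N(2) X_PA by blast
  then have "z i \<oplus>\<^bsub>P\<^esub> \<ominus>\<^bsub>P\<^esub> monom P y i \<in> N" using zi by (intro subN(5,7))
  moreover have "z i \<oplus>\<^bsub>P\<^esub> \<ominus>\<^bsub>P\<^esub> monom P y i = C x" unfolding z_def m[of i] using CC by algebra
  ultimately have "fr (C x) \<one>\<^bsub>P\<^esub> \<in> T i" unfolding N_def numerators_def by simp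
  then obtain f g where fg: "f \<in> K i" "g \<in> V" "fr (C x) \<one>\<^bsub>P\<^esub> = fr f g"
    unfolding T_def fractions_def by blast
  have fC: "f \<in> carrier P" "g \<in> carrier P" using fg(1) subringE(1)[OF K(1)] PC[OF VP[OF fg(2)]] by auto
  obtain u where u: "u \<in> W" "u \<otimes>\<^bsub>P\<^esub> (C x \<otimes>\<^bsub>P\<^esub> g) = u \<otimes>\<^bsub>P\<^esub> (f \<otimes>\<^bsub>P\<^esub> \<one>\<^bsub>P\<^esub>)"
    using M.fraction_eq_iff[of "C x" "\<one>\<^bsub>P\<^esub>" f g] fg VW fC CC M.one_closed by auto
  have "C x \<otimes>\<^bsub>P\<^esub> g = f"
    using unit_content_cancel[OF u(1), of "C x \<otimes>\<^bsub>P\<^esub> g" f] u(2) fC CC by simp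
  then show ?thesis using fg(1,2) unfolding K_def z_def by metis
qed

text \<open>An arbitrary fraction has a denominator of unit content over the overring, while the
  intermediate rings are only known to invert those of unit content over \<open>A\<close>. The
  multiples of \<open>g\<close> inside \<open>A[X]\<close> form an ideal contained in no
  \<open>I[X]\<close>, so one of them lies in \<open>V\<close>.\<close>

lemma unit_content_multiple:
  assumes loc: "\<And>I. primeideal I (subring_of R A) \<Longrightarrow> \<exists>Q. comparable_prime R A I Q"
    and g: "g \<in> W"
  shows "\<exists>w\<in>carrier P. w \<otimes>\<^bsub>P\<^esub> g \<in> V"
proof -
  have gC: "g \<in> carrier P" using g M.W_carrier by blast
  define K where "K = {w \<otimes>\<^bsub>P\<^esub> g | w. w \<in> carrier P} \<inter> PA"
  note subP = subringE[OF PA_subring]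
  have K: "submod P PA K"
  proof (rule submodI, goal_cases)
    case 1 show ?case unfolding K_def using PC by blast
  next
    case 2
    have "\<zero>\<^bsub>P\<^esub> = \<zero>\<^bsub>P\<^esub> \<otimes>\<^bsub>P\<^esub> g" using gC by simp
    then show ?case unfolding K_def using subP(2) by blast
  next
    case (3 a b)
    then obtain s t where "s \<in> carrier P" "t \<in> carrier P" "a = s \<otimes>\<^bsub>P\<^esub> g" "b = t \<otimes>\<^bsub>P\<^esub> g"
      unfolding K_def by blast
    then have "a \<oplus>\<^bsub>P\<^esub> b = (s \<oplus>\<^bsub>P\<^esub> t) \<otimes>\<^bsub>P\<^esub> g" "s \<oplus>\<^bsub>P\<^esub> t \<in> carrier P" using gC by (simp_all add: UP.P.l_distr)
    then show ?case using 3 subP(7) unfolding K_def by blast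
  next
    case (4 a b)
    then obtain t where "t \<in> carrier P" "b = t \<otimes>\<^bsub>P\<^esub> g" unfolding K_def by blast
    then have "a \<otimes>\<^bsub>P\<^esub> b = (a \<otimes>\<^bsub>P\<^esub> t) \<otimes>\<^bsub>P\<^esub> g" "a \<otimes>\<^bsub>P\<^esub> t \<in> carrier P" using gC PC[OF 4(1)] by (simp_all add: UP.P.m_assoc)
    then show ?case using 4 subP(6) unfolding K_def by blast
  qed
  have "\<exists>h\<in>K. h \<in> V"
  proof (rule ideal_contains_unit_content[OF A K])
    show "K \<subseteq> PA" unfolding K_def by blast
    fix I assume "primeideal I (subring_of R A)"
    then obtain Q where "comparable_prime R A I Q" using loc by blast
    then interpret I: comparable_prime R A I Q .
    have "g \<notin> polys R Q"
      using g I.Q unfolding unit_content_iff polys_def by blast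
    from I.multiple_in_base_polys[OF gC this] show "\<exists>h\<in>K. h \<notin> polys R I" unfolding K_def by blast
  qed
  then show ?thesis unfolding K_def by blast
qed

text \<open>The base polynomials that multiply \<open>C (cf F j)\<close> into the trace form an
  ideal. The local result keeps it out of every \<open>I[X]\<close>, so it meets \<open>V\<close>,
  and elements of \<open>V\<close> can be divided out in the trace.\<close>

lemma coefficient_in_numerators:
  assumes loc: "\<And>I. primeideal I (subring_of R A) \<Longrightarrow> \<exists>Q. comparable_prime R A I Q"
    and T: "subring T L" "fractions P W PA V \<subseteq> T" and F: "F \<in> numerators T"
  shows "C (cf F j) \<in> numerators T"
proof -
  have FC: "F \<in> carrier P" using F unfolding numerators_def by blast
  have sC: "C (cf F j) \<in> carrier P" using FC by simp
  note N = numerators_subring[OF T] and PN = PA_numerators[OF T]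
  note subN = subringE[OF N]
  define K where "K = {h \<in> PA. h \<otimes>\<^bsub>P\<^esub> C (cf F j) \<in> numerators T}"
  have K: "submod P PA K"
  proof (rule submodI, goal_cases)
    case 1 show ?case unfolding K_def using PC by blast
  next
    case 2 show ?case unfolding K_def using subringE(2)[OF PA_subring] subN(2) sC by simp
  next
    case (3 a b) then show ?case
      unfolding K_def using subringE(7)[OF PA_subring] subN(7) PC sC by (simp add: UP.P.l_distr)
  next
    case (4 a b) then show ?case
      unfolding K_def using subringE(6)[OF PA_subring] subN(6) PC sC PN by (auto simp: UP.P.m_assoc)
  qed
  have "\<exists>h\<in>K. h \<in> V"
  proof (rule ideal_contains_unit_content[OF A K])
    show "K \<subseteq> PA" unfolding K_def by blast
    fix I assume "primeideal I (subring_of R A)"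
    then obtain Q where "comparable_prime R A I Q" using loc by blast
    then interpret I: comparable_prime R A I Q .
    obtain h where h: "h \<in> PA" "h \<notin> polys R I" "h \<otimes>\<^bsub>P\<^esub> C (cf F j) \<in> poly_values P PA F"
      using I.coefficient_in_poly_values[OF FC] by (rule saturationE)
    have "poly_values P PA F \<subseteq> numerators T" by (rule UP.P.poly_values_least[OF N PN F])
    then show "\<exists>h\<in>K. h \<notin> polys R I" unfolding K_def using h by blast
  qed
  then show ?thesis using numerators_divide[OF T sC] unfolding K_def by blast
qed

lemma Nagata_FIP_of_FIP:
  assumes loc: "\<And>I. primeideal I (subring_of R A) \<Longrightarrow> \<exists>Q. comparable_prime R A I Q"
    and fip: "has_FIP R A"
  shows "has_FIP (Nagata R) (Nagata_subring R A)"
proof -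
  define \<I> where "\<I> = {T. subring T L \<and> fractions P W PA V \<subseteq> T}"
  define \<Phi> where "\<Phi> T = {t \<in> carrier R. C t \<in> numerators T}" for T
  have sub: "T1 \<subseteq> T2" if "T1 \<in> \<I>" "T2 \<in> \<I>" "\<Phi> T1 = \<Phi> T2" for T1 T2
  proof
    have T1: "subring T1 L" "fractions P W PA V \<subseteq> T1" and T2: "subring T2 L" "fractions P W PA V \<subseteq> T2"
      using that unfolding \<I>_def by auto
    fix h assume h: "h \<in> T1"
    then have "h \<in> carrier L" using subringE(1)[OF T1(1)] by blast
    then obtain f g where fg: "f \<in> carrier P" "g \<in> W" "h = fr f g" by (rule M.fraction_cases)
    have gC: "g \<in> carrier P" using fg M.W_carrier by blast
    \<comment> \<open>Expanding the fraction by \<open>w\<close> moves its denominator into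
      \<open>V\<close>, where it is a unit of both \<open>T1\<close> and \<open>T2\<close>; then
      only the numerator matters.\<close>
    obtain w where w: "w \<in> carrier P" "w \<otimes>\<^bsub>P\<^esub> g \<in> V" using unit_content_multiple[OF loc fg(2)] by blast
    have wf: "w \<otimes>\<^bsub>P\<^esub> f \<in> carrier P" using w fg by simp
    have he: "h = fr (w \<otimes>\<^bsub>P\<^esub> f) (w \<otimes>\<^bsub>P\<^esub> g)" unfolding fg(3)
    proof (rule M.fraction_eqI[OF fg(1,2) wf VW[OF w(2)]])
      show "f \<otimes>\<^bsub>P\<^esub> (w \<otimes>\<^bsub>P\<^esub> g) = w \<otimes>\<^bsub>P\<^esub> f \<otimes>\<^bsub>P\<^esub> g" using w(1) fg(1) gC by algebra
    qed
    have F1: "w \<otimes>\<^bsub>P\<^esub> f \<in> numerators T1" using h unfolding he fraction_mem_numerators[OF T1 wf w(2)] .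
    have "w \<otimes>\<^bsub>P\<^esub> f \<in> numerators T2"
    proof (rule poly_in_subring[OF numerators_subring[OF T2] _ wf])
      show "X i \<in> numerators T2" for i using X_PA PA_numerators[OF T2] by blast
      fix i
      have "cf (w \<otimes>\<^bsub>P\<^esub> f) i \<in> \<Phi> T1"
        unfolding \<Phi>_def using coefficient_in_numerators[OF loc T1 F1, of i] UP.coeff_closed[OF wf, of i] by blast
      then show "C (cf (w \<otimes>\<^bsub>P\<^esub> f) i) \<in> numerators T2" unfolding that(3) unfolding \<Phi>_def by blast
    qed
    then show "h \<in> T2" unfolding he fraction_mem_numerators[OF T2 wf w(2)] .
  qed
  have "inj_on \<Phi> \<I>" unfolding inj_on_def using sub by (intro ballI impI equalityI) auto
  moreover have "\<Phi> ` \<I> \<subseteq> intermediate_rings R A"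
  proof
    fix U assume "U \<in> \<Phi> ` \<I>"
    then obtain T where T: "subring T L" "fractions P W PA V \<subseteq> T" "U = \<Phi> T" unfolding \<I>_def by blast
    have "A \<subseteq> \<Phi> T" unfolding \<Phi>_def using C_PA PA_numerators[OF T(1,2)] subringE(1)[OF A] by blast
    then show "U \<in> intermediate_rings R A"
      unfolding intermediate_rings_def T(3) using subring_constants[OF numerators_subring[OF T(1,2)]]
      unfolding \<Phi>_def by blast
  qed
  ultimately show ?thesis
    using fip unfolding has_FIP_Nagata_iff \<I>_def[symmetric] unfolding has_FIP_def
    by (intro finite_imageD[of \<Phi>]) (rule finite_subset)
qed

end

theorem theorem4p2:
  fixes S :: "('a, 'm) ring_scheme" and R :: "'a set"
  assumes "cring S"
    and "subring R S"
    and "R \<subset> carrier S"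
    and "subintegral S R"
  shows "has_FIP (Nagata S) (Nagata_subring S R) \<longleftrightarrow> has_FIP S R \<and> arithmetic S R"
proof -
  interpret cring S by fact
  interpret S: nagata_extension S R
    by (intro nagata_extension.intro polynomials.intro nagata_extension_axioms.intro assms)
  have prime: "\<exists>Q. subintegral_prime S R M Q" if M: "primeideal M (subring_of S R)" for M
  proof -
    obtain Q where Q: "integral_prime S R M Q"
      using subintegral_integral_prime[OF assms(2,4) M] .
    have "subintegral_prime S R M Q"
      by (intro subintegral_prime.intro Q polynomials.intro assms(1) subintegral_prime_axioms.intro
        subintegral_residue[OF assms(2,4) integral_prime.Q[OF Q]])
    then show ?thesis by blast
  qed
  show ?thesis
  proof
    assume fip: "has_FIP (Nagata S) (Nagata_subring S R)"
    have "chained_at S R M" if M: "primeideal M (subring_of S R)" for M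
    proof -
      obtain Q where "subintegral_prime S R M Q" using prime[OF M] by blast
      then interpret M: subintegral_prime S R M Q .
      have "x \<in> M.sat y \<or> y \<in> M.sat x" if xy: "x \<in> Q" "y \<in> Q" for x y
      proof -
        obtain i g where g: "g \<in> unit_content (subring_of S R)"
          "S.C x \<otimes>\<^bsub>UP S\<^esub> g \<in> poly_values (UP S) (polys S R) (S.C x \<oplus>\<^bsub>UP S\<^esub> monom (UP S) y i)"
          using S.relation_of_Nagata_FIP[OF fip M.subQ(1)[OF xy(1)] M.subQ(1)[OF xy(2)]] by blast
        have "g \<in> polys S R" "g \<notin> polys S M"
          using g(1) M unfolding S.unit_content_sub_iff[OF assms(2)] by auto
        then show ?thesis using M.comparable_of_relation[OF xy _ _ g(2)] by blast
      qed
      then show ?thesis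
        unfolding M.chained_at_iff using M.comparable_of_comparable_in_Q by blast
    qed
    then show "has_FIP S R \<and> arithmetic S R"
      using S.FIP_of_Nagata_FIP[OF fip] unfolding arithmetic_def support_quotient_def by blast
  next
    assume *: "has_FIP S R \<and> arithmetic S R"
    have "\<exists>Q. comparable_prime S R M Q" if M: "primeideal M (subring_of S R)" for M
    proof -
      obtain Q where Q: "subintegral_prime S R M Q" using prime[OF M] by blast
      then interpret M: subintegral_prime S R M Q .
      have "x \<in> M.sat y \<or> y \<in> M.sat x" if xy: "x \<in> carrier S" "y \<in> carrier S" for x y
      proof (cases "M \<in> support_quotient S R")
        case True
        then show ?thesis using * xy M.chained_at_iff unfolding arithmetic_def by blast
      next
        \<comment> \<open>Outside the support, \<open>R\<close> and \<open>S\<close> agree at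
          \<open>M\<close>, so \<open>x\<close> is already in \<open>R\<close> up to a factor from
          \<open>R - M\<close>.\<close>
        case False
        then obtain u where u: "u \<in> R" "u \<notin> M" "u \<otimes>\<^bsub>S\<^esub> x \<in> R"
          using M xy(1) unfolding support_quotient_def by blast
        then have "u \<otimes>\<^bsub>S\<^esub> x \<in> M.pv y" using poly_values_incl by blast
        then show ?thesis using saturationI[OF xy(1) u(1,2)] by blast
      qed
      then have "comparable_prime S R M Q"
        by (intro comparable_prime.intro Q comparable_prime_axioms.intro)
      then show ?thesis by blast
    qed
    then show "has_FIP (Nagata S) (Nagata_subring S R)"
      using S.Nagata_FIP_of_FIP * by blast
  qed
qed

end
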